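(* Let $P$ be a random polytope (or, more generally, a random polyhedral set) in $\mathbb{R}^d$ with almost surely non-empty interior. Assume that the law of $P$ is invariant under orthogonal maps, that is, $OP$ has the same distribution as $P$ for every deterministic orthogonal transformation $O:\mathbb{R}^d\to\mathbb{R}^d$. Let $A:\mathbb{R}^d\to\mathbb{R}^d$ be a deterministic linear map with $\det A\neq 0$. Then for all $j\in\{0,\dots,d-1\}$ and $k\in\{0,\dots,d\}$, $$\mathbb{E}\sum_{G\in\mathcal{F}_j(AP)}\gamma_k\big(T_G(AP)\big)=\mathbb{E}\sum_{F\in\mathcal{F}_j(P)}\gamma_k\big(T_F(P)\big),$$ $$\mathbb{E}\sum_{G\in\mathcal{F}_j(AP)}\upsilon_k\big(T_G(AP)\big)=\mathbb{E}\sum_{F\in\mathcal{F}_j(P)}\upsilon_k\big(T_F(P)\big).$$ In particular (case $k=d$ of the second identity), for all $j\in\{0,\dots,d-1\}$, $$\mathbb{E}\sum_{G\in\mathcal{F}_j(AP)}\alpha\big(T_G(AP)\big)=\mathbb{E}\sum_{F\in\mathcal{F}_j(P)}\alpha\big(T_F(P)\big).$$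
   Context: A polyhedral set is an intersection of finitely many closed half-spaces (whose boundaries need not pass through the origin); a polytope is a bounded polyhedral set; polyhedral cones (positive hulls of finitely many vectors) are special polyhedral sets. $\mathcal{F}_j(P)$ is the set of $j$-dimensional faces of $P$ ($P$ itself being a face). The tangent cone of $P\subset\mathbb{R}^d$ at a face $F$ is $T_F(P)=\{v\in\mathbb{R}^d: f_0+\varepsilon v\in P\text{ for some }\varepsilon>0\}$, where $f_0$ is any point of the relative interior of $F$; the normal cone is the polar cone $N_F(P)=\{w:\langle w,u\rangle\le 0\ \text{for all } u\in T_F(P)\}$. The solid angle of a polyhedral cone $C$ is $\alpha(C)=\mathbb{P}[Z\in C]$ with $Z$ uniformly distributed on the unit sphere of the linear hull of $C$; $\alpha(C)=1$ if $C$ is a linear subspace (including $C=\{0\}$). For a polyhedral cone $C\subset\mathbb{R}^d$ and $k\in\{0,\dots,d\}$, the $k$-th Grassmann angle is $\gamma_k(C)=\mathbb{P}[W_{d-k}\cap C\neq\{0\}]$, where $W_{d-k}$ is a random $(d-k)$-dimensional linear subspace of $\mathbb{R}^d$ with the uniform (rotation invariant) distribution on the Grassmannian, and the $k$-th conic intrinsic volume is $\upsilon_k(C)=\sum_{F\in\mathcal{F}_k(C)}\alpha(F)\,\alpha(N_F(C))$. For a random polyhedral set, these functionals are computed for each realization. *)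

theory Defs
  imports "HOL-Probability.Probability"
begin

text \<open>
  The Borel \<sigma>-algebra of the Fell topology on the closed subsets of a Euclidean space, i.e. the
  usual \<sigma>-algebra for random closed sets. It is generated by the families of closed sets hitting a
  given compact set; on nonempty compact sets it agrees with the Borel \<sigma>-algebra of the Hausdorff
  metric, and on the linear subspaces of a fixed dimension with that of the Grassmannian.
\<close>

definition closed_sets_borel :: "'a::euclidean_space set measure" where
  "closed_sets_borel =
     sigma {F. closed F} {{F. closed F \<and> F \<inter> K \<noteq> {}} | K. compact K}"

definition random_polyhedral_set :: "'w measure \<Rightarrow> ('w \<Rightarrow> 'a::euclidean_space set) \<Rightarrow> bool" where
  "random_polyhedral_set M P \<longleftrightarrow>
     P \<in> M \<rightarrow>\<^sub>M closed_sets_borel \<and> (\<forall>\<omega>\<in>space M. polyhedron (P \<omega>))"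

definition rotation_invariant_law ::
  "'w measure \<Rightarrow> ('w \<Rightarrow> 'a::euclidean_space set) \<Rightarrow> bool" where
  "rotation_invariant_law M P \<longleftrightarrow>
     (\<forall>T. orthogonal_transformation T \<longrightarrow>
        distr M closed_sets_borel (\<lambda>\<omega>. T ` P \<omega>) = distr M closed_sets_borel P)"

text \<open>
  The empty set is a face in the sense of \<^const>\<open>face_of\<close>, but its affine dimension is -1, so it
  never occurs below.
\<close>

definition faces :: "nat \<Rightarrow> 'a::euclidean_space set \<Rightarrow> 'a set set" where
  "faces j P = {F. F face_of P \<and> aff_dim F = int j}"

text \<open>
  For a nonempty face \<open>F\<close> of a convex set \<open>P\<close> the set of directions does not depend on the point
  \<open>f\<close> of the relative interior of \<open>F\<close>.
\<close>

definition tangent_cone :: "'a::euclidean_space set \<Rightarrow> 'a set \<Rightarrow> 'a set" where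
  "tangent_cone F P = {v. \<exists>f\<in>rel_interior F. \<exists>\<epsilon>>0. f + \<epsilon> *\<^sub>R v \<in> P}"

definition normal_cone :: "'a::euclidean_space set \<Rightarrow> 'a set \<Rightarrow> 'a set" where
  "normal_cone F P = {w. \<forall>u\<in>tangent_cone F P. w \<bullet> u \<le> 0}"

text \<open>
  The invariant probability measure on the measurable space \<open>N\<close> under a family \<open>G\<close> of
  transformations. It is used only where \<open>G\<close> is induced by a group of orthogonal maps acting
  transitively on \<open>N\<close> (nonempty), so that the measure exists and is unique.
\<close>

definition uniform_law :: "'b measure \<Rightarrow> ('b \<Rightarrow> 'b) set \<Rightarrow> 'b measure" where
  "uniform_law N G =
     (THE \<mu>. sets \<mu> = sets N \<and> prob_space \<mu> \<and> (\<forall>g\<in>G. distr \<mu> N g = \<mu>))"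

definition uniform_sphere :: "'a::euclidean_space set \<Rightarrow> 'a measure" where
  "uniform_sphere L =
     uniform_law (restrict_space borel (sphere 0 1 \<inter> L))
       {T. orthogonal_transformation T \<and> T ` L = L}"

definition uniform_grassmannian :: "nat \<Rightarrow> 'a::euclidean_space set measure" where
  "uniform_grassmannian m =
     uniform_law (restrict_space closed_sets_borel {W. subspace W \<and> dim W = m})
       {\<lambda>W. T ` W | T. orthogonal_transformation T}"

definition solid_angle :: "'a::euclidean_space set \<Rightarrow> real" where
  "solid_angle C =
     (if subspace C then 1
      else measure (uniform_sphere (span C)) {z \<in> space (uniform_sphere (span C)). z \<in> C})"

definition grassmann_angle :: "nat \<Rightarrow> 'a::euclidean_space set \<Rightarrow> real" where
  "grassmann_angle k C =
     measure (uniform_grassmannian (DIM('a) - k))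
       {W \<in> space (uniform_grassmannian (DIM('a) - k)). W \<inter> C \<noteq> {0}}"

definition conic_intrinsic_volume :: "nat \<Rightarrow> 'a::euclidean_space set \<Rightarrow> real" where
  "conic_intrinsic_volume k C =
     (\<Sum>F\<in>faces k C. solid_angle F * solid_angle (normal_cone F C))"

end

theory Submission
  imports Defs
begin

text \<open>
  Why the theorem is true. Let \<open>\<Phi>\<close> be one of the three functionals of cones. The law of \<open>P\<close> is rotation
  invariant, so \<open>A P\<close> may be replaced by \<open>A X P\<close>, where \<open>X\<close> is an independent Haar distributed orthogonal
  matrix, without changing the expected sum over faces. Given \<open>P\<close>, the tangent cones of \<open>A X P\<close> are the images
  \<open>A X C\<close> of the tangent cones \<open>C\<close> of \<open>P\<close>. It is therefore enough that the average of \<open>\<Phi> (A X C)\<close> over \<open>X\<close> equals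
  \<open>\<Phi> C\<close> for every polyhedral cone \<open>C\<close> (\<open>averaging_functional\<close>, \<open>expected_tangent_sum_invariant\<close>).

  For Grassmann angles this holds because a subspace \<open>W\<close> meets \<open>A X C\<close> outside the origin if and only if the
  uniformly distributed subspace \<open>X\<^sup>T A\<^sup>-\<^sup>1 W\<close> meets \<open>C\<close>. For solid angles, pull a uniform direction in the linear hull
  of \<open>A X C\<close> back by \<open>A X\<close>: for fixed \<open>X\<close> the result is not uniform in the linear hull of \<open>C\<close>, but after averaging
  over \<open>X\<close> its law is invariant under the rotations of that linear hull, hence uniform
  (\<open>cone_angle_average\<close>). For conic intrinsic volumes, the normal cones are transformed by the inverse
  transpose of \<open>A X\<close>, which is \<open>A\<^sup>-\<^sup>T X\<close>. The rotations of the linear hull of a face fix the normal cone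
  pointwise and vice versa, so the argument for solid angles applies to the two factors one after the other
  (\<open>flag_angle_average\<close>). This treats conic intrinsic volumes directly, without expressing them by Grassmann
  angles through the conic Crofton formula.

  Two matters of foundation take up most of the text. The first is measurability, without which the integrals
  could not be exchanged. A random polyhedron is only given as a random element for the Fell \<sigma>-algebra. The metric
  projections of a countable dense set of points to the polyhedron are measurable, and every face contains such a
  projection in its relative interior, because the points projected to a given face fill a set with
  nonempty interior (\<open>closest_point_dense_seq_face\<close>). Thus faces, tangent cones and normal cones can be enumerated
  measurably, and sums over faces become series (\<open>borel_measurable_sum_faces\<close>). The second is that the uniform laws
  on spheres and Grassmannians are introduced by definite descriptions, so existence and uniqueness are needed. A right
  invariant law on the orthogonal group is obtained by orthonormalizing the rows of a random matrix
  (\<open>ex_right_invariant_law\<close>), and uniqueness follows on the spheres from an argument of Christensen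
  (\<open>uniformly_distributed_measures_eq\<close>) and on the Grassmannians from averaging over the orthogonal group
  (\<open>grassmannian_invariant_unique\<close>).
\<close>

section \<open>Random closed sets\<close>

text \<open>
  A fixed dense sequence. Random points of random sets are obtained from it by projection.
\<close>

definition dense_seq :: "nat \<Rightarrow> 'a::euclidean_space" where
  "dense_seq = (SOME f. \<forall>U. open U \<longrightarrow> U \<noteq> {} \<longrightarrow> (\<exists>n. f n \<in> U))"

lemma dense_seq:
  fixes U :: "'a::euclidean_space set"
  assumes "open U" "U \<noteq> {}"
  shows "\<exists>n. dense_seq n \<in> U"
proof -
  obtain D :: "'a set" where D: "countable D" "\<And>U. open U \<Longrightarrow> U \<noteq> {} \<Longrightarrow> \<exists>d\<in>D. d \<in> U"
    using countable_dense_setE by blast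
  have "D \<noteq> {}" using D(2)[of UNIV] by auto
  then have "range (from_nat_into D) = D" using D(1) by (simp add: range_from_nat_into)
  then have "\<forall>U. open U \<longrightarrow> U \<noteq> {} \<longrightarrow> (\<exists>n. from_nat_into D n \<in> U)"
    using D(2) by (metis imageE)
  then have "\<forall>U. open U \<longrightarrow> U \<noteq> {} \<longrightarrow> (\<exists>n. (dense_seq n::'a) \<in> U)"
    unfolding dense_seq_def by (rule someI[where P="\<lambda>f. \<forall>U. open U \<longrightarrow> U \<noteq> {} \<longrightarrow> (\<exists>n. f n \<in> U)"])
  then show ?thesis using assms by blast
qed

lemma dense_seq_near: "e > 0 \<Longrightarrow> \<exists>n. dist (dense_seq n) x < e"
  using dense_seq[of "ball x e"] by (auto simp: dist_commute)

text \<open>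
  The families of sets hitting a compact set generate the \<sigma>-algebra, so only their preimages have to
  be checked.
\<close>

lemma measurable_closed_sets_borelI:
  assumes "\<And>\<omega>. \<omega> \<in> space M \<Longrightarrow> closed (f \<omega>)"
    and "\<And>K. compact K \<Longrightarrow> {\<omega> \<in> space M. f \<omega> \<inter> K \<noteq> {}} \<in> sets M"
  shows "f \<in> M \<rightarrow>\<^sub>M closed_sets_borel"
  unfolding closed_sets_borel_def
proof (rule measurable_measure_of)
  show "f \<in> space M \<rightarrow> {F. closed F}" using assms(1) by auto
  show "f -` Y \<inter> space M \<in> sets M" if Y: "Y \<in> {{F. closed F \<and> F \<inter> K \<noteq> {}} |K. compact K}" for Y
  proof -
    obtain K where K: "Y = {F. closed F \<and> F \<inter> K \<noteq> {}}" "compact K" using Y by auto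
    have "f -` Y \<inter> space M = {\<omega> \<in> space M. f \<omega> \<inter> K \<noteq> {}}" using K assms(1) by auto
    then show ?thesis using assms(2) K by simp
  qed
qed auto

lemma space_closed_sets_borel: "space closed_sets_borel = {F. closed F}"
  unfolding closed_sets_borel_def by (rule space_measure_of) auto

lemma hit_sets_closed_sets_borel:
  assumes "compact K"
  shows "{F. closed F \<and> F \<inter> K \<noteq> {}} \<in> sets closed_sets_borel"
  unfolding closed_sets_borel_def using assms by (subst sets_measure_of) auto

text \<open>
  Nonemptiness is included because distances to the empty set and nearest points in it carry no
  meaning.
\<close>

definition random_nonempty_closed :: "'w measure \<Rightarrow> ('w \<Rightarrow> 'a::euclidean_space set) \<Rightarrow> bool" where
  "random_nonempty_closed M f \<longleftrightarrow> f \<in> M \<rightarrow>\<^sub>M closed_sets_borel \<and> (\<forall>\<omega>\<in>space M. f \<omega> \<noteq> {})"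

lemma random_nonempty_closedD:
  assumes "random_nonempty_closed M f" "\<omega> \<in> space M"
  shows "closed (f \<omega>)" "f \<omega> \<noteq> {}"
  using assms measurable_space[of f M closed_sets_borel \<omega>]
  by (auto simp: random_nonempty_closed_def space_closed_sets_borel)

lemma infdist_less_iff:
  assumes "A \<noteq> {}"
  shows "infdist z A < r \<longleftrightarrow> (\<exists>a\<in>A. dist z a < r)"
proof
  assume "infdist z A < r"
  moreover have "bdd_below (dist z ` A)" by (rule bdd_belowI[of _ 0]) auto
  ultimately show "\<exists>a\<in>A. dist z a < r"
    using assms by (simp add: infdist_notempty cINF_less_iff)
next
  assume "\<exists>a\<in>A. dist z a < r"
  then show "infdist z A < r" using infdist_le le_less_trans by blast
qed

text \<open>
  The distance to a closed set is attained, so it is at most \<open>r\<close> exactly when the set hits a closed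
  ball, which is compact.
\<close>

lemma borel_measurable_infdist_const:
  assumes f: "random_nonempty_closed M f"
  shows "(\<lambda>\<omega>. infdist z (f \<omega>)) \<in> borel_measurable M"
proof (rule borel_measurableI_le)
  fix r
  have fm: "f \<in> M \<rightarrow>\<^sub>M closed_sets_borel" using f by (simp add: random_nonempty_closed_def)
  have "{\<omega> \<in> space M. infdist z (f \<omega>) \<le> r} =
      f -` {F. closed F \<and> F \<inter> cball z r \<noteq> {}} \<inter> space M"
  proof (intro set_eqI iffI)
    fix \<omega> assume *: "\<omega> \<in> {\<omega> \<in> space M. infdist z (f \<omega>) \<le> r}"
    then have "closed (f \<omega>)" "f \<omega> \<noteq> {}" using random_nonempty_closedD[OF f] by auto
    then obtain a where "a \<in> f \<omega>" "infdist z (f \<omega>) = dist z a"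
      using infdist_attains_inf by blast
    then have "a \<in> f \<omega> \<inter> cball z r" using * by auto
    then show "\<omega> \<in> f -` {F. closed F \<and> F \<inter> cball z r \<noteq> {}} \<inter> space M"
      using * \<open>closed (f \<omega>)\<close> by auto
  next
    fix \<omega> assume "\<omega> \<in> f -` {F. closed F \<and> F \<inter> cball z r \<noteq> {}} \<inter> space M"
    then show "\<omega> \<in> {\<omega> \<in> space M. infdist z (f \<omega>) \<le> r}"
      using infdist_le2 by fastforce
  qed
  also have "\<dots> \<in> sets M"
    by (intro measurable_sets[OF fm] hit_sets_closed_sets_borel) auto
  finally show "{\<omega> \<in> space M. infdist z (f \<omega>) \<le> r} \<in> sets M" .
qed

text \<open>
  The distance function is 1-Lipschitz in the point, so the distance from a random point is an infimum
  over a countable dense set of distances from deterministic points.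
\<close>

lemma borel_measurable_infdist_random:
  fixes f :: "'w \<Rightarrow> 'a::euclidean_space set"
  assumes f: "random_nonempty_closed M f" and [measurable]: "Z \<in> borel_measurable M"
  shows "(\<lambda>\<omega>. infdist (Z \<omega>) (f \<omega>)) \<in> borel_measurable M"
proof (rule borel_measurableI_less)
  fix r
  note [measurable] = borel_measurable_infdist_const[OF f]
  have "{\<omega> \<in> space M. infdist (Z \<omega>) (f \<omega>) < r} =
      {\<omega> \<in> space M. \<exists>n. infdist (dense_seq n) (f \<omega>) + dist (Z \<omega>) (dense_seq n) < r}"
  proof (intro set_eqI iffI)
    fix \<omega> assume *: "\<omega> \<in> {\<omega> \<in> space M. infdist (Z \<omega>) (f \<omega>) < r}"
    then obtain n where "dist (dense_seq n) (Z \<omega>) < (r - infdist (Z \<omega>) (f \<omega>)) / 2"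
      using dense_seq_near[of "(r - infdist (Z \<omega>) (f \<omega>)) / 2" "Z \<omega>"] by auto
    moreover have "infdist (dense_seq n) (f \<omega>) \<le> infdist (Z \<omega>) (f \<omega>) + dist (dense_seq n) (Z \<omega>)"
      by (rule infdist_triangle)
    ultimately have "infdist (dense_seq n) (f \<omega>) + dist (Z \<omega>) (dense_seq n) < r"
      by (simp add: dist_commute)
    then show "\<omega> \<in> {\<omega> \<in> space M. \<exists>n. infdist (dense_seq n) (f \<omega>) + dist (Z \<omega>) (dense_seq n) < r}"
      using * by auto
  next
    fix \<omega> assume "\<omega> \<in> {\<omega> \<in> space M. \<exists>n. infdist (dense_seq n) (f \<omega>) + dist (Z \<omega>) (dense_seq n) < r}"
    then show "\<omega> \<in> {\<omega> \<in> space M. infdist (Z \<omega>) (f \<omega>) < r}"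
      using infdist_triangle[of "Z \<omega>" "f \<omega>"] by (force intro: le_less_trans)
  qed
  also have "\<dots> \<in> sets M" by measurable
  finally show "{\<omega> \<in> space M. infdist (Z \<omega>) (f \<omega>) < r} \<in> sets M" .
qed

lemma pred_mem_random_closed:
  assumes f: "random_nonempty_closed M f" and [measurable]: "Z \<in> borel_measurable M"
  shows "Measurable.pred M (\<lambda>\<omega>. Z \<omega> \<in> f \<omega>)"
proof -
  define g where "g \<omega> = infdist (Z \<omega>) (f \<omega>)" for \<omega>
  have [measurable]: "g \<in> borel_measurable M"
    unfolding g_def by (rule borel_measurable_infdist_random[OF f assms(2)])
  have "Measurable.pred M (\<lambda>\<omega>. g \<omega> = 0)" by measurable
  moreover have "Z \<omega> \<in> f \<omega> \<longleftrightarrow> g \<omega> = 0" if "\<omega> \<in> space M" for \<omega>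
    unfolding g_def using random_nonempty_closedD[OF f that] by (rule in_closed_iff_infdist_zero)
  ultimately show ?thesis by (simp cong: measurable_cong)
qed

text \<open>
  The distances to the points of the space determine the Fell \<sigma>-algebra: a closed set hits a compact \<open>K\<close>
  exactly when the distance function, which attains its minimum on \<open>K\<close>, vanishes there, and this can be
  tested on a countable dense subset of \<open>K\<close>.
\<close>

lemma random_nonempty_closedI_infdist:
  fixes f :: "'w \<Rightarrow> 'a::euclidean_space set"
  assumes cl: "\<And>\<omega>. \<omega> \<in> space M \<Longrightarrow> closed (f \<omega>)" and ne: "\<And>\<omega>. \<omega> \<in> space M \<Longrightarrow> f \<omega> \<noteq> {}"
    and m[measurable]: "\<And>z. (\<lambda>\<omega>. infdist z (f \<omega>)) \<in> borel_measurable M"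
  shows "random_nonempty_closed M f"
  unfolding random_nonempty_closed_def
proof (intro conjI ballI ne measurable_closed_sets_borelI cl)
  fix K :: "'a set" assume K: "compact K"
  show "{\<omega> \<in> space M. f \<omega> \<inter> K \<noteq> {}} \<in> sets M"
  proof (cases "K = {}")
    case False
    obtain D where D: "countable D" "D \<subseteq> K" "K \<subseteq> closure D"
      using separable by blast
    have "{\<omega> \<in> space M. f \<omega> \<inter> K \<noteq> {}} =
        {\<omega> \<in> space M. \<forall>n. \<exists>z\<in>D. infdist z (f \<omega>) < 1 / Suc n}" (is "?L = ?R")
    proof (intro set_eqI iffI)
      fix \<omega> assume *: "\<omega> \<in> ?L"
      then obtain y where y: "y \<in> f \<omega>" "y \<in> K" by auto
      have "\<exists>z\<in>D. infdist z (f \<omega>) < 1 / Suc n" for n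
      proof -
        have "y \<in> closure D" using D y by auto
        then obtain z where "z \<in> D" "dist z y < 1 / Suc n"
          using closure_approachable[of y D] by (metis of_nat_0_less_iff zero_less_Suc zero_less_divide_1_iff)
        then show ?thesis using y infdist_le le_less_trans by blast
      qed
      then show "\<omega> \<in> ?R" using * by auto
    next
      fix \<omega> assume *: "\<omega> \<in> ?R"
      then have "closed (f \<omega>)" "f \<omega> \<noteq> {}" using cl ne by auto
      have "continuous_on K (\<lambda>z. infdist z (f \<omega>))" by (intro continuous_intros)
      then obtain z where z: "z \<in> K" "\<And>y. y \<in> K \<Longrightarrow> infdist z (f \<omega>) \<le> infdist y (f \<omega>)"
        using continuous_attains_inf[OF K False] by blast
      have "infdist z (f \<omega>) = 0"
      proof (rule ccontr)
        assume "infdist z (f \<omega>) \<noteq> 0"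
        then have "infdist z (f \<omega>) > 0" using infdist_nonneg[of z "f \<omega>"] by linarith
        then obtain n where "1 / Suc n < infdist z (f \<omega>)" using nat_approx_posE by blast
        moreover obtain y where "y \<in> D" "infdist y (f \<omega>) < 1 / Suc n" using * by auto
        ultimately show False using z(2)[of y] D(2) by fastforce
      qed
      then have "z \<in> f \<omega>" using \<open>closed (f \<omega>)\<close> \<open>f \<omega> \<noteq> {}\<close> in_closed_iff_infdist_zero by blast
      then show "\<omega> \<in> ?L" using z * by auto
    qed
    also have "\<dots> \<in> sets M" using D(1) by measurable
    finally show ?thesis .
  qed simp
qed

text \<open>
  A set-valued map is measurable as soon as it has a Castaing representation, that is, a sequence of
  measurable points which is dense in it. This is the tool for constructing random sets.
\<close>

lemma random_nonempty_closedI_dense: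
  fixes f :: "'w \<Rightarrow> 'a::euclidean_space set" and \<xi> :: "nat \<Rightarrow> 'w \<Rightarrow> 'a"
  assumes [measurable]: "\<And>n. \<xi> n \<in> borel_measurable M"
    and f: "\<And>\<omega>. \<omega> \<in> space M \<Longrightarrow> f \<omega> = closure (range (\<lambda>n. \<xi> n \<omega>))"
  shows "random_nonempty_closed M f"
proof (rule random_nonempty_closedI_infdist)
  show "closed (f \<omega>)" "f \<omega> \<noteq> {}" if "\<omega> \<in> space M" for \<omega> using f[OF that] by auto
  show "(\<lambda>\<omega>. infdist z (f \<omega>)) \<in> borel_measurable M" for z
  proof (rule borel_measurableI_less)
    fix r
    have "infdist z (f \<omega>) < r \<longleftrightarrow> (\<exists>n. dist z (\<xi> n \<omega>) < r)" if "\<omega> \<in> space M" for \<omega>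
    proof -
      have "infdist z (f \<omega>) < r \<longleftrightarrow> (\<exists>a\<in>f \<omega>. dist z a < r)"
        using f[OF that] by (intro infdist_less_iff) auto
      also have "\<dots> \<longleftrightarrow> f \<omega> \<inter> ball z r \<noteq> {}" by auto
      also have "\<dots> \<longleftrightarrow> range (\<lambda>n. \<xi> n \<omega>) \<inter> ball z r \<noteq> {}"
        using open_Int_closure_eq_empty[of "ball z r" "range (\<lambda>n. \<xi> n \<omega>)"] f[OF that] by auto
      also have "\<dots> \<longleftrightarrow> (\<exists>n. dist z (\<xi> n \<omega>) < r)" by (auto simp: disjoint_iff)
      finally show ?thesis .
    qed
    then have "{\<omega> \<in> space M. infdist z (f \<omega>) < r} = {\<omega> \<in> space M. \<exists>n. dist z (\<xi> n \<omega>) < r}" by auto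
    also have "\<dots> \<in> sets M" by measurable
    finally show "{\<omega> \<in> space M. infdist z (f \<omega>) < r} \<in> sets M" .
  qed
qed

text \<open>
  The function \<open>z \<mapsto> (\<bar>z\<bar>\<^sup>2 - d(z)\<^sup>2) / 2\<close>, where \<open>d\<close> is the distance to a closed convex set, has the metric
  projection as its gradient. The coordinates of the projection are therefore limits of difference
  quotients of quantities that are already known to be measurable.
\<close>

lemma borel_measurable_closest_point:
  fixes f :: "'w \<Rightarrow> 'a::euclidean_space set"
  assumes f: "random_nonempty_closed M f" and cv: "\<And>\<omega>. \<omega> \<in> space M \<Longrightarrow> convex (f \<omega>)"
    and [measurable]: "Z \<in> borel_measurable M"
  shows "(\<lambda>\<omega>. closest_point (f \<omega>) (Z \<omega>)) \<in> borel_measurable M"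
proof -
  define \<phi> where "\<phi> z \<omega> = (z \<bullet> z - (infdist z (f \<omega>))\<^sup>2) / 2" for z \<omega>
  have m: "(\<lambda>\<omega>. \<phi> (Z \<omega> + c) \<omega>) \<in> borel_measurable M" for c
  proof -
    have [measurable]: "(\<lambda>\<omega>. infdist (Z \<omega> + c) (f \<omega>)) \<in> borel_measurable M"
      by (intro borel_measurable_infdist_random[OF f]) measurable
    show ?thesis unfolding \<phi>_def by measurable
  qed
  show ?thesis
  proof (rule borel_measurable_euclidean_space[THEN iffD2], intro ballI)
    fix b :: 'a assume b: "b \<in> Basis"
    show "(\<lambda>\<omega>. closest_point (f \<omega>) (Z \<omega>) \<bullet> b) \<in> borel_measurable M"
    proof (rule borel_measurable_LIMSEQ_real)
      show "(\<lambda>\<omega>. (\<phi> (Z \<omega> + (1 / Suc n) *\<^sub>R b) \<omega> - \<phi> (Z \<omega> + 0) \<omega>) * Suc n) \<in> borel_measurable M" for n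
        using m by measurable
      fix \<omega> assume w: "\<omega> \<in> space M"
      let ?p = "closest_point (f \<omega>)" and ?z = "Z \<omega>"
      have S: "closed (f \<omega>)" "f \<omega> \<noteq> {}" "convex (f \<omega>)"
        using random_nonempty_closedD[OF f w] cv[OF w] by auto
      have phi: "\<phi> z \<omega> = z \<bullet> ?p z - (?p z \<bullet> ?p z) / 2" for z
      proof -
        have "infdist z (f \<omega>) = norm (z - ?p z)"
          using setdist_closest_point[OF S(1,2)] by (simp add: infdist_eq_setdist dist_norm)
        then show ?thesis unfolding \<phi>_def
          by (simp add: power2_norm_eq_inner algebra_simps inner_commute diff_divide_distrib add_divide_distrib)
      qed
      have ge: "\<phi> z \<omega> \<ge> z \<bullet> s - (s \<bullet> s) / 2" if "s \<in> f \<omega>" for z s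
      proof -
        have "infdist z (f \<omega>) \<le> norm (z - s)" using infdist_le[OF that, of z] by (simp add: dist_norm)
        then have "(infdist z (f \<omega>))\<^sup>2 \<le> (norm (z - s))\<^sup>2" by (intro power_mono infdist_nonneg) auto
        then show ?thesis unfolding \<phi>_def
          by (simp add: power2_norm_eq_inner algebra_simps inner_commute)
      qed
      have pin: "?p z \<in> f \<omega>" for z using S closest_point_in_set by blast
      (* \<phi> is the supremum over s in the set of the affine functions z \<bullet> s - (s \<bullet> s) / 2, attained at the
         projection; comparing the maximizers at z and at z + h bounds the difference quotient from both sides. *)
      have lo: "?p ?z \<bullet> h \<le> \<phi> (?z + h) \<omega> - \<phi> ?z \<omega>" for h
        using ge[OF pin[of ?z], of "?z + h"] phi[of ?z] by (simp add: inner_add_left inner_commute)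
      have hi: "\<phi> (?z + h) \<omega> - \<phi> ?z \<omega> \<le> ?p (?z + h) \<bullet> h" for h
        using ge[OF pin[of "?z+h"], of "?z"] phi[of "?z+h"] by (simp add: inner_add_left inner_commute)
      let ?h = "\<lambda>n. (1 / real (Suc n)) *\<^sub>R b"
      show "(\<lambda>n. (\<phi> (?z + ?h n) \<omega> - \<phi> (?z + 0) \<omega>) * Suc n) \<longlonglongrightarrow> ?p ?z \<bullet> b"
      proof (rule tendsto_sandwich)
        show "\<forall>\<^sub>F n in sequentially. ?p ?z \<bullet> b \<le> (\<phi> (?z + ?h n) \<omega> - \<phi> (?z + 0) \<omega>) * Suc n"
          using lo[of "?h n" for n] by (auto simp: field_simps)
        show "\<forall>\<^sub>F n in sequentially. (\<phi> (?z + ?h n) \<omega> - \<phi> (?z + 0) \<omega>) * Suc n \<le> ?p (?z + ?h n) \<bullet> b"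
          using hi[of "?h n" for n] by (auto simp: field_simps)
        have "(\<lambda>n. 1 / real (Suc n)) \<longlonglongrightarrow> 0" by (rule LIMSEQ_Suc[OF lim_1_over_n])
        then have "(\<lambda>n. ?z + ?h n) \<longlonglongrightarrow> ?z + 0 *\<^sub>R b" by (intro tendsto_intros)
        then have "(\<lambda>n. ?p (?z + ?h n)) \<longlonglongrightarrow> ?p ?z"
          using continuous_at_closest_point[OF S(3,1,2)] isCont_tendsto_compose by fastforce
        then show "(\<lambda>n. ?p (?z + ?h n) \<bullet> b) \<longlonglongrightarrow> ?p ?z \<bullet> b" by (intro tendsto_intros)
      qed simp
    qed
  qed
qed

text \<open>
  Projections are 1-Lipschitz and fix the set, so they carry a dense sequence to a dense sequence.
\<close>

lemma closure_range_closest_point: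
  fixes S :: "'a::euclidean_space set"
  assumes "closed S" "convex S" "S \<noteq> {}"
  shows "closure (range (\<lambda>n. closest_point S (dense_seq n))) = S"
proof
  show "closure (range (\<lambda>n. closest_point S (dense_seq n))) \<subseteq> S"
    using assms closest_point_in_set by (intro closure_minimal) auto
  show "S \<subseteq> closure (range (\<lambda>n. closest_point S (dense_seq n)))"
  proof
    fix x assume x: "x \<in> S"
    show "x \<in> closure (range (\<lambda>n. closest_point S (dense_seq n)))"
      unfolding closure_approachable
    proof (intro allI impI)
      fix e :: real assume "e > 0"
      then obtain n where n: "dist (dense_seq n) x < e" using dense_seq_near by blast
      have "dist (closest_point S (dense_seq n)) (closest_point S x) \<le> dist (dense_seq n) x"
        using assms by (intro closest_point_lipschitz)
      then show "\<exists>y\<in>range (\<lambda>n. closest_point S (dense_seq n)). dist y x < e"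
        using n x by (auto simp: closest_point_self intro: le_less_trans)
    qed
  qed
qed

text \<open>
  Conversely, a random closed convex set has a Castaing representation, given by the projections of the
  points of a dense sequence.
\<close>

lemma random_closed_dense_seq:
  fixes f :: "'w \<Rightarrow> 'a::euclidean_space set"
  assumes f: "random_nonempty_closed M f" and cv: "\<And>\<omega>. \<omega> \<in> space M \<Longrightarrow> convex (f \<omega>)"
  obtains \<xi> :: "nat \<Rightarrow> 'w \<Rightarrow> 'a" where "\<And>n. \<xi> n \<in> borel_measurable M"
    "\<And>\<omega>. \<omega> \<in> space M \<Longrightarrow> f \<omega> = closure (range (\<lambda>n. \<xi> n \<omega>))"
proof
  show "(\<lambda>\<omega>. closest_point (f \<omega>) (dense_seq n)) \<in> borel_measurable M" for n
    by (rule borel_measurable_closest_point[OF f cv]) auto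
  show "f \<omega> = closure (range (\<lambda>n. closest_point (f \<omega>) (dense_seq n)))" if "\<omega> \<in> space M" for \<omega>
    using closure_range_closest_point random_nonempty_closedD[OF f that] cv[OF that] by metis
qed

lemma random_nonempty_closed_image:
  fixes f :: "'w \<Rightarrow> 'a::euclidean_space set" and T :: "'w \<Rightarrow> 'a \<Rightarrow> 'b::euclidean_space"
  assumes f: "random_nonempty_closed M f" and cv: "\<And>\<omega>. \<omega> \<in> space M \<Longrightarrow> convex (f \<omega>)"
    and T: "\<And>Z. Z \<in> borel_measurable M \<Longrightarrow> (\<lambda>\<omega>. T \<omega> (Z \<omega>)) \<in> borel_measurable M"
    and ct: "\<And>\<omega>. \<omega> \<in> space M \<Longrightarrow> continuous_on UNIV (T \<omega>)"
    and cl: "\<And>\<omega>. \<omega> \<in> space M \<Longrightarrow> closed (T \<omega> ` f \<omega>)"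
  shows "random_nonempty_closed M (\<lambda>\<omega>. T \<omega> ` f \<omega>)"
proof -
  obtain \<xi> :: "nat \<Rightarrow> 'w \<Rightarrow> 'a" where \<xi>: "\<And>n. \<xi> n \<in> borel_measurable M"
    "\<And>\<omega>. \<omega> \<in> space M \<Longrightarrow> f \<omega> = closure (range (\<lambda>n. \<xi> n \<omega>))"
    using random_closed_dense_seq[OF f cv] by blast
  show ?thesis
  proof (rule random_nonempty_closedI_dense[of "\<lambda>n \<omega>. T \<omega> (\<xi> n \<omega>)"])
    show "(\<lambda>\<omega>. T \<omega> (\<xi> n \<omega>)) \<in> borel_measurable M" for n using T \<xi>(1) by blast
    fix \<omega> assume w: "\<omega> \<in> space M"
    have *: "range (\<lambda>n. T \<omega> (\<xi> n \<omega>)) = T \<omega> ` range (\<lambda>n. \<xi> n \<omega>)" by auto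
    show "T \<omega> ` f \<omega> = closure (range (\<lambda>n. T \<omega> (\<xi> n \<omega>)))"
      unfolding *
    proof
      show "T \<omega> ` f \<omega> \<subseteq> closure (T \<omega> ` range (\<lambda>n. \<xi> n \<omega>))"
        using ct[OF w] \<xi>(2)[OF w]
        by (metis closed_closure closure_subset continuous_on_subset image_closure_subset subset_UNIV)
      show "closure (T \<omega> ` range (\<lambda>n. \<xi> n \<omega>)) \<subseteq> T \<omega> ` f \<omega>"
      proof (rule closure_minimal)
        have "range (\<lambda>n. \<xi> n \<omega>) \<subseteq> f \<omega>" using \<xi>(2)[OF w] closure_subset by metis
        then show "T \<omega> ` range (\<lambda>n. \<xi> n \<omega>) \<subseteq> T \<omega> ` f \<omega>" by (rule image_mono)
      qed (rule cl[OF w])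
    qed
  qed
qed

text \<open>
  Closing up under limits turns rational scalars into real ones.
\<close>

lemma subspace_closure_rational_combinations:
  fixes R :: "'a::euclidean_space set"
  assumes "0 \<in> R" "\<And>x y. x \<in> R \<Longrightarrow> y \<in> R \<Longrightarrow> x + y \<in> R"
    "\<And>c x. x \<in> R \<Longrightarrow> real_of_rat c *\<^sub>R x \<in> R"
  shows "subspace (closure R)"
proof (rule subspaceI)
  show "0 \<in> closure R" using assms(1) closure_subset by auto
  show "x + y \<in> closure R" if xy: "x \<in> closure R" "y \<in> closure R" for x y
  proof -
    obtain a b where ab: "\<And>n. a n \<in> R" "a \<longlonglongrightarrow> x" "\<And>n. b n \<in> R" "b \<longlonglongrightarrow> y"
      using xy unfolding closure_sequential by blast
    then have "\<forall>n. a n + b n \<in> R" "(\<lambda>n. a n + b n) \<longlonglongrightarrow> x + y"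
      using assms(2) by (auto intro: tendsto_add)
    then show ?thesis unfolding closure_sequential by (intro exI[of _ "\<lambda>n. a n + b n"]) blast
  qed
  show "c *\<^sub>R x \<in> closure R" if x: "x \<in> closure R" for c x
  proof -
    obtain a where a: "\<And>n. a n \<in> R" "a \<longlonglongrightarrow> x" using x unfolding closure_sequential by blast
    have "\<exists>q. \<bar>real_of_rat q - c\<bar> < 1 / Suc n" for n
    proof -
      have "c < c + 1 / Suc n" by simp
      then obtain q where "c < real_of_rat q" "real_of_rat q < c + 1 / Suc n"
        using of_rat_dense by blast
      then show ?thesis by (intro exI[of _ q]) auto
    qed
    then obtain q where q: "\<And>n. \<bar>real_of_rat (q n) - c\<bar> < 1 / Suc n" by metis
    have "(\<lambda>n. real_of_rat (q n) - c) \<longlonglongrightarrow> 0"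
      by (rule Lim_null_comparison[OF _ LIMSEQ_Suc[OF lim_1_over_n]])
        (use q in \<open>auto intro!: always_eventually less_imp_le\<close>)
    then have "(\<lambda>n. real_of_rat (q n)) \<longlonglongrightarrow> c" by (simp add: LIM_zero_iff)
    then have "(\<lambda>n. real_of_rat (q n) *\<^sub>R a n) \<longlonglongrightarrow> c *\<^sub>R x" using a by (intro tendsto_scaleR)
    moreover have "\<forall>n. real_of_rat (q n) *\<^sub>R a n \<in> R" using a assms(3) by auto
    ultimately show ?thesis
      unfolding closure_sequential by (intro exI[of _ "\<lambda>n. real_of_rat (q n) *\<^sub>R a n"] conjI)
  qed
qed

text \<open>
  The finite rational linear combinations of a countable generating family are countable in number and
  dense in the span. They are indexed here by lists of pairs of a coefficient and an index.
\<close>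

lemma random_nonempty_closed_span:
  fixes \<xi> :: "nat \<Rightarrow> 'w \<Rightarrow> 'a::euclidean_space"
  assumes [measurable]: "\<And>n. \<xi> n \<in> borel_measurable M"
    and f: "\<And>\<omega>. \<omega> \<in> space M \<Longrightarrow> f \<omega> \<subseteq> closure (range (\<lambda>n. \<xi> n \<omega>))"
    and g: "\<And>\<omega>. \<omega> \<in> space M \<Longrightarrow> range (\<lambda>n. \<xi> n \<omega>) \<subseteq> span (f \<omega>)"
  shows "random_nonempty_closed M (\<lambda>\<omega>. span (f \<omega>))"
proof -
  define C where "C l \<omega> = (\<Sum>(c, n)\<leftarrow>l. real_of_rat c *\<^sub>R \<xi> n \<omega>)" for l :: "(rat \<times> nat) list" and \<omega>
  have C_append: "C (k @ l) \<omega> = C k \<omega> + C l \<omega>" for k l \<omega> by (simp add: C_def)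
  have C_Nil: "C [] \<omega> = 0" for \<omega> by (simp add: C_def)
  have C_Cons: "C ((c, n) # l) \<omega> = real_of_rat c *\<^sub>R \<xi> n \<omega> + C l \<omega>" for c n l \<omega> by (simp add: C_def)
  have C_scale: "real_of_rat c *\<^sub>R C l \<omega> = C (map (\<lambda>(d, n). (c * d, n)) l) \<omega>" for c l \<omega>
    by (induction l) (auto simp: C_def of_rat_mult scaleR_right_distrib)
  show ?thesis
  proof (rule random_nonempty_closedI_dense[of "\<lambda>i. C (from_nat i)"])
    have "C l \<in> borel_measurable M" for l
    proof (induction l)
      case Nil
      then show ?case by (simp add: C_Nil[abs_def])
    next
      case (Cons a l)
      obtain c n where a: "a = (c, n)" by (cases a)
      have [measurable]: "C l \<in> borel_measurable M" by fact
      have "C (a # l) = (\<lambda>\<omega>. real_of_rat c *\<^sub>R \<xi> n \<omega> + C l \<omega>)" using a C_Cons by auto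
      then show ?case by simp
    qed
    then show "C (from_nat i) \<in> borel_measurable M" for i .
    fix \<omega> assume w: "\<omega> \<in> space M"
    let ?R = "range (\<lambda>i. C (from_nat i) \<omega>)"
    have R: "?R = range (\<lambda>l. C l \<omega>)"
    proof -
      have "(\<lambda>l. C l \<omega>) ` range from_nat = range (\<lambda>l. C l \<omega>)" by (simp only: surj_from_nat)
      then show ?thesis by (simp only: image_image)
    qed
    have sub: "subspace (closure ?R)"
      unfolding R
    proof (rule subspace_closure_rational_combinations)
      show "0 \<in> range (\<lambda>l. C l \<omega>)" using C_Nil by (metis rangeI)
      show "x + y \<in> range (\<lambda>l. C l \<omega>)" if "x \<in> range (\<lambda>l. C l \<omega>)" "y \<in> range (\<lambda>l. C l \<omega>)" for x y
        using that by (auto simp: C_append[symmetric])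
      show "real_of_rat c *\<^sub>R x \<in> range (\<lambda>l. C l \<omega>)" if "x \<in> range (\<lambda>l. C l \<omega>)" for x c
        using that by (auto simp: C_scale)
    qed
    have "\<xi> n \<omega> \<in> range (\<lambda>l. C l \<omega>)" for n
      by (rule image_eqI[of _ _ "[(1, n)]"]) (auto simp: C_def)
    then have "range (\<lambda>n. \<xi> n \<omega>) \<subseteq> ?R" unfolding R by auto
    then have "f \<omega> \<subseteq> closure ?R" using f[OF w] closure_mono by blast
    then have 1: "span (f \<omega>) \<subseteq> closure ?R" using sub by (rule span_minimal)
    have "C l \<omega> \<in> span (f \<omega>)" for l
    proof (induction l)
      case (Cons a l)
      then show ?case using g[OF w] by (cases a) (auto simp: C_Cons intro!: span_add span_mul)
    qed (simp add: C_Nil span_zero)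
    then have "closure ?R \<subseteq> span (f \<omega>)"
      by (intro closure_minimal closed_subspace) auto
    then show "span (f \<omega>) = closure ?R" using 1 by auto
  qed
qed

section \<open>Tangent cones and faces of polyhedra\<close>

text \<open>
  The directions in which one can leave the point \<open>y\<close> while staying in \<open>P\<close>; for a point of the relative
  interior of a face this is the tangent cone at that face. Working with points instead of faces makes
  tangent cones accessible to measurable selections.
\<close>

definition dir_cone :: "'a::euclidean_space \<Rightarrow> 'a set \<Rightarrow> 'a set" where
  "dir_cone y P = {v. \<exists>e>0. y + e *\<^sub>R v \<in> P}"

text \<open>
  For \<open>y \<in> P\<close>, the points \<open>p\<close> of \<open>P\<close> such that the segment from \<open>p\<close> to \<open>y\<close> can be prolonged beyond \<open>y\<close>
  inside \<open>P\<close>: the smallest face of \<open>P\<close> containing \<open>y\<close>.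
\<close>

definition face_at :: "'a::euclidean_space \<Rightarrow> 'a set \<Rightarrow> 'a set" where
  "face_at y P = {p \<in> P. y - p \<in> dir_cone y P}"

lemma dir_cone_smaller_step:
  assumes "convex P" "y \<in> P" "y + e *\<^sub>R v \<in> P" "0 \<le> d" "d \<le> e"
  shows "y + d *\<^sub>R v \<in> P"
proof (cases "e = 0")
  case False
  then have "e > 0" using assms by linarith
  have "(1 - d/e) *\<^sub>R y + (d/e) *\<^sub>R (y + e *\<^sub>R v) \<in> P"
    using assms \<open>e > 0\<close> by (intro convexD) auto
  also have "(1 - d/e) *\<^sub>R y + (d/e) *\<^sub>R (y + e *\<^sub>R v) = y + d *\<^sub>R v"
    using \<open>e > 0\<close> by (simp add: algebra_simps)
  finally show ?thesis .
qed (use assms in auto)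

lemma dir_cone_Int:
  assumes "convex A" "convex B" "y \<in> A" "y \<in> B"
  shows "dir_cone y (A \<inter> B) = dir_cone y A \<inter> dir_cone y B"
proof
  show "dir_cone y A \<inter> dir_cone y B \<subseteq> dir_cone y (A \<inter> B)"
  proof
    fix v assume "v \<in> dir_cone y A \<inter> dir_cone y B"
    then obtain d e where de: "d > 0" "y + d *\<^sub>R v \<in> A" "e > 0" "y + e *\<^sub>R v \<in> B"
      by (auto simp: dir_cone_def)
    then have "y + min d e *\<^sub>R v \<in> A" "y + min d e *\<^sub>R v \<in> B"
      using dir_cone_smaller_step[of A y d v "min d e"] dir_cone_smaller_step[of B y e v "min d e"] assms
      by auto
    then show "v \<in> dir_cone y (A \<inter> B)"
      using de unfolding dir_cone_def by (intro CollectI exI[of _ "min d e"]) auto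
  qed
qed (auto simp: dir_cone_def)

lemma dir_cone_halfspace:
  assumes "a \<bullet> y \<le> b"
  shows "dir_cone y {x. a \<bullet> x \<le> b} = (if a \<bullet> y < b then UNIV else {v. a \<bullet> v \<le> 0})"
proof (cases "a \<bullet> y < b")
  case True
  have "v \<in> dir_cone y {x. a \<bullet> x \<le> b}" for v
  proof -
    define e where "e = (b - a \<bullet> y) / (1 + \<bar>a \<bullet> v\<bar>)"
    have "e > 0" using True by (simp add: e_def add_pos_nonneg)
    have "e * (a \<bullet> v) \<le> e * (1 + \<bar>a \<bullet> v\<bar>)" using \<open>e > 0\<close> by (intro mult_left_mono) auto
    also have "\<dots> = b - a \<bullet> y"
      unfolding e_def by (simp add: add_nonneg_eq_0_iff)
    finally have "a \<bullet> (y + e *\<^sub>R v) \<le> b" by (simp add: inner_add_right)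
    then show ?thesis using \<open>e > 0\<close> by (auto simp: dir_cone_def)
  qed
  then show ?thesis using True by auto
next
  case False
  then have "a \<bullet> y = b" using assms by simp
  then show ?thesis
    by (auto simp: dir_cone_def inner_add_right mult_le_0_iff intro: exI[of _ 1])
qed

lemma zero_in_dir_cone: "y \<in> P \<Longrightarrow> 0 \<in> dir_cone y P"
  by (auto simp: dir_cone_def intro: exI[of _ 1])

text \<open>
  Only the half-spaces whose boundary passes through \<open>y\<close> restrict the directions; each contributes the
  parallel half-space through the origin.
\<close>

lemma polyhedron_dir_cone:
  assumes "polyhedron P" "y \<in> P"
  shows "polyhedron (dir_cone y P)"
proof -
  obtain H where H: "finite H" "P = \<Inter>H" "\<And>h. h \<in> H \<Longrightarrow> \<exists>a b. a \<noteq> 0 \<and> h = {x. a \<bullet> x \<le> b}"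
    using assms(1) unfolding polyhedron_def by blast
  have "y \<in> \<Inter>H" using assms H by simp
  from H(1) H(3) this have "polyhedron (dir_cone y (\<Inter>H))"
  proof (induction H rule: finite_induct)
    case empty
    have "dir_cone y UNIV = UNIV" by (auto simp: dir_cone_def intro: exI[of _ 1])
    then show ?case by simp
  next
    case (insert h H)
    obtain a b where h: "h = {x. a \<bullet> x \<le> b}" using insert(4) by blast
    have cv: "convex h" "convex (\<Inter>H)"
    proof -
      show "convex h" by (simp add: h convex_halfspace_le)
      show "convex (\<Inter>H)"
      proof (rule convex_Inter)
        show "\<And>k. k \<in> H \<Longrightarrow> convex k" using insert(4) convex_halfspace_le by (metis insertCI)
      qed
    qed
    have y: "a \<bullet> y \<le> b" "y \<in> \<Inter>H" using insert(5) h by auto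
    have "dir_cone y (\<Inter>(insert h H)) = dir_cone y h \<inter> dir_cone y (\<Inter>H)"
      using dir_cone_Int[OF cv] y h by simp
    moreover have "polyhedron (dir_cone y h)"
      unfolding h dir_cone_halfspace[OF y(1)] by (simp add: polyhedron_halfspace_le)
    ultimately show ?case using insert.IH insert(4) y(2) by simp
  qed
  then show ?thesis using H by simp
qed

lemma cone_dir_cone:
  assumes "convex P" "y \<in> P"
  shows "cone (dir_cone y P)"
  unfolding cone_def
proof (intro ballI allI impI)
  fix v and c :: real assume v: "v \<in> dir_cone y P" and c: "c \<ge> 0"
  then obtain e where e: "e > 0" "y + e *\<^sub>R v \<in> P" by (auto simp: dir_cone_def)
  show "c *\<^sub>R v \<in> dir_cone y P"
  proof (cases "c = 0")
    case True
    then show ?thesis using assms by (auto simp: dir_cone_def intro: exI[of _ 1])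
  next
    case False
    then have "e / c > 0" "y + (e / c) *\<^sub>R (c *\<^sub>R v) \<in> P" using c e by auto
    then show ?thesis unfolding dir_cone_def by blast
  qed
qed

text \<open>
  If the segment from a point between \<open>a\<close> and \<open>b\<close> can be prolonged beyond \<open>y\<close>, then a convex combination
  of the end of that segment with \<open>b\<close> lies on the prolongation of the segment from \<open>a\<close>.
\<close>

lemma face_at_convex_step:
  assumes "convex P" "y \<in> P" "a \<in> P" "b \<in> P" "0 \<le> u" "u < 1"
    "(1 - u) *\<^sub>R a + u *\<^sub>R b \<in> face_at y P"
  shows "a \<in> face_at y P"
proof -
  obtain e where e: "e > 0" "y + e *\<^sub>R (y - ((1 - u) *\<^sub>R a + u *\<^sub>R b)) \<in> P" (is "?z \<in> P")
    using assms(7) by (auto simp: face_at_def dir_cone_def)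
  have pos: "1 + e * u > 0" using e assms by (simp add: add_pos_nonneg)
  have "(1 / (1 + e * u)) *\<^sub>R ?z + (e * u / (1 + e * u)) *\<^sub>R b \<in> P"
    using assms e pos by (intro convexD) (auto simp: field_simps)
  also have "(1 / (1 + e * u)) *\<^sub>R ?z + (e * u / (1 + e * u)) *\<^sub>R b =
      (1 / (1 + e * u)) *\<^sub>R ((1 + e * u) *\<^sub>R y + (e * (1 - u)) *\<^sub>R (y - a))"
    by (simp add: algebra_simps)
  also have "\<dots> = y + (e * (1 - u) / (1 + e * u)) *\<^sub>R (y - a)"
    using pos by (simp add: scaleR_add_right)
  finally show ?thesis
    using assms e pos unfolding face_at_def dir_cone_def
    by (intro CollectI conjI exI[of _ "e * (1 - u) / (1 + e * u)"]) auto
qed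

lemma face_at_face_of:
  assumes P: "convex P" "y \<in> P"
  shows "face_at y P face_of P" "y \<in> rel_interior (face_at y P)"
proof -
  have cv: "convex (face_at y P)"
  proof (rule convexI)
    fix p q and u v :: real
    assume pq: "p \<in> face_at y P" "q \<in> face_at y P" and uv: "0 \<le> u" "0 \<le> v" "u + v = 1"
    then obtain d e where de: "d > 0" "y + d *\<^sub>R (y - p) \<in> P" "e > 0" "y + e *\<^sub>R (y - q) \<in> P"
      and in_P: "p \<in> P" "q \<in> P"
      by (auto simp: dir_cone_def face_at_def)
    define m where "m = min d e"
    have m: "m > 0" "y + m *\<^sub>R (y - p) \<in> P" "y + m *\<^sub>R (y - q) \<in> P"
      using de dir_cone_smaller_step[OF P] unfolding m_def by auto
    have "u *\<^sub>R (y + m *\<^sub>R (y - p)) + v *\<^sub>R (y + m *\<^sub>R (y - q)) \<in> P"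
      using P m uv by (intro convexD) auto
    also have "u *\<^sub>R (y + m *\<^sub>R (y - p)) + v *\<^sub>R (y + m *\<^sub>R (y - q)) =
       (u + v) *\<^sub>R y + m *\<^sub>R ((u + v) *\<^sub>R y - (u *\<^sub>R p + v *\<^sub>R q))"
      by (simp add: algebra_simps)
    finally have "y + m *\<^sub>R (y - (u *\<^sub>R p + v *\<^sub>R q)) \<in> P" using uv by simp
    moreover have "u *\<^sub>R p + v *\<^sub>R q \<in> P" using P in_P uv by (intro convexD) auto
    ultimately show "u *\<^sub>R p + v *\<^sub>R q \<in> face_at y P"
      using m(1) unfolding face_at_def dir_cone_def by blast
  qed
  show "face_at y P face_of P"
    unfolding face_of_def
  proof (intro conjI ballI impI cv)
    show "face_at y P \<subseteq> P" by (auto simp: face_at_def)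
    fix a b x assume ab: "a \<in> P" "b \<in> P" "x \<in> face_at y P" "x \<in> open_segment a b"
    then obtain u where u: "0 < u" "u < 1" "x = (1 - u) *\<^sub>R a + u *\<^sub>R b"
      by (auto simp: in_segment)
    show "a \<in> face_at y P" using face_at_convex_step[OF P ab(1,2), of u] u ab by auto
    have "x = (1 - (1 - u)) *\<^sub>R b + (1 - u) *\<^sub>R a" using u by simp
    then show "b \<in> face_at y P" using face_at_convex_step[OF P ab(2,1), of "1 - u"] u ab by (auto simp: add.commute)
  qed
  have y: "y \<in> face_at y P" using P by (auto simp: face_at_def dir_cone_def intro: exI[of _ 1])
  have "\<exists>e>1. (1 - e) *\<^sub>R p + e *\<^sub>R y \<in> face_at y P" if p: "p \<in> face_at y P" for p
  proof -
    obtain e where e: "e > 0" "y + e *\<^sub>R (y - p) \<in> P" and "p \<in> P"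
      using p by (auto simp: face_at_def dir_cone_def)
    (* The prolonged point belongs to the face because prolonging from it beyond y leads back to p. *)
    have "y + (1 / e) *\<^sub>R (y - (y + e *\<^sub>R (y - p))) = p" using e by simp
    then have "y + e *\<^sub>R (y - p) \<in> face_at y P"
      unfolding face_at_def dir_cone_def using e \<open>p \<in> P\<close>
      by (intro CollectI conjI exI[of _ "1 / e"]) auto
    moreover have "(1 - (1 + e)) *\<^sub>R p + (1 + e) *\<^sub>R y = y + e *\<^sub>R (y - p)"
      by (simp add: algebra_simps)
    ultimately show ?thesis using e(1) by (intro exI[of _ "1 + e"]) auto
  qed
  then show "y \<in> rel_interior (face_at y P)"
    using convex_rel_interior_iff[OF cv] y by blast
qed

text \<open>
  Two faces whose relative interiors meet are equal.
\<close>

lemma face_at_unique: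
  assumes "convex P" "F face_of P" "y \<in> rel_interior F"
  shows "face_at y P = F"
proof -
  have "y \<in> P" using assms face_of_imp_subset rel_interior_subset by blast
  then show ?thesis
    using face_at_face_of[OF assms(1)] assms by (intro face_of_eq[of _ P]) auto
qed

lemma tangent_cone_eq_dir_cone:
  assumes P: "convex P" "F face_of P" and y: "y \<in> rel_interior F"
  shows "tangent_cone F P = dir_cone y P"
proof
  show "dir_cone y P \<subseteq> tangent_cone F P" using y by (auto simp: dir_cone_def tangent_cone_def)
  show "tangent_cone F P \<subseteq> dir_cone y P"
  proof
    fix v assume "v \<in> tangent_cone F P"
    then obtain f \<epsilon> where f: "f \<in> rel_interior F" "\<epsilon> > 0" "f + \<epsilon> *\<^sub>R v \<in> P"
      by (auto simp: tangent_cone_def)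
    have "convex F" "F \<noteq> {}" using P face_of_imp_convex y by auto
    then obtain e where e: "e > 1" "(1 - e) *\<^sub>R f + e *\<^sub>R y \<in> F"
      using convex_rel_interior_iff[of F y] y f rel_interior_subset by blast
    then have g: "(1 - e) *\<^sub>R f + e *\<^sub>R y \<in> P" (is "?g \<in> P") using P face_of_imp_subset by blast
    have "(1 / e) *\<^sub>R ?g + ((e - 1) / e) *\<^sub>R (f + \<epsilon> *\<^sub>R v) \<in> P"
      by (rule convexD[OF P(1) g f(3)]) (use e in \<open>auto simp: field_simps\<close>)
    also have "(1 / e) *\<^sub>R ?g + ((e - 1) / e) *\<^sub>R (f + \<epsilon> *\<^sub>R v) =
        (1 / e) *\<^sub>R (?g + (e - 1) *\<^sub>R (f + \<epsilon> *\<^sub>R v))"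
      by (simp add: scaleR_add_right)
    also have "?g + (e - 1) *\<^sub>R (f + \<epsilon> *\<^sub>R v) = e *\<^sub>R y + ((e - 1) * \<epsilon>) *\<^sub>R v"
      by (simp add: algebra_simps)
    also have "(1 / e) *\<^sub>R (e *\<^sub>R y + ((e - 1) * \<epsilon>) *\<^sub>R v) = y + ((e - 1) * \<epsilon> / e) *\<^sub>R v"
      using e by (simp add: scaleR_add_right)
    finally show "v \<in> dir_cone y P"
      using e f unfolding dir_cone_def by (intro CollectI exI[of _ "(e - 1) * \<epsilon> / e"]) auto
  qed
qed

text \<open>
  The residual of a metric projection is a normal vector at the projected point, hence at every point of
  the smallest face containing it.
\<close>

lemma closest_point_normal_face:
  assumes P: "convex P" "closed P" and x: "x \<in> P" and g: "g \<in> face_at (closest_point P q) P"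
  shows "(q - closest_point P q) \<bullet> x \<le> (q - closest_point P q) \<bullet> g"
proof -
  let ?p = "closest_point P q" and ?u = "q - closest_point P q"
  have le: "?u \<bullet> (z - ?p) \<le> 0" if "z \<in> P" for z using closest_point_dot[OF P that] .
  obtain e where e: "e > 0" "?p + e *\<^sub>R (?p - g) \<in> P"
    using g by (auto simp: face_at_def dir_cone_def)
  have "e * (?u \<bullet> (?p - g)) \<le> 0" using le[OF e(2)] by simp
  then have "?u \<bullet> (?p - g) \<le> 0" using e(1) by (simp add: mult_le_0_iff)
  then show ?thesis using le[OF x] by (simp add: inner_diff_right)
qed

text \<open>
  The points which the metric projection sends to a face \<open>F\<close> fill a set with nonempty interior, and even
  those sent close to a given \<open>y \<in> F\<close> do. Indeed, let \<open>w\<close> be a functional exposing \<open>F\<close>. It is not normal to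
  any face that is not contained in \<open>F\<close>; there are finitely many of these and their normal sets are closed, so a whole ball
  around \<open>w\<close> avoids them. For \<open>q\<close> close to \<open>y + w\<close>, the residual of the projection is close to \<open>w\<close>, and
  therefore the projection of \<open>q\<close> lies in \<open>F\<close>. In this way countably many projections see every face.
\<close>

lemma closest_point_dense_seq_face:
  fixes P :: "'a::euclidean_space set"
  assumes P: "polyhedron P" and F: "F face_of P" and y: "y \<in> F" and d: "d > 0"
  shows "\<exists>n. closest_point P (dense_seq n) \<in> F \<and> dist (closest_point P (dense_seq n)) y < d"
proof -
  have cc: "convex P" "closed P" using P polyhedron_imp_convex polyhedron_imp_closed by auto
  have yP: "y \<in> P" using F y face_of_imp_subset by blast
  have "F exposed_face_of P" using exposed_face_of_polyhedron[OF P] F by simp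
  then obtain w b where wb: "P \<subseteq> {x. w \<bullet> x \<le> b}" "F = P \<inter> {x. w \<bullet> x = b}"
    by (auto simp: exposed_face_of_def)
  define N where "N G = {u. \<forall>x\<in>P. \<forall>g\<in>G. u \<bullet> x \<le> u \<bullet> g}" for G :: "'a set"
  have clN: "closed (N G)" for G
  proof -
    have "N G = (\<Inter>x\<in>P. \<Inter>g\<in>G. {u. u \<bullet> x \<le> u \<bullet> g})" unfolding N_def by auto
    then show ?thesis by (auto intro!: closed_INT closed_Collect_le continuous_intros)
  qed
  define \<G> where "\<G> = {G. G face_of P \<and> \<not> G \<subseteq> F}"
  have "finite \<G>" unfolding \<G>_def using finite_polyhedron_faces[OF P] by (rule rev_finite_subset) auto
  then have "closed (\<Union>G\<in>\<G>. N G)" using clN by auto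
  moreover have "w \<notin> (\<Union>G\<in>\<G>. N G)"
  proof
    assume "w \<in> (\<Union>G\<in>\<G>. N G)"
    then obtain G where G: "G face_of P" "\<not> G \<subseteq> F" "w \<in> N G" by (auto simp: \<G>_def)
    then obtain g where g: "g \<in> G" "g \<notin> F" by auto
    have "w \<bullet> y \<le> w \<bullet> g" using G(3) g yP by (auto simp: N_def)
    moreover have "w \<bullet> y = b" "g \<in> P" "w \<bullet> g \<le> b"
      using wb y g G face_of_imp_subset by auto
    ultimately show False using wb g by auto
  qed
  ultimately obtain \<epsilon> where \<epsilon>: "\<epsilon> > 0" "ball w \<epsilon> \<subseteq> - (\<Union>G\<in>\<G>. N G)"
    using openE[of "- (\<Union>G\<in>\<G>. N G)" w] by (metis ComplI open_Compl)
  (* Since w is normal to P at y, the point y + w projects to y. *)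
  have py: "closest_point P (y + w) = y"
  proof -
    have "dist (y + w) y \<le> dist (y + w) z" if "z \<in> P" for z
    proof -
      have "w \<bullet> (z - y) \<le> 0" using wb y that by (auto simp: inner_diff_right)
      moreover have "(norm (w - (z - y)))\<^sup>2 = (norm w)\<^sup>2 - 2 * (w \<bullet> (z - y)) + (norm (z - y))\<^sup>2"
        unfolding power2_norm_eq_inner by (simp only: inner_diff_left inner_diff_right inner_commute) simp
      ultimately have "(norm w)\<^sup>2 \<le> (norm (w - (z - y)))\<^sup>2"
        using zero_le_power2[of "norm (z - y)"] by linarith
      then have "norm w \<le> norm (w - (z - y))" by (rule power2_le_imp_le) simp
      then show ?thesis by (simp add: dist_norm algebra_simps)
    qed
    then show ?thesis using closest_point_unique[OF cc yP] by auto
  qed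
  obtain n where n: "dist (dense_seq n) (y + w) < min d (\<epsilon> / 2)"
    using dense_seq_near[of "min d (\<epsilon> / 2)" "y + w"] d \<epsilon>(1) by auto
  let ?q = "dense_seq n :: 'a" let ?p = "closest_point P ?q"
  have pd: "dist ?p y \<le> dist ?q (y + w)"
    using closest_point_lipschitz[OF cc, of ?q "y + w"] yP py by auto
  have "?q - ?p \<in> N (face_at ?p P)"
    unfolding N_def using closest_point_normal_face[OF cc] by auto
  moreover have "?q - ?p \<in> ball w \<epsilon>"
  proof -
    have "w - (?q - ?p) = (y + w - ?q) + (?p - y)" by simp
    then have "norm (w - (?q - ?p)) \<le> norm (y + w - ?q) + norm (?p - y)" by (metis norm_triangle_ineq)
    then show ?thesis using pd n by (simp add: dist_norm norm_minus_commute)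
  qed
  ultimately have "face_at ?p P \<notin> \<G>" using \<epsilon>(2) by blast
  moreover have pP: "?p \<in> P" using closest_point_in_set[OF cc(2)] yP by blast
  ultimately have "face_at ?p P \<subseteq> F" using face_at_face_of[OF cc(1)] by (auto simp: \<G>_def)
  then have "?p \<in> F" using face_at_face_of(2)[OF cc(1) pP] rel_interior_subset by blast
  then show ?thesis using pd n by (intro exI[of _ n]) auto
qed

lemma closest_point_dense_seq_rel_interior:
  fixes P :: "'a::euclidean_space set"
  assumes P: "polyhedron P" and F: "F face_of P" "F \<noteq> {}"
  shows "\<exists>n. closest_point P (dense_seq n) \<in> rel_interior F"
proof -
  have "convex F" using F face_of_imp_convex by blast
  then obtain y where y: "y \<in> rel_interior F" using F rel_interior_eq_empty by blast
  then obtain e where e: "e > 0" "ball y e \<inter> affine hull F \<subseteq> F" and "y \<in> F"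
    by (auto simp: mem_rel_interior_ball)
  obtain n where n: "closest_point P (dense_seq n) \<in> F" "dist (closest_point P (dense_seq n)) y < e"
    using closest_point_dense_seq_face[OF P F(1) \<open>y \<in> F\<close> e(1)] by blast
  let ?p = "closest_point P (dense_seq n)"
  have "ball ?p (e - dist ?p y) \<inter> affine hull F \<subseteq> F"
  proof -
    have "ball ?p (e - dist ?p y) \<subseteq> ball y e"
    proof
      fix z assume "z \<in> ball ?p (e - dist ?p y)"
      then show "z \<in> ball y e" using dist_triangle[of y z ?p] by (simp add: dist_commute)
    qed
    then show ?thesis using e(2) by blast
  qed
  then show ?thesis using n by (intro exI[of _ n]) (auto simp: mem_rel_interior_ball intro!: exI[of _ "e - dist ?p y"])
qed

section \<open>Polar and normal cones\<close>

definition polar :: "'a::euclidean_space set \<Rightarrow> 'a set" where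
  "polar C = {w. \<forall>u\<in>C. w \<bullet> u \<le> 0}"

lemma normal_cone_eq_polar: "normal_cone F P = polar (tangent_cone F P)"
  by (simp add: normal_cone_def polar_def)

lemma closed_polar: "closed (polar C)"
proof -
  have "polar C = (\<Inter>u\<in>C. {w. w \<bullet> u \<le> 0})" by (auto simp: polar_def)
  then show ?thesis by (auto intro!: closed_INT closed_Collect_le continuous_intros)
qed

lemma convex_polar: "convex (polar C)"
proof -
  have "polar C = (\<Inter>u\<in>C. {w. u \<bullet> w \<le> 0})" by (auto simp: polar_def inner_commute)
  then show ?thesis by (auto intro!: convex_INT simp: convex_halfspace_le)
qed

lemma cone_polar: "cone (polar C)"
  unfolding cone_def polar_def by (simp add: mult_nonneg_nonpos)

lemma zero_in_polar: "0 \<in> polar C"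
  by (simp add: polar_def)

lemma subspace_convex_closed:
  fixes L :: "'a::euclidean_space set"
  assumes "subspace L"
  shows "closed L" "convex L" "L \<noteq> {}"
  using closed_subspace[OF assms] subspace_imp_convex[OF assms] subspace_0[OF assms] by auto

text \<open>
  The Moreau decomposition: a point is the sum of its projections to a closed convex cone and to the polar
  cone, and these are orthogonal.
\<close>

lemma closest_point_cone:
  assumes C: "closed C" "convex C" "cone C" "C \<noteq> {}"
  shows "z - closest_point C z \<in> polar C" "(z - closest_point C z) \<bullet> closest_point C z = 0"
proof -
  let ?p = "closest_point C z"
  have p: "?p \<in> C" using C closest_point_in_set by blast
  have le: "(z - ?p) \<bullet> (x - ?p) \<le> 0" if "x \<in> C" for x using closest_point_dot[OF C(2,1) that] .
  have "0 *\<^sub>R ?p \<in> C" "2 *\<^sub>R ?p \<in> C" using mem_cone[OF C(3) p, of 0] mem_cone[OF C(3) p, of 2] by simp_all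
  then have "(z - ?p) \<bullet> (0 *\<^sub>R ?p - ?p) \<le> 0" "(z - ?p) \<bullet> (2 *\<^sub>R ?p - ?p) \<le> 0" using le by blast+
  moreover have "2 *\<^sub>R ?p - ?p = ?p" by (simp add: scaleR_2)
  ultimately show 0: "(z - ?p) \<bullet> ?p = 0" by auto
  show "z - ?p \<in> polar C" using le 0 by (auto simp: polar_def inner_diff_right)
qed

lemma closest_point_polar:
  assumes C: "closed C" "convex C" "cone C" "C \<noteq> {}" and w: "w \<in> polar C"
  shows "closest_point C w = 0"
proof -
  let ?p = "closest_point C w"
  have "w \<bullet> ?p \<le> 0" using w closest_point_in_set[OF C(1,4)] by (auto simp: polar_def)
  moreover have "w \<bullet> ?p = ?p \<bullet> ?p" using closest_point_cone(2)[OF C, of w] by (simp add: inner_diff_left)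
  ultimately have "?p \<bullet> ?p \<le> 0" by simp
  then have "?p \<bullet> ?p = 0" using inner_ge_zero[of ?p] by linarith
  then show ?thesis by simp
qed

lemma polar_eq_range:
  assumes C: "closed C" "convex C" "cone C" "C \<noteq> {}"
  shows "polar C = (\<lambda>z. z - closest_point C z) ` UNIV"
proof
  show "polar C \<subseteq> (\<lambda>z. z - closest_point C z) ` UNIV"
  proof
    fix w assume "w \<in> polar C"
    then have "w = w - closest_point C w" using closest_point_polar[OF C] by simp
    then show "w \<in> (\<lambda>z. z - closest_point C z) ` UNIV" by blast
  qed
qed (use closest_point_cone(1)[OF C] in blast)

text \<open>
  A vector orthogonal to the polar cone has vanishing projection to it, so it equals its own projection to
  the cone.
\<close>

lemma orthogonal_comp_span_polar:
  assumes C: "closed C" "convex C" "cone C" "C \<noteq> {}"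
  shows "(span (polar C))\<^sup>\<bottom> \<subseteq> C"
proof
  fix v assume v: "v \<in> (span (polar C))\<^sup>\<bottom>"
  have "v - closest_point C v \<in> span (polar C)"
    using closest_point_cone(1)[OF C] span_superset by blast
  then have "(v - closest_point C v) \<bullet> v = 0" using v by (auto simp: orthogonal_comp_def orthogonal_def)
  then have "(v - closest_point C v) \<bullet> (v - closest_point C v) = 0"
    using closest_point_cone(2)[OF C, of v] by (simp add: inner_diff_right)
  then have "v = closest_point C v" by simp
  then show "v \<in> C" using C closest_point_in_set by metis
qed

text \<open>
  The linear hull of \<open>D\<close> is the lineality space of the tangent cone \<open>T\<close> at \<open>D\<close>. Every vector orthogonal to
  the polar of \<open>T\<close> lies in \<open>T\<close>, together with its negative, hence in the linear hull of \<open>D\<close>; passing to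
  orthogonal complements, the normal cone spans the whole orthogonal complement of \<open>D\<close>.
\<close>

lemma span_normal_cone:
  fixes C :: "'a::euclidean_space set"
  assumes C: "polyhedron C" "cone C" and D: "D face_of C" "D \<noteq> {}"
  shows "span (normal_cone D C) = (span D)\<^sup>\<bottom>"
proof -
  have cc: "convex C" "closed C" using C polyhedron_imp_convex polyhedron_imp_closed by auto
  have "convex D" using D face_of_imp_convex by blast
  then obtain y where y: "y \<in> rel_interior D" using D rel_interior_eq_empty by blast
  define T where "T = dir_cone y C"
  have tc: "tangent_cone D C = T" unfolding T_def using tangent_cone_eq_dir_cone[OF cc(1) D(1) y] .
  have yC: "y \<in> C" "y \<in> D" using y D face_of_imp_subset rel_interior_subset by blast+
  have T: "closed T" "convex T" "cone T" "T \<noteq> {}"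
    unfolding T_def using polyhedron_dir_cone[OF C(1) yC(1)] polyhedron_imp_convex polyhedron_imp_closed
      cone_dir_cone[OF cc(1) yC(1)] zero_in_dir_cone[OF yC(1)] by auto
  have D_eq: "face_at y C = D" using face_at_unique[OF cc(1) D(1) y] .
  have scal: "c *\<^sub>R x \<in> C" if "x \<in> C" "c \<ge> 0" for c x using C(2) that by (auto simp: cone_def)
  have add: "x + z \<in> C" if "x \<in> C" "z \<in> C" for x z
    using C(2) cc(1) that convex_cone[of C] by blast
  (* D lies in the lineality space of T. For - x, prolong the segment from x beyond y and use that C
     is a cone to scale the result back to a point on the ray from y in direction - x. *)
  have lin: "D \<subseteq> T \<inter> uminus ` T"
  proof
    fix x assume x: "x \<in> D"
    then have xC: "x \<in> C" using D face_of_imp_subset by blast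
    have "y + 1 *\<^sub>R x \<in> C" using add[OF yC(1) xC] by simp
    then have 1: "x \<in> T" unfolding T_def dir_cone_def using zero_less_one by blast
    obtain e where e: "e > 0" "y + e *\<^sub>R (y - x) \<in> C"
      using x D_eq by (auto simp: face_at_def dir_cone_def)
    have "(1 / (1 + e)) *\<^sub>R (y + e *\<^sub>R (y - x)) \<in> C" using scal[OF e(2), of "1 / (1 + e)"] e(1) by simp
    also have "(1 / (1 + e)) *\<^sub>R (y + e *\<^sub>R (y - x)) = (1 / (1 + e)) *\<^sub>R ((1 + e) *\<^sub>R y + e *\<^sub>R (- x))"
      by (simp add: algebra_simps)
    also have "\<dots> = y + (e / (1 + e)) *\<^sub>R (- x)"
      using e(1) by (simp only: scaleR_add_right scaleR_scaleR) simp
    finally have "- x \<in> T" unfolding T_def dir_cone_def using e(1)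
      by (intro CollectI exI[of _ "e / (1 + e)"]) auto
    then have "x \<in> uminus ` T" by (metis image_eqI minus_minus)
    then show "x \<in> T \<inter> uminus ` T" using 1 by simp
  qed
  have sub: "v \<in> span D" if v: "v \<in> T" "- v \<in> T" for v
  proof -
    obtain d e where de: "d > 0" "y + d *\<^sub>R v \<in> C" "e > 0" "y + e *\<^sub>R (- v) \<in> C"
      using v by (auto simp: T_def dir_cone_def)
    have "y - (y + d *\<^sub>R v) \<in> dir_cone y C"
      using de unfolding dir_cone_def by (intro CollectI exI[of _ "e / d"]) auto
    then have "y + d *\<^sub>R v \<in> D" using D_eq de by (auto simp: face_at_def)
    then have "(y + d *\<^sub>R v) - y \<in> span D" using yC by (intro span_diff span_base) auto
    then have "d *\<^sub>R v \<in> span D" by simp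
    then have "(1 / d) *\<^sub>R (d *\<^sub>R v) \<in> span D" by (rule span_mul)
    then show ?thesis using de(1) by simp
  qed
  have N: "normal_cone D C = polar T" using tc by (simp add: normal_cone_eq_polar)
  have "polar T \<subseteq> (span D)\<^sup>\<bottom>"
  proof
    fix w assume w: "w \<in> polar T"
    have "w \<bullet> x = 0" if "x \<in> D" for x
    proof -
      have "x \<in> T" "- x \<in> T" using lin that by auto
      then have "w \<bullet> x \<le> 0" "w \<bullet> (- x) \<le> 0" using w by (auto simp: polar_def)
      then show ?thesis by simp
    qed
    then have "orthogonal w x" if "x \<in> span D" for x
      using orthogonal_to_span[OF that] by (simp add: orthogonal_def)
    then show "w \<in> (span D)\<^sup>\<bottom>" by (auto simp: orthogonal_comp_def orthogonal_commute)
  qed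
  then have 1: "span (polar T) \<subseteq> (span D)\<^sup>\<bottom>"
    by (simp add: span_minimal subspace_orthogonal_comp)
  have "(span (polar T))\<^sup>\<bottom> \<subseteq> span D"
  proof
    fix v assume v: "v \<in> (span (polar T))\<^sup>\<bottom>"
    then have "- v \<in> (span (polar T))\<^sup>\<bottom>" using subspace_neg[OF subspace_orthogonal_comp] by blast
    then show "v \<in> span D" using sub v orthogonal_comp_span_polar[OF T] by blast
  qed
  then have "(span D)\<^sup>\<bottom> \<subseteq> (span (polar T))\<^sup>\<bottom>\<^sup>\<bottom>" by (rule orthogonal_comp_anti_mono)
  then have "(span D)\<^sup>\<bottom> \<subseteq> span (polar T)" by (simp add: orthogonal_comp_self)
  then show ?thesis using 1 N by simp
qed

lemma dir_cone_linear_image: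
  assumes T: "linear T" "bij T"
  shows "dir_cone (T y) (T ` P) = T ` dir_cone y P"
proof -
  have mem: "T y + e *\<^sub>R T u \<in> T ` P \<longleftrightarrow> y + e *\<^sub>R u \<in> P" for e u
  proof -
    have "T y + e *\<^sub>R T u = T (y + e *\<^sub>R u)" by (simp add: linear_add[OF T(1)] linear_scale[OF T(1)])
    then show ?thesis using T(2) by (simp add: bij_is_inj inj_image_mem_iff)
  qed
  show ?thesis
  proof (intro set_eqI)
    fix v
    obtain u where u: "v = T u" using T(2) by (metis bij_pointE)
    show "v \<in> dir_cone (T y) (T ` P) \<longleftrightarrow> v \<in> T ` dir_cone y P"
      using T(2) unfolding u by (simp add: dir_cone_def mem bij_is_inj inj_image_mem_iff)
  qed
qed

text \<open>
  The trace of the orthogonal projection; this expresses the dimension of a random subspace by measurable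
  quantities.
\<close>

lemma dim_eq_trace_closest_point:
  fixes L :: "'a::euclidean_space set"
  assumes L: "subspace L"
  shows "real (dim L) = (\<Sum>b\<in>Basis. closest_point L b \<bullet> b)"
proof -
  obtain B where B: "B \<subseteq> L" "pairwise orthogonal B" "\<And>x. x \<in> B \<Longrightarrow> norm x = 1"
    "independent B" "card B = dim L" "span B = L"
    using orthonormal_basis_subspace[OF L] by metis
  have finB: "finite B" using B(4) independent_imp_finite by blast
  note Lc = subspace_convex_closed[OF L]
  (* The usual formula for the projection in an orthonormal basis of L. *)
  have proj: "closest_point L z = (\<Sum>u\<in>B. (z \<bullet> u) *\<^sub>R u)" for z
  proof -
    let ?p = "\<Sum>u\<in>B. (z \<bullet> u) *\<^sub>R u"
    have pL: "?p \<in> L" using B(1) L by (intro subspace_sum subspace_mul) auto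
    have orth: "(z - ?p) \<bullet> v = 0" if "v \<in> B" for v
    proof -
      have "?p \<bullet> v = (\<Sum>u\<in>B. (z \<bullet> u) * (u \<bullet> v))" by (simp add: inner_sum_left)
      also have "\<dots> = (\<Sum>u\<in>B. if u = v then z \<bullet> v else 0)"
      proof (rule sum.cong)
        fix u assume u: "u \<in> B"
        have "v \<bullet> v = 1" using B(3)[OF that] by (simp add: norm_eq_1)
        moreover have "u \<bullet> v = 0" if "u \<noteq> v"
          using B(2) u \<open>v \<in> B\<close> that unfolding pairwise_def orthogonal_def by blast
        ultimately show "(z \<bullet> u) * (u \<bullet> v) = (if u = v then z \<bullet> v else 0)" by simp
      qed simp
      also have "\<dots> = z \<bullet> v" using finB that by simp
      finally show ?thesis by (simp add: inner_diff_left)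
    qed
    have orthL: "(z - ?p) \<bullet> v = 0" if "v \<in> L" for v
      using orthogonal_to_span[of v B "z - ?p"] that B(6) orth by (simp add: orthogonal_def)
    have "dist z ?p \<le> dist z x" if "x \<in> L" for x
    proof -
      have "?p - x \<in> L" using pL that L subspace_diff by blast
      then have "(z - ?p) \<bullet> (?p - x) = 0" by (rule orthL)
      then have "(norm (z - x))\<^sup>2 = (norm (z - ?p))\<^sup>2 + (norm (?p - x))\<^sup>2"
        using norm_add_Pythagorean[of "z - ?p" "?p - x"] by (simp add: orthogonal_def)
      then have "norm (z - ?p) \<le> norm (z - x)"
        by (intro power2_le_imp_le[of "norm (z - ?p)"]) auto
      then show ?thesis by (simp add: dist_norm)
    qed
    then show ?thesis using closest_point_unique[OF Lc(2,1) pL] by metis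
  qed
  have "(\<Sum>b\<in>Basis. closest_point L b \<bullet> b) = (\<Sum>b\<in>Basis. \<Sum>u\<in>B. (u \<bullet> b)\<^sup>2)"
    by (simp add: proj inner_sum_left power2_eq_square) (simp add: inner_commute)
  also have "\<dots> = (\<Sum>u\<in>B. \<Sum>b\<in>Basis. (u \<bullet> b)\<^sup>2)" by (rule sum.swap)
  also have "\<dots> = (\<Sum>u\<in>B. 1)"
  proof (rule sum.cong)
    fix u assume "u \<in> B"
    then have "u \<bullet> u = 1" using B(3) by (simp add: norm_eq_1)
    then show "(\<Sum>b\<in>Basis. (u \<bullet> b)\<^sup>2) = 1"
      using euclidean_inner[of u u] by (simp add: power2_eq_square)
  qed simp
  finally show ?thesis using B(5) by simp
qed

lemma subspace_closest_point_orthogonal: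
  fixes L :: "'a::euclidean_space set"
  assumes L: "subspace L" and v: "v \<in> L"
  shows "(z - closest_point L z) \<bullet> v = 0"
proof -
  note Lc = subspace_convex_closed[OF L]
  have p: "closest_point L z \<in> L" using Lc closest_point_in_set by blast
  have 1: "(z - closest_point L z) \<bullet> w \<le> 0" if "w \<in> L" for w
    using closest_point_dot[OF Lc(2,1), of "w + closest_point L z" z] subspace_add[OF L that p] by simp
  show ?thesis using 1[OF v] 1[of "- v"] subspace_neg[OF L v] by simp
qed

section \<open>Measurability of sums over faces\<close>

lemma random_nonempty_closed_compose:
  assumes f: "random_nonempty_closed M f" and h: "h \<in> N \<rightarrow>\<^sub>M M"
  shows "random_nonempty_closed N (\<lambda>x. f (h x))"
  using assms measurable_space[OF h] measurable_compose[OF h]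
  unfolding random_nonempty_closed_def by blast

lemma random_nonempty_closed_const:
  assumes "closed S" "S \<noteq> {}"
  shows "random_nonempty_closed M (\<lambda>\<omega>. S)"
  using assms by (intro random_nonempty_closedI_infdist) auto

lemma closest_point_seq_in:
  assumes "random_nonempty_closed M f" "\<omega> \<in> space M"
  shows "closest_point (f \<omega>) z \<in> f \<omega>"
  using random_nonempty_closedD[OF assms] by (rule closest_point_in_set)

lemma dir_cone_eq_closure:
  fixes P :: "'a::euclidean_space set"
  assumes P: "polyhedron P" "y \<in> P" and R: "closure R = P"
  shows "dir_cone y P = closure ((\<lambda>(x, k). real (Suc k) *\<^sub>R (x - y)) ` (R \<times> UNIV))" (is "_ = closure ?S")
proof
  have cl: "closed (dir_cone y P)" using polyhedron_dir_cone[OF P] polyhedron_imp_closed by blast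
  show "closure ?S \<subseteq> dir_cone y P"
  proof (rule closure_minimal[OF _ cl], rule subsetI)
    fix v assume "v \<in> ?S"
    then obtain x k where x: "x \<in> R" "v = real (Suc k) *\<^sub>R (x - y)" by auto
    have "y + (1 / real (Suc k)) *\<^sub>R v = x" unfolding x by simp
    then show "v \<in> dir_cone y P" using x R closure_subset unfolding dir_cone_def
      by (intro CollectI exI[of _ "1 / real (Suc k)"]) auto
  qed
  show "dir_cone y P \<subseteq> closure ?S"
  proof
    fix v assume "v \<in> dir_cone y P"
    then obtain e where e: "e > 0" "y + e *\<^sub>R v \<in> P" by (auto simp: dir_cone_def)
    obtain k where k: "1 / real (Suc k) < e" using nat_approx_posE[OF e(1)] by blast
    define c where "c = real (Suc k)"
    have c: "c > 0" "1 / c < e" using k by (auto simp: c_def)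
    have p: "y + (1 / c) *\<^sub>R v \<in> P"
      using dir_cone_smaller_step[OF polyhedron_imp_convex[OF P(1)] P(2) e(2), of "1 / c"] c by auto
    show "v \<in> closure ?S"
      unfolding closure_approachable
    proof (intro allI impI)
      fix \<delta> :: real assume "\<delta> > 0"
      then have "\<delta> / c > 0" using c by simp
      then obtain x where x: "x \<in> R" "dist x (y + (1 / c) *\<^sub>R v) < \<delta> / c"
        using p R closure_approachable by blast
      have "c *\<^sub>R (x - y) - v = c *\<^sub>R (x - (y + (1 / c) *\<^sub>R v))"
        using c(1) by (simp add: algebra_simps)
      then have "dist (c *\<^sub>R (x - y)) v = c * dist x (y + (1 / c) *\<^sub>R v)"
        using c(1) by (simp add: dist_norm)
      also have "\<dots> < \<delta>" using x(2) c(1) by (simp add: field_simps)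
      finally have "dist (real (Suc k) *\<^sub>R (x - y)) v < \<delta>" unfolding c_def .
      then show "\<exists>s\<in>?S. dist s v < \<delta>"
        using x(1) by (intro bexI[of _ "real (Suc k) *\<^sub>R (x - y)"] image_eqI[of _ _ "(x, k)"]) auto
    qed
  qed
qed

text \<open>
  The multiples \<open>(k + 1) (x - y)\<close> with \<open>x\<close> from a dense sequence of \<open>P\<close> form a Castaing representation. Their
  closure is no larger than the cone because the cone of a polyhedron is closed.
\<close>

lemma random_dir_cone:
  fixes P :: "'w \<Rightarrow> 'a::euclidean_space set"
  assumes P: "random_nonempty_closed M P" and poly: "\<And>\<omega>. \<omega> \<in> space M \<Longrightarrow> polyhedron (P \<omega>)"
    and y[measurable]: "y \<in> borel_measurable M" and yP: "\<And>\<omega>. \<omega> \<in> space M \<Longrightarrow> y \<omega> \<in> P \<omega>"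
  shows "random_nonempty_closed M (\<lambda>\<omega>. dir_cone (y \<omega>) (P \<omega>))"
proof -
  obtain \<xi> :: "nat \<Rightarrow> 'w \<Rightarrow> 'a" where \<xi>[measurable]: "\<And>n. \<xi> n \<in> borel_measurable M"
    and dense: "\<And>\<omega>. \<omega> \<in> space M \<Longrightarrow> P \<omega> = closure (range (\<lambda>n. \<xi> n \<omega>))"
    using random_closed_dense_seq[OF P polyhedron_imp_convex[OF poly]] by blast
  define \<zeta> where "\<zeta> i \<omega> = (case prod_decode i of (n, k) \<Rightarrow> real (Suc k) *\<^sub>R (\<xi> n \<omega> - y \<omega>))" for i \<omega>
  show ?thesis
  proof (rule random_nonempty_closedI_dense[of \<zeta>])
    show "\<zeta> i \<in> borel_measurable M" for i
      unfolding \<zeta>_def by (cases "prod_decode i") simp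
    fix \<omega> assume w: "\<omega> \<in> space M"
    let ?f = "\<lambda>(x, k). real (Suc k) *\<^sub>R (x - y \<omega>)"
    have "range (\<lambda>i. \<zeta> i \<omega>) = (\<lambda>p. case p of (n, k) \<Rightarrow> ?f (\<xi> n \<omega>, k)) ` range prod_decode"
      unfolding \<zeta>_def by (simp only: image_image) (simp split: prod.split)
    also have "\<dots> = ?f ` (range (\<lambda>n. \<xi> n \<omega>) \<times> UNIV)"
      unfolding surj_prod_decode by force
    finally have "range (\<lambda>i. \<zeta> i \<omega>) = ?f ` (range (\<lambda>n. \<xi> n \<omega>) \<times> UNIV)" .
    then show "dir_cone (y \<omega>) (P \<omega>) = closure (range (\<lambda>i. \<zeta> i \<omega>))"
      using dir_cone_eq_closure[OF poly[OF w] yP[OF w]] dense[OF w] by simp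
  qed
qed

lemma closed_face_at:
  assumes "polyhedron P" "y \<in> P"
  shows "closed (face_at y P)"
  using face_of_polyhedron_polyhedron[OF assms(1)] face_at_face_of(1)[OF polyhedron_imp_convex[OF assms(1)] assms(2)]
    polyhedron_imp_closed by blast

lemma in_face_at_self: "y \<in> P \<Longrightarrow> y \<in> face_at y P"
  by (simp add: face_at_def zero_in_dir_cone)

lemma pred_in_face_at:
  fixes P :: "'w \<Rightarrow> 'a::euclidean_space set"
  assumes P: "random_nonempty_closed M P" and poly: "\<And>\<omega>. \<omega> \<in> space M \<Longrightarrow> polyhedron (P \<omega>)"
    and y[measurable]: "y \<in> borel_measurable M" and yP: "\<And>\<omega>. \<omega> \<in> space M \<Longrightarrow> y \<omega> \<in> P \<omega>"
    and z[measurable]: "z \<in> borel_measurable M"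
  shows "Measurable.pred M (\<lambda>\<omega>. z \<omega> \<in> face_at (y \<omega>) (P \<omega>))"
proof -
  have [measurable]: "Measurable.pred M (\<lambda>\<omega>. z \<omega> \<in> P \<omega>)"
    by (rule pred_mem_random_closed[OF P z])
  have [measurable]: "Measurable.pred M (\<lambda>\<omega>. y \<omega> - z \<omega> \<in> dir_cone (y \<omega>) (P \<omega>))"
    by (rule pred_mem_random_closed[OF random_dir_cone[OF P poly y yP]]) measurable
  show ?thesis unfolding face_at_def mem_Collect_eq by measurable
qed

text \<open>
  The projections of a dense sequence that happen to lie in the face are dense in it, since the metric
  projection of a polyhedron sees every face near each of its points.
\<close>

lemma random_face_at:
  fixes P :: "'w \<Rightarrow> 'a::euclidean_space set"
  assumes P: "random_nonempty_closed M P" and poly: "\<And>\<omega>. \<omega> \<in> space M \<Longrightarrow> polyhedron (P \<omega>)"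
    and y[measurable]: "y \<in> borel_measurable M" and yP: "\<And>\<omega>. \<omega> \<in> space M \<Longrightarrow> y \<omega> \<in> P \<omega>"
  shows "random_nonempty_closed M (\<lambda>\<omega>. face_at (y \<omega>) (P \<omega>))"
proof -
  define x where "x n \<omega> = closest_point (P \<omega>) (dense_seq n)" for n \<omega>
  have x[measurable]: "x n \<in> borel_measurable M" for n
    unfolding x_def by (rule borel_measurable_closest_point[OF P polyhedron_imp_convex[OF poly]]) auto
  (* Points that miss the face are replaced by y, which always lies in it. *)
  define \<zeta> where "\<zeta> n \<omega> = (if x n \<omega> \<in> face_at (y \<omega>) (P \<omega>) then x n \<omega> else y \<omega>)" for n \<omega>
  show ?thesis
  proof (rule random_nonempty_closedI_dense[of \<zeta>])
    fix n
    note [measurable] = pred_in_face_at[OF P poly y yP x]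
    show "\<zeta> n \<in> borel_measurable M" unfolding \<zeta>_def by measurable
  next
    fix \<omega> assume w: "\<omega> \<in> space M"
    let ?F = "face_at (y \<omega>) (P \<omega>)"
    have F: "?F face_of P \<omega>"
      using face_at_face_of(1)[OF polyhedron_imp_convex[OF poly[OF w]] yP[OF w]] .
    show "?F = closure (range (\<lambda>n. \<zeta> n \<omega>))"
    proof
      show "closure (range (\<lambda>n. \<zeta> n \<omega>)) \<subseteq> ?F"
        using closed_face_at[OF poly[OF w] yP[OF w]] in_face_at_self[OF yP[OF w]]
        by (intro closure_minimal) (auto simp: \<zeta>_def)
      show "?F \<subseteq> closure (range (\<lambda>n. \<zeta> n \<omega>))"
      proof
        fix p assume p: "p \<in> ?F"
        show "p \<in> closure (range (\<lambda>n. \<zeta> n \<omega>))"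
          unfolding closure_approachable
        proof (intro allI impI)
          fix e :: real assume "e > 0"
          then obtain n where "x n \<omega> \<in> ?F" "dist (x n \<omega>) p < e"
            using closest_point_dense_seq_face[OF poly[OF w] F p] unfolding x_def by blast
          then show "\<exists>q\<in>range (\<lambda>n. \<zeta> n \<omega>). dist q p < e" by (auto simp: \<zeta>_def intro!: exI[of _ n])
        qed
      qed
    qed
  qed
qed

lemma borel_measurable_dim_span:
  fixes F :: "'w \<Rightarrow> 'a::euclidean_space set"
  assumes F: "random_nonempty_closed M F" and cv: "\<And>\<omega>. \<omega> \<in> space M \<Longrightarrow> convex (F \<omega>)"
  shows "random_nonempty_closed M (\<lambda>\<omega>. span (F \<omega>))"
    and "(\<lambda>\<omega>. real (dim (F \<omega>))) \<in> borel_measurable M"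
proof -
  obtain \<xi> :: "nat \<Rightarrow> 'w \<Rightarrow> 'a" where \<xi>[measurable]: "\<And>n. \<xi> n \<in> borel_measurable M"
    and dense: "\<And>\<omega>. \<omega> \<in> space M \<Longrightarrow> F \<omega> = closure (range (\<lambda>n. \<xi> n \<omega>))"
    using random_closed_dense_seq[OF F cv] by blast
  show S: "random_nonempty_closed M (\<lambda>\<omega>. span (F \<omega>))"
  proof (rule random_nonempty_closed_span[OF \<xi>])
    fix \<omega> assume w: "\<omega> \<in> space M"
    show "F \<omega> \<subseteq> closure (range (\<lambda>n. \<xi> n \<omega>))" using dense[OF w] by simp
    have "range (\<lambda>n. \<xi> n \<omega>) \<subseteq> F \<omega>" using dense[OF w] closure_subset by metis
    then show "range (\<lambda>n. \<xi> n \<omega>) \<subseteq> span (F \<omega>)" using span_superset by blast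
  qed
  have "(\<lambda>\<omega>. closest_point (span (F \<omega>)) b \<bullet> b) \<in> borel_measurable M" for b
    by (intro borel_measurable_inner borel_measurable_closest_point[OF S]) (auto intro: subspace_imp_convex)
  then have "(\<lambda>\<omega>. \<Sum>b\<in>Basis. closest_point (span (F \<omega>)) b \<bullet> b) \<in> borel_measurable M" by measurable
  moreover have "real (dim (F \<omega>)) = (\<Sum>b\<in>Basis. closest_point (span (F \<omega>)) b \<bullet> b)" for \<omega>
    using dim_eq_trace_closest_point[of "span (F \<omega>)"] by simp
  ultimately show "(\<lambda>\<omega>. real (dim (F \<omega>))) \<in> borel_measurable M" by simp
qed

lemma pred_aff_dim:
  fixes F :: "'w \<Rightarrow> 'a::euclidean_space set"
  assumes F: "random_nonempty_closed M F" and cv: "\<And>\<omega>. \<omega> \<in> space M \<Longrightarrow> convex (F \<omega>)"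
  shows "Measurable.pred M (\<lambda>\<omega>. aff_dim (F \<omega>) = int j)"
proof -
  define y where "y \<omega> = closest_point (F \<omega>) 0" for \<omega>
  have [measurable]: "y \<in> borel_measurable M"
    unfolding y_def by (rule borel_measurable_closest_point[OF F cv]) auto
  have "random_nonempty_closed M (\<lambda>\<omega>. (+) (- y \<omega>) ` F \<omega>)"
  proof (rule random_nonempty_closed_image[OF F cv])
    show "closed ((+) (- y \<omega>) ` F \<omega>)" if "\<omega> \<in> space M" for \<omega>
      using random_nonempty_closedD(1)[OF F that] by (rule closed_translation)
  qed (auto intro!: continuous_intros)
  from borel_measurable_dim_span(2)[OF this] cv
  have [measurable]: "(\<lambda>\<omega>. real (dim ((+) (- y \<omega>) ` F \<omega>))) \<in> borel_measurable M"
    by (simp add: convex_translation)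
  have "Measurable.pred M (\<lambda>\<omega>. real (dim ((+) (- y \<omega>) ` F \<omega>)) = real j)" by measurable
  moreover have "aff_dim (F \<omega>) = int j \<longleftrightarrow> real (dim ((+) (- y \<omega>) ` F \<omega>)) = real j" if "\<omega> \<in> space M" for \<omega>
  proof -
    have "y \<omega> \<in> affine hull (F \<omega>)"
      using closest_point_seq_in[OF F that] hull_inc unfolding y_def by metis
    from aff_dim_eq_dim[OF this] show ?thesis by simp
  qed
  ultimately show ?thesis by (simp cong: measurable_cong)
qed

text \<open>
  Given an enumeration with repetitions, each element is counted at its first occurrence.
\<close>

lemma sum_eq_suminf_first_occurrence:
  fixes g :: "'b \<Rightarrow> ennreal"
  assumes "finite S" "S \<subseteq> range G"
  shows "(\<Sum>F\<in>S. g F) = (\<Sum>n. if G n \<in> S \<and> (\<forall>m<n. G m \<noteq> G n) then g (G n) else 0)"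
proof -
  define I where "I = {n. G n \<in> S \<and> (\<forall>m<n. G m \<noteq> G n)}"
  have inj: "inj_on G I" unfolding I_def inj_on_def by (metis (mono_tags, lifting) linorder_neqE_nat mem_Collect_eq)
  have img: "G ` I = S"
  proof
    show "S \<subseteq> G ` I"
    proof
      fix F assume F: "F \<in> S"
      then have ex: "\<exists>n. G n = F" using assms(2) by auto
      define n where "n = (LEAST n. G n = F)"
      have "G n = F" unfolding n_def using LeastI_ex[OF ex] .
      moreover have "\<forall>m<n. G m \<noteq> F" unfolding n_def using not_less_Least by blast
      ultimately show "F \<in> G ` I" using F unfolding I_def by (intro image_eqI[of _ _ n]) auto
    qed
  qed (auto simp: I_def)
  have "finite I" using inj img assms(1) finite_imageD by metis
  then have "(\<Sum>n. if n \<in> I then g (G n) else 0) = (\<Sum>n\<in>I. if n \<in> I then g (G n) else 0)"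
    by (intro suminf_finite) auto
  also have "\<dots> = (\<Sum>n\<in>I. g (G n))" by (intro sum.cong) auto
  also have "\<dots> = (\<Sum>F\<in>S. g F)" using sum.reindex[OF inj, of g] img by (simp add: comp_def)
  finally show ?thesis unfolding I_def by simp
qed

lemma finite_faces: "polyhedron P \<Longrightarrow> finite (faces j P)"
  using finite_polyhedron_faces unfolding faces_def by (rule rev_finite_subset) auto

text \<open>
  Every nonempty face is the smallest face containing one of the countably many random points
  \<open>x n\<close>, so a sum over faces is a series over \<open>n\<close> in which each face is counted at its first occurrence.
  Whether two of the points determine the same face, and the dimension of that face, are measurable.
\<close>

lemma borel_measurable_sum_faces:
  fixes P :: "'w \<Rightarrow> 'a::euclidean_space set" and g :: "'w \<Rightarrow> 'a set \<Rightarrow> ennreal"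
  assumes P: "random_nonempty_closed M P" and poly: "\<And>\<omega>. \<omega> \<in> space M \<Longrightarrow> polyhedron (P \<omega>)"
    and g: "\<And>y. y \<in> borel_measurable M \<Longrightarrow> (\<And>\<omega>. \<omega> \<in> space M \<Longrightarrow> y \<omega> \<in> P \<omega>) \<Longrightarrow>
      (\<lambda>\<omega>. g \<omega> (face_at (y \<omega>) (P \<omega>))) \<in> borel_measurable M"
  shows "(\<lambda>\<omega>. \<Sum>F\<in>faces j (P \<omega>). g \<omega> F) \<in> borel_measurable M"
proof -
  define x where "x n \<omega> = closest_point (P \<omega>) (dense_seq n)" for n \<omega>
  have x[measurable]: "x n \<in> borel_measurable M" for n
    unfolding x_def by (rule borel_measurable_closest_point[OF P polyhedron_imp_convex[OF poly]]) auto
  have xP: "x n \<omega> \<in> P \<omega>" if "\<omega> \<in> space M" for n \<omega>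
    unfolding x_def using closest_point_seq_in[OF P that] .
  define G where "G n \<omega> = face_at (x n \<omega>) (P \<omega>)" for n \<omega>
  have fo: "G n \<omega> face_of P \<omega>" "x n \<omega> \<in> rel_interior (G n \<omega>)" if "\<omega> \<in> space M" for n \<omega>
    unfolding G_def using face_at_face_of[OF polyhedron_imp_convex[OF poly[OF that]] xP[OF that]] by auto
  have [measurable]: "Measurable.pred M (\<lambda>\<omega>. aff_dim (G n \<omega>) = int j)" for n
    unfolding G_def
  proof (rule pred_aff_dim[OF random_face_at[OF P poly x xP]])
    show "convex (face_at (x n \<omega>) (P \<omega>))" if "\<omega> \<in> space M" for \<omega>
      using face_of_imp_convex[OF fo(1)[OF that, of n]] unfolding G_def .
  qed
  have [measurable]: "Measurable.pred M (\<lambda>\<omega>. x m \<omega> \<in> G n \<omega>)" for m n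
    unfolding G_def by (rule pred_in_face_at[OF P poly x xP x])
  have [measurable]: "(\<lambda>\<omega>. g \<omega> (G n \<omega>)) \<in> borel_measurable M" for n
    unfolding G_def by (rule g[OF x xP])
  have eq: "(\<Sum>F\<in>faces j (P \<omega>). g \<omega> F) =
      (\<Sum>n. if aff_dim (G n \<omega>) = int j \<and> (\<forall>m<n. \<not> (x m \<omega> \<in> G n \<omega> \<and> x n \<omega> \<in> G m \<omega>))
        then g \<omega> (G n \<omega>) else 0)" if w: "\<omega> \<in> space M" for \<omega>
  proof -
    have cvP: "convex (P \<omega>)" using poly[OF w] polyhedron_imp_convex by blast
    have "faces j (P \<omega>) \<subseteq> range (\<lambda>n. G n \<omega>)"
    proof
      fix F assume "F \<in> faces j (P \<omega>)"
      then have F: "F face_of P \<omega>" "F \<noteq> {}" by (auto simp: faces_def)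
      then obtain n where "x n \<omega> \<in> rel_interior F"
        unfolding x_def using closest_point_dense_seq_rel_interior[OF poly[OF w] F] by auto
      then have "F = G n \<omega>" unfolding G_def using face_at_unique[OF cvP F(1)] by simp
      then show "F \<in> range (\<lambda>n. G n \<omega>)" by (rule range_eqI)
    qed
    from sum_eq_suminf_first_occurrence[OF finite_faces[OF poly[OF w]] this]
    have "(\<Sum>F\<in>faces j (P \<omega>). g \<omega> F) =
      (\<Sum>n. if G n \<omega> \<in> faces j (P \<omega>) \<and> (\<forall>m<n. G m \<omega> \<noteq> G n \<omega>) then g \<omega> (G n \<omega>) else 0)" .
    moreover have "G n \<omega> \<in> faces j (P \<omega>) \<longleftrightarrow> aff_dim (G n \<omega>) = int j" for n
      using fo(1)[OF w] by (auto simp: faces_def)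
    moreover have "G m \<omega> = G n \<omega> \<longleftrightarrow> x m \<omega> \<in> G n \<omega> \<and> x n \<omega> \<in> G m \<omega>" for m n
    proof
      have in_G: "x k \<omega> \<in> G k \<omega>" for k using subsetD[OF rel_interior_subset fo(2)[OF w]] .
      show "G m \<omega> = G n \<omega> \<Longrightarrow> x m \<omega> \<in> G n \<omega> \<and> x n \<omega> \<in> G m \<omega>"
        using in_G[of m] in_G[of n] by simp
      assume *: "x m \<omega> \<in> G n \<omega> \<and> x n \<omega> \<in> G m \<omega>"
      have sub: "G k \<omega> \<subseteq> G l \<omega>" if "x k \<omega> \<in> G l \<omega>" for k l
        by (rule subset_of_face_of[OF fo(1)[OF w] face_of_imp_subset[OF fo(1)[OF w]]])
          (use fo(2)[OF w, of k] that in blast)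
      have "G m \<omega> \<subseteq> G n \<omega>" "G n \<omega> \<subseteq> G m \<omega>" using * sub by simp_all
      then show "G m \<omega> = G n \<omega>" by simp
    qed
    ultimately show ?thesis by simp
  qed
  have "(\<lambda>\<omega>. \<Sum>n. if aff_dim (G n \<omega>) = int j \<and> (\<forall>m<n. \<not> (x m \<omega> \<in> G n \<omega> \<and> x n \<omega> \<in> G m \<omega>))
        then g \<omega> (G n \<omega>) else 0) \<in> borel_measurable M" by measurable
  then show ?thesis using eq by (simp cong: measurable_cong)
qed

text \<open>
  By the Moreau decomposition the polar cone is the range of the residual map of the projection.
\<close>

lemma random_polar:
  fixes C :: "'w \<Rightarrow> 'a::euclidean_space set"
  assumes C: "random_nonempty_closed M C" and cv: "\<And>\<omega>. \<omega> \<in> space M \<Longrightarrow> convex (C \<omega>) \<and> cone (C \<omega>)"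
  shows "random_nonempty_closed M (\<lambda>\<omega>. polar (C \<omega>))"
proof -
  have eq: "polar (C \<omega>) = (\<lambda>z. z - closest_point (C \<omega>) z) ` UNIV" if "\<omega> \<in> space M" for \<omega>
    using polar_eq_range random_nonempty_closedD[OF C that] cv[OF that] by blast
  have "random_nonempty_closed M (\<lambda>\<omega>. (\<lambda>z. z - closest_point (C \<omega>) z) ` UNIV)"
  proof (rule random_nonempty_closed_image)
    show "random_nonempty_closed M (\<lambda>\<omega>. UNIV :: 'a set)" by (rule random_nonempty_closed_const) auto
    show "(\<lambda>\<omega>. Z \<omega> - closest_point (C \<omega>) (Z \<omega>)) \<in> borel_measurable M"
      if [measurable]: "Z \<in> borel_measurable M" for Z
    proof -
      have [measurable]: "(\<lambda>\<omega>. closest_point (C \<omega>) (Z \<omega>)) \<in> borel_measurable M"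
        by (rule borel_measurable_closest_point[OF C]) (use cv in auto)
      show ?thesis by measurable
    qed
    show "continuous_on UNIV (\<lambda>z. z - closest_point (C \<omega>) z)" if "\<omega> \<in> space M" for \<omega>
      using random_nonempty_closedD[OF C that] cv[OF that]
      by (intro continuous_intros continuous_on_closest_point) auto
    show "closed ((\<lambda>z. z - closest_point (C \<omega>) z) ` UNIV)" if "\<omega> \<in> space M" for \<omega>
      using eq[OF that] closed_polar by metis
  qed auto
  moreover have "(\<lambda>\<omega>. polar (C \<omega>)) \<in> M \<rightarrow>\<^sub>M closed_sets_borel \<longleftrightarrow>
      (\<lambda>\<omega>. (\<lambda>z. z - closest_point (C \<omega>) z) ` UNIV) \<in> M \<rightarrow>\<^sub>M closed_sets_borel"
    by (rule measurable_cong) (rule eq)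
  ultimately show ?thesis unfolding random_nonempty_closed_def using eq by metis
qed

section \<open>Measurability of angles\<close>

definition unit_ball_law :: "'a::euclidean_space measure" where
  "unit_ball_law = uniform_measure lborel (cball 0 1)"

text \<open>
  The solid angle, described by a random vector of the whole space: project a uniform point of the unit ball
  to the linear hull of the cone. For a linear subspace this gives 1, in agreement with the convention for
  solid angles.
\<close>

definition cone_angle :: "'a::euclidean_space set \<Rightarrow> ennreal" where
  "cone_angle C = emeasure unit_ball_law {z. closest_point (span C) z \<in> C}"

lemma prob_space_unit_ball_law: "prob_space (unit_ball_law :: 'a::euclidean_space measure)"
  unfolding unit_ball_law_def
  by (rule prob_space_uniform_measure)
    (simp_all add: emeasure_cball less_imp_neq[OF unit_ball_vol_pos[OF of_nat_0_le_iff], symmetric])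

lemma sets_unit_ball_law[simp, measurable_cong]: "sets unit_ball_law = sets borel"
  by (simp add: unit_ball_law_def)

lemma space_unit_ball_law[simp]: "space unit_ball_law = UNIV"
  by (simp add: unit_ball_law_def)

lemma borel_measurable_cone_angle:
  fixes C :: "'w \<Rightarrow> 'a::euclidean_space set"
  assumes C: "random_nonempty_closed M C" and cv: "\<And>\<omega>. \<omega> \<in> space M \<Longrightarrow> convex (C \<omega>)"
  shows "(\<lambda>\<omega>. cone_angle (C \<omega>)) \<in> borel_measurable M"
proof -
  interpret B: prob_space "unit_ball_law :: 'a measure" by (rule prob_space_unit_ball_law)
  let ?N = "M \<Otimes>\<^sub>M (unit_ball_law :: 'a measure)"
  have C': "random_nonempty_closed ?N (\<lambda>p. C (fst p))"
    by (rule random_nonempty_closed_compose[OF C]) simp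
  have S': "random_nonempty_closed ?N (\<lambda>p. span (C (fst p)))"
    by (rule borel_measurable_dim_span(1)[OF C']) (auto simp: space_pair_measure cv)
  have "(\<lambda>p. closest_point (span (C (fst p))) (snd p)) \<in> borel_measurable ?N"
    by (rule borel_measurable_closest_point[OF S']) (auto intro: subspace_imp_convex)
  from pred_mem_random_closed[OF C' this]
  have [measurable]: "Measurable.pred ?N (\<lambda>p. closest_point (span (C (fst p))) (snd p) \<in> C (fst p))" .
  have "(\<lambda>\<omega>. emeasure unit_ball_law {z \<in> space unit_ball_law. closest_point (span (C \<omega>)) z \<in> C \<omega>})
      \<in> borel_measurable M"
    by (rule B.measurable_emeasure) measurable
  then show ?thesis by (simp add: cone_angle_def)
qed

text \<open>
  By compactness of the unit sphere, the cone and the subspace meet outside the origin exactly when unit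
  vectors of the cone come arbitrarily close to the subspace; a dense sequence of the cone suffices to
  test this.
\<close>

lemma subspace_hits_cone_iff:
  fixes C W :: "'a::euclidean_space set"
  assumes W: "subspace W" and C: "closed C" "cone C" "C = closure (range \<xi>)"
  shows "W \<inter> C \<noteq> {0} \<longleftrightarrow>
    (\<forall>m. \<exists>n. \<xi> n \<noteq> 0 \<and> infdist (\<xi> n) W * real (Suc m) < norm (\<xi> n))" (is "_ \<longleftrightarrow> ?R")
proof
  note Wc = subspace_convex_closed[OF W]
  have rC: "\<xi> n \<in> C" for n unfolding C(3) using closure_subset by (rule subsetD) simp
  have zero: "0 \<in> W \<inter> C" using subspace_0[OF W] mem_cone[OF C(2) rC, of 0] by simp
  {
    assume "W \<inter> C \<noteq> {0}"
    then have "\<exists>v\<in>W \<inter> C. v \<noteq> 0" using zero by fastforce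
    then obtain v where v: "v \<in> W" "v \<in> C" "v \<noteq> 0" by auto
    show ?R
    proof
      fix m
      define s where "s = real (Suc m)"
      have s: "s \<ge> 1" by (simp add: s_def)
      define d where "d = norm v / (2 * (s + 1))"
      have nv: "norm v > 0" using v(3) by simp
      have d: "d > 0" "2 * (d * s + d) = norm v"
        using nv s by (simp_all add: d_def divide_simps) (simp_all add: algebra_simps)
      have ds: "d * s \<ge> d * 1" using d(1) s by (intro mult_left_mono) auto
      obtain n where n: "dist (\<xi> n) v < d"
        using v(2) d(1) unfolding C(3) closure_approachable by auto
      have "infdist (\<xi> n) W < d" using infdist_le[OF v(1)] n by (rule le_less_trans)
      then have 1: "infdist (\<xi> n) W * s \<le> d * s" using s by (intro mult_right_mono) auto
      have 2: "norm v - d < norm (\<xi> n)"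
        using n norm_triangle_ineq2[of v "\<xi> n"] by (simp add: dist_norm norm_minus_commute)
      have "infdist (\<xi> n) W * s < norm (\<xi> n)" using 1 2 d nv by argo
      moreover have "norm (\<xi> n) > 0" using 2 d ds nv by argo
      ultimately show "\<exists>n. \<xi> n \<noteq> 0 \<and> infdist (\<xi> n) W * real (Suc m) < norm (\<xi> n)"
        unfolding s_def by (intro exI[of _ n]) auto
    qed
  next
    assume R: ?R
    let ?K = "C \<inter> sphere 0 1"
    have approx: "\<exists>u\<in>?K. infdist u W < 1 / real (Suc m)" for m
    proof -
      obtain n where n: "\<xi> n \<noteq> 0" "infdist (\<xi> n) W * real (Suc m) < norm (\<xi> n)" using R by blast
      obtain w where w: "w \<in> W" "infdist (\<xi> n) W = dist (\<xi> n) w"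
        using infdist_attains_inf[OF Wc(1,3)] by blast
      let ?c = "1 / norm (\<xi> n)"
      have "infdist (?c *\<^sub>R \<xi> n) W \<le> dist (?c *\<^sub>R \<xi> n) (?c *\<^sub>R w)"
        by (rule infdist_le) (rule subspace_mul[OF W w(1)])
      also have "\<dots> = ?c * infdist (\<xi> n) W"
        using w(2) by (simp add: dist_norm scaleR_diff_right[symmetric])
      also have "\<dots> < 1 / real (Suc m)" using n by (simp add: field_simps)
      finally have "infdist (?c *\<^sub>R \<xi> n) W < 1 / real (Suc m)" .
      moreover have "?c *\<^sub>R \<xi> n \<in> ?K" using mem_cone[OF C(2) rC, of ?c n] n(1) by simp
      ultimately show ?thesis by blast
    qed
    have "compact ?K" using C(1) by (intro closed_Int_compact) auto
    moreover have "?K \<noteq> {}" using approx by blast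
    moreover have "continuous_on ?K (\<lambda>u. infdist u W)" by (intro continuous_intros)
    ultimately have "\<exists>u\<in>?K. \<forall>v\<in>?K. infdist u W \<le> infdist v W"
      by (rule continuous_attains_inf)
    then obtain u where u: "u \<in> ?K" "\<And>v. v \<in> ?K \<Longrightarrow> infdist u W \<le> infdist v W"
      by (elim bexE) (rule that, auto)
    have "infdist u W = 0"
    proof (rule ccontr)
      assume "infdist u W \<noteq> 0"
      then have "infdist u W > 0" using infdist_nonneg[of u W] by linarith
      then obtain m where "1 / real (Suc m) < infdist u W" using nat_approx_posE by blast
      then show False using approx[of m] u(2) by fastforce
    qed
    then have "u \<in> W" using in_closed_iff_infdist_zero[OF Wc(1,3)] by simp
    moreover have "u \<in> C" "norm u = 1" using u(1) by simp_all
    ultimately have "u \<in> W \<inter> C" "u \<noteq> 0" by auto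
    then show "W \<inter> C \<noteq> {0}" by (metis singletonD)
  }
qed

lemma pred_subspace_hits_cone:
  fixes C W :: "'w \<Rightarrow> 'a::euclidean_space set"
  assumes C: "random_nonempty_closed N C" and cv: "\<And>\<omega>. \<omega> \<in> space N \<Longrightarrow> convex (C \<omega>) \<and> cone (C \<omega>)"
    and W: "random_nonempty_closed N W" and sub: "\<And>\<omega>. \<omega> \<in> space N \<Longrightarrow> subspace (W \<omega>)"
  shows "Measurable.pred N (\<lambda>\<omega>. W \<omega> \<inter> C \<omega> \<noteq> {0})"
proof -
  obtain \<xi> :: "nat \<Rightarrow> 'w \<Rightarrow> 'a" where \<xi>[measurable]: "\<And>n. \<xi> n \<in> borel_measurable N"
    and dense: "\<And>\<omega>. \<omega> \<in> space N \<Longrightarrow> C \<omega> = closure (range (\<lambda>n. \<xi> n \<omega>))"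
    using random_closed_dense_seq[OF C] cv by blast
  have [measurable]: "(\<lambda>\<omega>. infdist (\<xi> n \<omega>) (W \<omega>)) \<in> borel_measurable N" for n
    by (rule borel_measurable_infdist_random[OF W]) simp
  have "Measurable.pred N (\<lambda>\<omega>. \<forall>m. \<exists>n. \<xi> n \<omega> \<noteq> 0 \<and>
      infdist (\<xi> n \<omega>) (W \<omega>) * real (Suc m) < norm (\<xi> n \<omega>))" by measurable
  moreover have "W \<omega> \<inter> C \<omega> \<noteq> {0} \<longleftrightarrow> (\<forall>m. \<exists>n. \<xi> n \<omega> \<noteq> 0 \<and>
      infdist (\<xi> n \<omega>) (W \<omega>) * real (Suc m) < norm (\<xi> n \<omega>))" if "\<omega> \<in> space N" for \<omega>
    using that random_nonempty_closedD(1)[OF C that] cv[OF that] dense[OF that] sub[OF that]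
    by (intro subspace_hits_cone_iff) auto
  ultimately show ?thesis by (simp cong: measurable_cong)
qed

section \<open>Invariance and uniqueness of measures\<close>

text \<open>
  Both sides are evaluations of the double integral of \<open>1\<^sub>A (x + y) 1\<^sub>B (y)\<close>: translating \<open>x\<close> by \<open>y\<close> gives the left
  one, translating \<open>y\<close> by \<open>x\<close> and using the symmetry of \<open>B\<close> gives the right one.
\<close>

lemma translation_invariant_measures_proportional:
  fixes \<mu> \<nu> :: "'a::euclidean_space measure"
  assumes \<mu>: "sigma_finite_measure \<mu>" "sets \<mu> = sets borel" "\<And>c. distr \<mu> borel ((+) c) = \<mu>"
    and \<nu>: "sigma_finite_measure \<nu>" "sets \<nu> = sets borel" "\<And>c. distr \<nu> borel ((+) c) = \<nu>"
    and [measurable]: "A \<in> sets borel" "B \<in> sets borel" and sym: "\<And>x. - x \<in> B \<longleftrightarrow> x \<in> B"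
  shows "emeasure \<mu> A * emeasure \<nu> B = emeasure \<mu> B * emeasure \<nu> A"
proof -
  interpret M: sigma_finite_measure \<mu> by fact
  interpret N: sigma_finite_measure \<nu> by fact
  interpret pair_sigma_finite \<mu> \<nu> ..
  note [measurable_cong] = \<mu>(2) \<nu>(2)
  have tr\<mu>: "(\<integral>\<^sup>+x. f (c + x) \<partial>\<mu>) = (\<integral>\<^sup>+x. f x \<partial>\<mu>)" if [measurable]: "f \<in> borel_measurable borel" for f c
  proof -
    have "(\<integral>\<^sup>+x. f x \<partial>distr \<mu> borel ((+) c)) = (\<integral>\<^sup>+x. f (c + x) \<partial>\<mu>)"
      by (rule nn_integral_distr) measurable
    then show ?thesis by (simp add: \<mu>(3))
  qed
  have tr\<nu>: "(\<integral>\<^sup>+x. f (c + x) \<partial>\<nu>) = (\<integral>\<^sup>+x. f x \<partial>\<nu>)" if [measurable]: "f \<in> borel_measurable borel" for f c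
  proof -
    have "(\<integral>\<^sup>+x. f x \<partial>distr \<nu> borel ((+) c)) = (\<integral>\<^sup>+x. f (c + x) \<partial>\<nu>)"
      by (rule nn_integral_distr) measurable
    then show ?thesis by (simp add: \<nu>(3))
  qed
  have iB: "indicator B (- x) = (indicator B x :: ennreal)" for x
    by (simp add: indicator_def sym)
  have i\<mu>: "(\<integral>\<^sup>+x. indicator A x * c \<partial>\<mu>) = emeasure \<mu> A * c"
    and i\<mu>': "(\<integral>\<^sup>+x. c * indicator B x \<partial>\<mu>) = c * emeasure \<mu> B" for c
    by (simp_all add: nn_integral_multc nn_integral_cmult \<mu>(2))
  have i\<nu>: "(\<integral>\<^sup>+x. indicator A x * c \<partial>\<nu>) = emeasure \<nu> A * c"
    and i\<nu>': "(\<integral>\<^sup>+x. c * indicator B x \<partial>\<nu>) = c * emeasure \<nu> B" for c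
    by (simp_all add: nn_integral_multc nn_integral_cmult \<nu>(2))
  have "emeasure \<mu> A * emeasure \<nu> B = (\<integral>\<^sup>+y. (\<integral>\<^sup>+x. indicator A x * indicator B y \<partial>\<mu>) \<partial>\<nu>)"
    by (simp add: i\<mu> i\<nu>')
  also have "\<dots> = (\<integral>\<^sup>+y. (\<integral>\<^sup>+x. indicator A (y + x) * indicator B y \<partial>\<mu>) \<partial>\<nu>)"
    using tr\<mu>[of "\<lambda>x. indicator A x * indicator B y" for y] by simp
  also have "\<dots> = (\<integral>\<^sup>+x. (\<integral>\<^sup>+y. indicator A (y + x) * indicator B y \<partial>\<nu>) \<partial>\<mu>)"
    by (rule Fubini') measurable
  also have "\<dots> = (\<integral>\<^sup>+x. (\<integral>\<^sup>+y. indicator A y * indicator B (y - x) \<partial>\<nu>) \<partial>\<mu>)"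
  proof (rule nn_integral_cong)
    fix x
    show "(\<integral>\<^sup>+y. indicator A (y + x) * indicator B y \<partial>\<nu>) =
        (\<integral>\<^sup>+y. indicator A y * indicator B (y - x) \<partial>\<nu>)"
      using tr\<nu>[of "\<lambda>y. indicator A y * indicator B (y - x)" x] by (simp add: add.commute[of x])
  qed
  also have "\<dots> = (\<integral>\<^sup>+y. (\<integral>\<^sup>+x. indicator A y * indicator B (y - x) \<partial>\<mu>) \<partial>\<nu>)"
    by (rule Fubini'[symmetric]) measurable
  also have "\<dots> = (\<integral>\<^sup>+y. (\<integral>\<^sup>+x. indicator A y * indicator B x \<partial>\<mu>) \<partial>\<nu>)"
  proof (rule nn_integral_cong)
    fix y
    have "indicator B (y - x) = (indicator B (- y + x) :: ennreal)" for x using iB[of "y - x"] by simp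
    then show "(\<integral>\<^sup>+x. indicator A y * indicator B (y - x) \<partial>\<mu>) =
        (\<integral>\<^sup>+x. indicator A y * indicator B x \<partial>\<mu>)"
      using tr\<mu>[of "\<lambda>x. indicator A y * indicator B x" "- y"] by simp
  qed
  also have "\<dots> = emeasure \<mu> B * emeasure \<nu> A"
    by (simp add: i\<mu>' i\<nu> mult.commute)
  finally show ?thesis .
qed

lemma orthogonal_transformation_measurable:
  fixes T :: "'a::euclidean_space \<Rightarrow> 'a"
  assumes "orthogonal_transformation T"
  shows "T \<in> borel_measurable borel"
proof -
  have "bounded_linear T"
    using assms by (simp add: orthogonal_transformation_def linear_conv_bounded_linear)
  then show ?thesis by (intro borel_measurable_continuous_onI linear_continuous_on)
qed

text \<open>
  The image measure is translation invariant, hence proportional to Lebesgue measure; the factor is 1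
  because the unit ball is preserved.
\<close>

lemma distr_lborel_orthogonal_transformation:
  fixes T :: "'a::euclidean_space \<Rightarrow> 'a"
  assumes T: "orthogonal_transformation T"
  shows "distr lborel borel T = lborel"
proof -
  note [measurable] = orthogonal_transformation_measurable[OF T]
  let ?\<nu> = "distr lborel borel T"
  obtain S where S: "orthogonal_transformation S" "\<And>x. T (S x) = x"
    using orthogonal_transformation_inv[OF T] orthogonal_transformation_surj[OF T] surj_f_inv_f by metis
  have nT: "norm (T x) = norm x" for x using T by (rule orthogonal_transformation_norm)
  have lin: "linear T" using T by (simp add: orthogonal_transformation_def)
  have pre: "T -` ball 0 r = ball 0 r" for r by (auto simp: nT)
  have ball: "emeasure ?\<nu> (ball 0 r) = emeasure lborel (ball (0::'a) r)" for r
    by (subst emeasure_distr) (auto simp: pre)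
  have sf: "sigma_finite_measure ?\<nu>"
  proof
    show "\<exists>A. countable A \<and> A \<subseteq> sets ?\<nu> \<and> \<Union> A = space ?\<nu> \<and> (\<forall>a\<in>A. emeasure ?\<nu> a \<noteq> \<infinity>)"
    proof (intro exI[of _ "range (\<lambda>n. ball (0::'a) (real n))"] conjI ballI)
      show "\<Union> (range (\<lambda>n. ball (0::'a) (real n))) = space ?\<nu>"
        using reals_Archimedean2 by auto
      show "emeasure ?\<nu> a \<noteq> \<infinity>" if "a \<in> range (\<lambda>n. ball (0::'a) (real n))" for a
        using that ball emeasure_lborel_ball_finite[of "0::'a"] by (auto simp: less_top[symmetric])
    qed auto
  qed
  have trans: "distr ?\<nu> borel ((+) c) = ?\<nu>" for c
  proof -
    have "distr ?\<nu> borel ((+) c) = distr lborel borel (\<lambda>x. c + T x)"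
      by (subst distr_distr) (auto simp: comp_def)
    also have "(\<lambda>x. c + T x) = (\<lambda>x. T (S c + x))" by (simp add: linear_add[OF lin] S(2))
    also have "distr lborel borel (\<lambda>x. T (S c + x)) = distr (distr lborel borel ((+) (S c))) borel T"
      by (subst distr_distr) (auto simp: comp_def)
    also have "\<dots> = ?\<nu>" by (simp add: lborel_distr_plus)
    finally show ?thesis .
  qed
  have sym: "- x \<in> ball 0 1 \<longleftrightarrow> x \<in> ball 0 1" for x :: 'a by simp
  have fin: "emeasure lborel (ball (0::'a) 1) \<noteq> 0" "emeasure lborel (ball (0::'a) 1) \<noteq> \<infinity>"
    using emeasure_lborel_ball_finite[of "0::'a" 1]
    by (simp_all add: emeasure_ball less_imp_neq[OF unit_ball_vol_pos[OF of_nat_0_le_iff], symmetric])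
  show ?thesis
  proof (rule measure_eqI)
    fix A assume "A \<in> sets ?\<nu>"
    then have A: "A \<in> sets borel" by simp
    have "emeasure lborel A * emeasure ?\<nu> (ball 0 1) = emeasure lborel (ball (0::'a) 1) * emeasure ?\<nu> A"
    proof (rule translation_invariant_measures_proportional[where \<mu>=lborel and \<nu>="?\<nu>"])
      show "sigma_finite_measure lborel" by (rule lborel.sigma_finite_measure_axioms)
    qed (simp_all add: sf trans A lborel_distr_plus)
    then show "emeasure ?\<nu> A = emeasure lborel A"
      using fin unfolding ball by (simp add: mult.commute[of "emeasure lborel A"] ennreal_mult_cancel_left)
  qed simp
qed

lemma distr_uniform_measure_orthogonal_transformation:
  fixes T :: "'a::euclidean_space \<Rightarrow> 'a"
  assumes T: "orthogonal_transformation T" and S: "S \<in> sets borel" "T -` S = S"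
  shows "distr (uniform_measure lborel S) borel T = uniform_measure lborel S"
proof (rule measure_eqI)
  note [measurable] = orthogonal_transformation_measurable[OF T] S(1)
  fix A :: "'a set" assume "A \<in> sets (distr (uniform_measure lborel S) borel T)"
  then have [measurable]: "A \<in> sets borel" by simp
  have TA[measurable]: "T -` A \<in> sets borel"
    using measurable_sets[OF orthogonal_transformation_measurable[OF T], of A] by simp
  have "emeasure lborel (S \<inter> A) = emeasure (distr lborel borel T) (S \<inter> A)"
    by (simp add: distr_lborel_orthogonal_transformation[OF T])
  also have "\<dots> = emeasure lborel (S \<inter> T -` A)" by (subst emeasure_distr) (auto simp: S(2))
  finally have eq: "emeasure lborel (S \<inter> A) = emeasure lborel (S \<inter> T -` A)" .
  have "emeasure (distr (uniform_measure lborel S) borel T) A = emeasure (uniform_measure lborel S) (T -` A)"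
    by (subst emeasure_distr) auto
  then show "emeasure (distr (uniform_measure lborel S) borel T) A = emeasure (uniform_measure lborel S) A"
    using eq by simp
qed simp

lemma distr_unit_ball_law_orthogonal_transformation:
  fixes T :: "'a::euclidean_space \<Rightarrow> 'a"
  assumes T: "orthogonal_transformation T"
  shows "distr unit_ball_law borel T = unit_ball_law"
  unfolding unit_ball_law_def
  by (rule distr_uniform_measure_orthogonal_transformation[OF T]) (auto simp: orthogonal_transformation_norm[OF T])

text \<open>
  Christensen's argument for the uniqueness of uniformly distributed measures on a compact set \<open>K\<close>. Let
  \<open>h r\<close> be the measure of a ball of radius \<open>r\<close> centred in \<open>K\<close>. Integrating the indicator of \<open>\<bar>x - y\<bar> < r\<close> with
  respect to both measures shows first that \<open>h\<close> is the same for both, and then, with \<open>x\<close> restricted to \<open>F\<close>,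
  that \<open>\<mu> F\<close> is at most the \<open>\<nu>\<close>-measure of the \<open>r\<close>-neighbourhood of \<open>F\<close>. Finally let \<open>r\<close> tend to 0.
\<close>

lemma uniformly_distributed_measures_le:
  fixes \<mu> \<nu> :: "'a::euclidean_space measure"
  assumes K: "compact K"
    and \<mu>: "prob_space \<mu>" "sets \<mu> = sets borel" "emeasure \<mu> K = 1"
      "\<And>x y r. x \<in> K \<Longrightarrow> y \<in> K \<Longrightarrow> emeasure \<mu> (ball x r) = emeasure \<mu> (ball y r)"
    and \<nu>: "prob_space \<nu>" "sets \<nu> = sets borel" "emeasure \<nu> K = 1"
      "\<And>x y r. x \<in> K \<Longrightarrow> y \<in> K \<Longrightarrow> emeasure \<nu> (ball x r) = emeasure \<nu> (ball y r)"
    and F: "closed F"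
  shows "emeasure \<mu> F \<le> emeasure \<nu> F"
proof (cases "F = {}")
  case False
  interpret M: prob_space \<mu> by fact
  interpret N: prob_space \<nu> by fact
  interpret pair_sigma_finite \<mu> \<nu> ..
  note [measurable_cong] = \<mu>(2) \<nu>(2)
  have [measurable]: "F \<in> sets borel" "K \<in> sets borel"
    using F K by (auto intro: borel_closed borel_compact)
  have "K \<noteq> {}" using \<mu>(3) by auto
  then obtain k where k: "k \<in> K" by auto
  define h where "h \<rho> r = emeasure \<rho> (ball k r)" for \<rho> r
  have AE\<mu>: "AE x in \<mu>. x \<in> K" using \<mu>(3) by (intro M.AE_prob_1) (simp add: M.emeasure_eq_measure)
  have AE\<nu>: "AE x in \<nu>. x \<in> K" using \<nu>(3) by (intro N.AE_prob_1) (simp add: N.emeasure_eq_measure)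
  have pos: "h \<nu> r \<noteq> 0" if r: "r > 0" for r
  proof
    assume "h \<nu> r = 0"
    then have z: "emeasure \<nu> (ball x r) = 0" if "x \<in> K" for x using \<nu>(4)[OF that k] by (simp add: h_def)
    obtain C where C: "C \<subseteq> K" "finite C" "K \<subseteq> (\<Union>x\<in>C. ball x r)"
      using seq_compact_imp_totally_bounded[OF compact_imp_seq_compact[OF K]] r by auto
    have "emeasure \<nu> K \<le> emeasure \<nu> (\<Union>x\<in>C. ball x r)" using C by (intro emeasure_mono) auto
    also have "\<dots> \<le> (\<Sum>x\<in>C. emeasure \<nu> (ball x r))" using C by (intro emeasure_subadditive_finite) auto
    also have "\<dots> = 0" using z C by (intro sum.neutral) auto
    finally show False using \<nu>(3) by simp
  qed
  have dbl: "(\<integral>\<^sup>+y. (\<integral>\<^sup>+x. indicator G x * indicator (ball x r) y \<partial>\<mu>) \<partial>\<nu>) = emeasure \<mu> G * h \<nu> r"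
    if [measurable]: "G \<in> sets borel" for G r
  proof -
    have "(\<integral>\<^sup>+y. (\<integral>\<^sup>+x. indicator G x * indicator (ball x r) y \<partial>\<mu>) \<partial>\<nu>) =
      (\<integral>\<^sup>+x. (\<integral>\<^sup>+y. indicator G x * indicator (ball x r) y \<partial>\<nu>) \<partial>\<mu>)"
      by (rule Fubini') (unfold indicator_def ball_def mem_Collect_eq, measurable)
    also have "\<dots> = (\<integral>\<^sup>+x. indicator G x * emeasure \<nu> (ball x r) \<partial>\<mu>)"
      by (intro nn_integral_cong nn_integral_cmult_indicator) (simp add: \<nu>(2))
    also have "\<dots> = (\<integral>\<^sup>+x. indicator G x * h \<nu> r \<partial>\<mu>)"
      using AE\<mu> \<nu>(4)[OF _ k] by (intro nn_integral_cong_AE) (auto simp: h_def)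
    also have "\<dots> = emeasure \<mu> G * h \<nu> r" using nn_integral_cmult_indicator[of G \<mu> "h \<nu> r"] \<mu>(2) by (simp add: mult.commute)
    finally show ?thesis .
  qed
  have sw: "(\<integral>\<^sup>+x. c * indicator (ball x r) y \<partial>\<mu>) = c * emeasure \<mu> (ball y r)" for c y r
  proof -
    have "indicator (ball x r) y = (indicator (ball y r) x :: ennreal)" for x
      by (simp add: indicator_def dist_commute)
    then show ?thesis using nn_integral_cmult_indicator[of "ball y r" \<mu> c] \<mu>(2) by simp
  qed
  (* The case in which x is unrestricted. *)
  have hh: "h \<mu> r = h \<nu> r" for r
  proof -
    have "h \<nu> r = (\<integral>\<^sup>+y. (\<integral>\<^sup>+x. indicator (ball x r) y \<partial>\<mu>) \<partial>\<nu>)"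
      using dbl[of UNIV r] M.emeasure_space_1 sets_eq_imp_space_eq[OF \<mu>(2)] by simp
    also have "\<dots> = (\<integral>\<^sup>+y. h \<mu> r \<partial>\<nu>)"
      using AE\<nu> \<mu>(4)[OF _ k] sw[of 1] by (intro nn_integral_cong_AE) (auto simp: h_def)
    also have "\<dots> = h \<mu> r" by (simp add: N.emeasure_space_1)
    finally show ?thesis by simp
  qed
  have le: "emeasure \<mu> F \<le> emeasure \<nu> {x. infdist x F < r}" if r: "r > 0" for r
  proof -
    have [measurable]: "{x. infdist x F < r} \<in> sets borel"
      by (intro borel_open open_Collect_less continuous_intros)
    have fin: "h \<nu> r \<noteq> \<infinity>" by (simp add: h_def)
    have "emeasure \<mu> F * h \<nu> r = (\<integral>\<^sup>+y. (\<integral>\<^sup>+x. indicator F x * indicator (ball x r) y \<partial>\<mu>) \<partial>\<nu>)"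
      by (simp add: dbl)
    also have "\<dots> \<le> (\<integral>\<^sup>+y. (\<integral>\<^sup>+x. indicator {x. infdist x F < r} y * indicator (ball x r) y \<partial>\<mu>) \<partial>\<nu>)"
    proof (intro nn_integral_mono)
      fix x y
      have "infdist y F < r" if "x \<in> F" "dist x y < r"
        using infdist_le[OF that(1), of y] that(2) by (simp add: dist_commute)
      then show "indicator F x * indicator (ball x r) y
          \<le> (indicator {x. infdist x F < r} y * indicator (ball x r) y :: ennreal)"
        by (auto simp: indicator_def)
    qed
    also have "\<dots> = (\<integral>\<^sup>+y. indicator {x. infdist x F < r} y * emeasure \<mu> (ball y r) \<partial>\<nu>)"
      by (intro nn_integral_cong) (rule sw)
    also have "\<dots> = (\<integral>\<^sup>+y. indicator {x. infdist x F < r} y * h \<nu> r \<partial>\<nu>)"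
      using AE\<nu> \<mu>(4)[OF _ k] by (intro nn_integral_cong_AE) (auto simp: hh[symmetric], auto simp: h_def)
    also have "\<dots> = emeasure \<nu> {x. infdist x F < r} * h \<nu> r" 
      using nn_integral_cmult_indicator[of "{x. infdist x F < r}" \<nu> "h \<nu> r"] \<nu>(2) by (simp add: mult.commute)
    finally show ?thesis using pos[OF r] fin by (simp add: ennreal_mult_le_mult_iff mult.commute[of _ "h \<nu> r"])
  qed
  let ?A = "\<lambda>n. {x. infdist x F < 1 / real (Suc n)}"
  have "(\<lambda>n. emeasure \<nu> (?A n)) \<longlonglongrightarrow> emeasure \<nu> (\<Inter>n. ?A n)"
  proof (rule Lim_emeasure_decseq)
    show "range ?A \<subseteq> sets \<nu>"
      using \<nu>(2) by (auto intro!: borel_open open_Collect_less continuous_intros)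
    show "decseq ?A" by (auto simp: decseq_def frac_le intro: less_le_trans)
  qed simp
  moreover have "(\<Inter>n. ?A n) = F"
  proof
    show "F \<subseteq> (\<Inter>n. ?A n)" by auto
    show "(\<Inter>n. ?A n) \<subseteq> F"
    proof
      fix x assume x: "x \<in> (\<Inter>n. ?A n)"
      have "infdist x F = 0"
      proof (rule ccontr)
        assume "infdist x F \<noteq> 0"
        then have "infdist x F > 0" using infdist_nonneg[of x F] by linarith
        then obtain n where "1 / real (Suc n) < infdist x F" using nat_approx_posE by blast
        moreover have "infdist x F < 1 / real (Suc n)" using x by blast
        ultimately show False by simp
      qed
      then show "x \<in> F" using in_closed_iff_infdist_zero[OF F False] by simp
    qed
  qed
  ultimately have "(\<lambda>n. emeasure \<nu> (?A n)) \<longlonglongrightarrow> emeasure \<nu> F" by simp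
  then show ?thesis using le by (intro LIMSEQ_le_const) auto
qed simp

lemma uniformly_distributed_measures_eq:
  fixes \<mu> \<nu> :: "'a::euclidean_space measure"
  assumes K: "compact K"
    and \<mu>: "prob_space \<mu>" "sets \<mu> = sets borel" "emeasure \<mu> K = 1"
      "\<And>x y r. x \<in> K \<Longrightarrow> y \<in> K \<Longrightarrow> emeasure \<mu> (ball x r) = emeasure \<mu> (ball y r)"
    and \<nu>: "prob_space \<nu>" "sets \<nu> = sets borel" "emeasure \<nu> K = 1"
      "\<And>x y r. x \<in> K \<Longrightarrow> y \<in> K \<Longrightarrow> emeasure \<nu> (ball x r) = emeasure \<nu> (ball y r)"
  shows "\<mu> = \<nu>"
proof (rule measure_eqI_generator_eq[where E="Collect closed" and \<Omega>=UNIV and A="\<lambda>_. UNIV"])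
  show "Int_stable (Collect closed)" by (auto simp: Int_stable_def)
  show "emeasure \<mu> X = emeasure \<nu> X" if "X \<in> Collect closed" for X
    using uniformly_distributed_measures_le[OF K \<mu> \<nu>] uniformly_distributed_measures_le[OF K \<nu> \<mu>] that
    by (intro antisym) auto
  show "sets \<mu> = sigma_sets UNIV (Collect closed)" "sets \<nu> = sigma_sets UNIV (Collect closed)"
    using \<mu>(2) \<nu>(2) by (simp_all add: borel_eq_closed)
  show "emeasure \<mu> UNIV \<noteq> \<infinity>" using prob_space.emeasure_space_1[OF \<mu>(1)] sets_eq_imp_space_eq[OF \<mu>(2)] by simp
qed auto

section \<open>Uniform laws on spheres and solid angles\<close>

text \<open>
  For \<open>a = 0\<close> division by zero makes this the identity, which is orthogonal as well.
\<close>

definition reflection :: "'a::euclidean_space \<Rightarrow> 'a \<Rightarrow> 'a" where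
  "reflection a z = z - (2 * (z \<bullet> a) / (a \<bullet> a)) *\<^sub>R a"

lemma reflection_involution: "reflection a (reflection a z) = z"
  by (cases "a = 0") (simp_all add: reflection_def inner_diff_left diff_divide_distrib)

lemma linear_reflection: "linear (reflection a)"
  by (rule linearI)
    (simp_all add: reflection_def inner_add_left algebra_simps add_divide_distrib)

lemma orthogonal_transformation_reflection: "orthogonal_transformation (reflection a)"
  unfolding orthogonal_transformation_def
proof (intro conjI allI linear_reflection)
  fix v w show "reflection a v \<bullet> reflection a w = v \<bullet> w"
  proof (cases "a = 0")
    case False
    then have "a \<bullet> a \<noteq> 0" by simp
    then show ?thesis
      by (simp add: reflection_def inner_diff_left inner_diff_right inner_commute divide_simps)
  qed (simp add: reflection_def)
qed

lemma reflection_swap: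
  assumes "norm x = norm y"
  shows "reflection (x - y) x = y"
proof (cases "x = y")
  case False
  have xy: "x \<bullet> x = y \<bullet> y" using assms by (simp add: norm_eq)
  then have "2 * (x \<bullet> (x - y)) = (x - y) \<bullet> (x - y)"
    by (simp add: inner_diff_left inner_diff_right inner_commute)
  moreover have "(x - y) \<bullet> (x - y) \<noteq> 0" using False by simp
  ultimately show ?thesis unfolding reflection_def by simp
qed (simp add: reflection_def)

lemma reflection_orthogonal: "a \<bullet> v = 0 \<Longrightarrow> reflection a v = v"
  by (simp add: reflection_def inner_commute)

lemma reflection_image_subspace:
  assumes "subspace L" "a \<in> L"
  shows "reflection a ` L = L"
proof -
  have sub: "reflection a z \<in> L" if "z \<in> L" for z
    unfolding reflection_def using assms that by (intro subspace_diff subspace_mul)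
  show ?thesis
  proof
    show "L \<subseteq> reflection a ` L" using sub reflection_involution by (metis image_eqI subsetI)
  qed (use sub in blast)
qed

lemma closest_point_orthogonal_image:
  fixes S :: "'a::euclidean_space set" and T :: "'a \<Rightarrow> 'a"
  assumes T: "orthogonal_transformation T" and S: "closed S" "convex S" "S \<noteq> {}"
  shows "closest_point (T ` S) (T z) = T (closest_point S z)"
proof -
  have lin: "linear T" using T by (simp add: orthogonal_transformation_def)
  have iso: "dist (T x) (T y) = dist x y" for x y
    using T by (simp add: dist_norm linear_diff[OF lin, symmetric] orthogonal_transformation_norm)
  have 1: "T (closest_point S z) \<in> T ` S" using closest_point_in_set[OF S(1,3)] by simp
  have 2: "closed (T ` S)"
    using closed_injective_linear_image[OF S(1) lin orthogonal_transformation_inj[OF T]] .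
  have 3: "\<forall>x\<in>T ` S. dist (T z) (T (closest_point S z)) \<le> dist (T z) x"
    using closest_point_le[OF S(1)] by (auto simp: iso)
  from closest_point_unique[OF convex_linear_image[OF lin S(2)] 2 1 3] show ?thesis by simp
qed

text \<open>
  The reflection along \<open>x - y\<close> exchanges two unit vectors \<open>x\<close> and \<open>y\<close> of \<open>L\<close>, so an invariant law gives equal
  mass to balls of equal radius, and uniformly distributed laws are unique.
\<close>

lemma reflection_invariant_law_unique:
  fixes L :: "'a::euclidean_space set"
  assumes L: "subspace L"
    and \<mu>: "prob_space \<mu>" "sets \<mu> = sets borel" "emeasure \<mu> (sphere 0 1 \<inter> L) = 1"
      "\<And>a. a \<in> L \<Longrightarrow> distr \<mu> borel (reflection a) = \<mu>"
    and \<nu>: "prob_space \<nu>" "sets \<nu> = sets borel" "emeasure \<nu> (sphere 0 1 \<inter> L) = 1"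
      "\<And>a. a \<in> L \<Longrightarrow> distr \<nu> borel (reflection a) = \<nu>"
  shows "\<mu> = \<nu>"
proof -
  have ball: "emeasure \<rho> (ball x r) = emeasure \<rho> (ball y r)"
    if xy: "x \<in> sphere 0 1 \<inter> L" "y \<in> sphere 0 1 \<inter> L" and s: "sets \<rho> = sets borel"
      and inv: "\<And>a. a \<in> L \<Longrightarrow> distr \<rho> borel (reflection a) = \<rho>"
    for x y :: 'a and r and \<rho> :: "'a measure"
  proof -
    let ?R = "reflection (x - y)"
    have a: "x - y \<in> L" using xy L by (auto intro: subspace_diff)
    have R: "?R x = y" using xy by (intro reflection_swap) auto
    have lin: "linear ?R" by (rule linear_reflection)
    have "norm (x - ?R z) = norm (y - z)" for z
    proof -
      have "norm (x - ?R z) = norm (?R (x - ?R z))"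
        using orthogonal_transformation_norm[OF orthogonal_transformation_reflection] by metis
      also have "?R (x - ?R z) = y - z" by (simp add: linear_diff[OF lin] R reflection_involution)
      finally show ?thesis .
    qed
    then have pre: "?R -` ball x r = ball y r" by (auto simp: dist_norm)
    have m: "?R \<in> \<rho> \<rightarrow>\<^sub>M borel"
      using orthogonal_transformation_measurable[OF orthogonal_transformation_reflection]
      by (simp add: measurable_cong_sets[OF s refl])
    have "emeasure \<rho> (ball x r) = emeasure (distr \<rho> borel ?R) (ball x r)" by (simp add: inv[OF a])
    also have "\<dots> = emeasure \<rho> (ball y r)"
      using sets_eq_imp_space_eq[OF s] by (subst emeasure_distr[OF m]) (auto simp: pre)
    finally show ?thesis .
  qed
  show ?thesis
  proof (rule uniformly_distributed_measures_eq[OF _ \<mu>(1-3) _ \<nu>(1-3)])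
    show "compact (sphere 0 1 \<inter> L)" using subspace_convex_closed[OF L] by (intro compact_Int_closed) auto
    fix x y r assume xy: "x \<in> sphere 0 1 \<inter> L" "y \<in> sphere 0 1 \<inter> L"
    show "emeasure \<mu> (ball x r) = emeasure \<mu> (ball y r)" by (rule ball[OF xy \<mu>(2,4)])
    show "emeasure \<nu> (ball x r) = emeasure \<nu> (ball y r)" by (rule ball[OF xy \<nu>(2,4)])
  qed
qed

lemma AE_unit_ball_law:
  assumes "AE z in lborel. P z"
  shows "AE z in unit_ball_law. P z"
  unfolding unit_ball_law_def using assms by (intro AE_uniform_measureI) auto

text \<open>
  The projection vanishes only on the orthogonal complement of \<open>L\<close>, which lies in a hyperplane.
\<close>

lemma AE_closest_point_subspace_nonzero:
  fixes L :: "'a::euclidean_space set"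
  assumes L: "subspace L" "L \<noteq> {0}"
  shows "AE z in unit_ball_law. closest_point L z \<noteq> 0"
proof (rule AE_unit_ball_law)
  obtain v where v: "v \<in> L" "v \<noteq> 0" using L subspace_0 by fastforce
  have "negligible {z. v \<bullet> z = 0}" using v by (intro negligible_hyperplane) auto
  then have "{z. v \<bullet> z = 0} \<in> null_sets lebesgue" by (simp add: negligible_iff_null_sets)
  then have "AE z in lebesgue. z \<notin> {z. v \<bullet> z = 0}" by (rule AE_not_in)
  then have "AE z in lborel. z \<notin> {z. v \<bullet> z = 0}" by (simp add: AE_completion_iff)
  then show "AE z in lborel. closest_point L z \<noteq> 0"
  proof (rule AE_mp, intro AE_I2 impI notI)
    fix z assume z: "z \<notin> {z. v \<bullet> z = 0}" "closest_point L z = 0"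
    from subspace_closest_point_orthogonal[OF L(1) v(1), of z] z show False by (simp add: inner_commute)
  qed
qed

lemma borel_measurable_closest_point_subspace:
  assumes L: "subspace L"
  shows "closest_point L \<in> borel_measurable (borel :: 'a::euclidean_space measure)"
  by (rule borel_measurable_closest_point[OF random_nonempty_closed_const])
    (use subspace_convex_closed[OF L] in auto)

lemma borel_measurable_sgn_vector:
  "(sgn :: 'a::euclidean_space \<Rightarrow> 'a) \<in> borel_measurable borel"
  unfolding sgn_div_norm by measurable

text \<open>
  For a subspace \<open>L\<close> other than the null space this is the uniform law on the unit sphere of \<open>L\<close>.
\<close>

definition sphere_law :: "'a::euclidean_space set \<Rightarrow> 'a measure" where
  "sphere_law L = distr unit_ball_law borel (\<lambda>z. sgn (closest_point L z))"

lemma measurable_sphere_law_map: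
  assumes L: "subspace L"
  shows "(\<lambda>z. sgn (closest_point L z)) \<in> unit_ball_law \<rightarrow>\<^sub>M (borel :: 'a::euclidean_space measure)"
  using measurable_comp[OF borel_measurable_closest_point_subspace[OF L] borel_measurable_sgn_vector]
  by (simp add: comp_def measurable_cong_sets[OF sets_unit_ball_law refl])

lemma sphere_law:
  fixes L :: "'a::euclidean_space set"
  assumes L: "subspace L" "L \<noteq> {0}"
  shows "prob_space (sphere_law L)" "sets (sphere_law L) = sets borel"
    "emeasure (sphere_law L) (sphere 0 1 \<inter> L) = 1"
    "\<And>T. orthogonal_transformation T \<Longrightarrow> T ` L = L \<Longrightarrow> distr (sphere_law L) borel T = sphere_law L"
proof -
  interpret B: prob_space "unit_ball_law :: 'a measure" by (rule prob_space_unit_ball_law)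
  note m = measurable_sphere_law_map[OF L(1)]
  note Lc = subspace_convex_closed[OF L(1)]
  show "prob_space (sphere_law L)" unfolding sphere_law_def by (rule B.prob_space_distr[OF m])
  show "sets (sphere_law L) = sets borel" by (simp add: sphere_law_def)
  have S: "sphere 0 1 \<inter> L \<in> sets borel" using Lc by (intro sets.Int borel_closed) auto
  have "AE z in unit_ball_law. z \<in> (\<lambda>z. sgn (closest_point L z)) -` (sphere 0 1 \<inter> L)"
    using AE_closest_point_subspace_nonzero[OF L]
  proof (rule AE_mp, intro AE_I2 impI)
    fix z assume "closest_point L z \<noteq> 0"
    moreover have "closest_point L z \<in> L" using closest_point_in_set[OF Lc(1,3)] .
    ultimately show "z \<in> (\<lambda>z. sgn (closest_point L z)) -` (sphere 0 1 \<inter> L)"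
      using L(1) by (auto simp: norm_sgn sgn_div_norm intro: subspace_mul)
  qed
  then have "emeasure unit_ball_law ((\<lambda>z. sgn (closest_point L z)) -` (sphere 0 1 \<inter> L) \<inter> space unit_ball_law) = 1"
    using measurable_sets[OF m S] by (intro B.emeasure_eq_1_AE) auto
  then show "emeasure (sphere_law L) (sphere 0 1 \<inter> L) = 1"
    unfolding sphere_law_def by (simp only: emeasure_distr[OF m S])
  fix T :: "'a \<Rightarrow> 'a" assume T: "orthogonal_transformation T" "T ` L = L"
  have lin: "linear T" using T by (simp add: orthogonal_transformation_def)
  note Tm = orthogonal_transformation_measurable[OF T(1)]
  have Tm': "T \<in> unit_ball_law \<rightarrow>\<^sub>M borel" using Tm by (simp add: measurable_cong_sets[OF sets_unit_ball_law refl])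
  have "T (sgn (closest_point L z)) = sgn (closest_point L (T z))" for z
    using closest_point_orthogonal_image[OF T(1) Lc, of z] T
    by (simp add: sgn_div_norm linear_scale[OF lin] orthogonal_transformation_norm)
  then have "distr (sphere_law L) borel T = distr unit_ball_law borel (\<lambda>z. sgn (closest_point L (T z)))"
    unfolding sphere_law_def by (subst distr_distr[OF Tm m]) (simp add: comp_def)
  also have "\<dots> = distr (distr unit_ball_law borel T) borel (\<lambda>z. sgn (closest_point L z))"
    using m by (subst distr_distr[OF _ Tm'])
      (simp_all add: comp_def measurable_cong_sets[OF sets_unit_ball_law refl])
  also have "\<dots> = sphere_law L"
    by (simp add: distr_unit_ball_law_orthogonal_transformation[OF T(1)] sphere_law_def)
  finally show "distr (sphere_law L) borel T = sphere_law L" .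
qed

text \<open>
  Existence of the invariant law comes from the rotation invariance of the unit ball, uniqueness from
  reflections alone; together they justify the definite description in the definition of the uniform law.
\<close>

lemma uniform_sphere_eq:
  fixes L :: "'a::euclidean_space set"
  assumes L: "subspace L" "L \<noteq> {0}"
  shows "uniform_sphere L = restrict_space (sphere_law L) (sphere 0 1 \<inter> L)"
proof -
  note Lc = subspace_convex_closed[OF L(1)]
  note sl = sphere_law[OF L]
  let ?S = "sphere 0 1 \<inter> L"
  let ?N = "restrict_space borel ?S"
  have S: "?S \<in> sets borel" using Lc by (intro sets.Int borel_closed) auto
  have spN: "space ?N = ?S" by (simp add: space_restrict_space)
  have Tm: "T \<in> ?N \<rightarrow>\<^sub>M ?N" if T: "orthogonal_transformation T" "T ` L = L" for T :: "'a \<Rightarrow> 'a"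
  proof (rule measurable_restrict_space2)
    show "T \<in> space ?N \<rightarrow> ?S" using T orthogonal_transformation_norm[OF T(1)] by (auto simp: spN)
    show "T \<in> ?N \<rightarrow>\<^sub>M borel"
      by (rule measurable_restrict_space1[OF orthogonal_transformation_measurable[OF T(1)]])
  qed
  show ?thesis
    unfolding uniform_sphere_def uniform_law_def
  proof (rule the_equality, intro conjI ballI)
    let ?\<nu> = "restrict_space (sphere_law L) ?S"
    show s: "sets ?\<nu> = sets ?N" by (intro sets_restrict_space_cong sl(2))
    have S': "?S \<inter> space (sphere_law L) \<in> sets (sphere_law L)" using S sl(2) sets_eq_imp_space_eq[OF sl(2)] by simp
    have em: "emeasure ?\<nu> A = emeasure (sphere_law L) A" if "A \<subseteq> ?S" for A
      using that by (intro emeasure_restrict_space S')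
    show "prob_space ?\<nu>"
      using em[of ?S] sl(3) sets_eq_imp_space_eq[OF s] spN by (intro prob_spaceI) simp
    fix g assume "g \<in> {T. orthogonal_transformation T \<and> T ` L = L}"
    then have g: "orthogonal_transformation g" "g ` L = L" by auto
    have gm: "g \<in> ?\<nu> \<rightarrow>\<^sub>M ?N" using Tm[OF g] by (simp add: measurable_cong_sets[OF s refl])
    have gm': "g \<in> sphere_law L \<rightarrow>\<^sub>M borel"
      using orthogonal_transformation_measurable[OF g(1)] by (simp add: measurable_cong_sets[OF sl(2) refl])
    show "distr ?\<nu> ?N g = ?\<nu>"
    proof (rule measure_eqI)
      fix A assume "A \<in> sets (distr ?\<nu> ?N g)"
      then have A: "A \<in> sets ?N" by simp
      then have AS: "A \<subseteq> ?S" "A \<in> sets borel"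
        using sets.sets_into_space[OF A] S by (auto simp: spN sets_restrict_space_iff)
      have pre: "g -` A \<inter> ?S = g -` A"
      proof -
        have "x \<in> ?S" if "g x \<in> A" for x
        proof -
          have "g x \<in> g ` L" "norm (g x) = 1" using that AS(1) g(2) by auto
          then have "x \<in> L" using orthogonal_transformation_inj[OF g(1)] by (simp add: inj_image_mem_iff)
          then show ?thesis using \<open>norm (g x) = 1\<close> orthogonal_transformation_norm[OF g(1), of x] by simp
        qed
        then show ?thesis by auto
      qed
      have "emeasure (distr ?\<nu> ?N g) A = emeasure (sphere_law L) (g -` A \<inter> ?S)"
        using sets_eq_imp_space_eq[OF s] spN by (subst emeasure_distr[OF gm A]) (simp only: em[OF Int_lower2])
      also have "\<dots> = emeasure (distr (sphere_law L) borel g) A"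
        using sets_eq_imp_space_eq[OF sl(2)] by (subst emeasure_distr[OF gm' AS(2)]) (simp add: pre)
      also have "\<dots> = emeasure (sphere_law L) A" by (simp add: sl(4)[OF g])
      finally show "emeasure (distr ?\<nu> ?N g) A = emeasure ?\<nu> A" using em[OF AS(1)] by simp
    qed (simp add: s)
  next
    fix \<mu> assume asm: "sets \<mu> = sets ?N \<and> prob_space \<mu> \<and>
      (\<forall>g\<in>{T. orthogonal_transformation T \<and> T ` L = L}. distr \<mu> ?N g = \<mu>)"
    then have s: "sets \<mu> = sets ?N" and "prob_space \<mu>" by auto
    interpret M: prob_space \<mu> by fact
    have sp: "space \<mu> = ?S" using sets_eq_imp_space_eq[OF s] spN by simp
    have idm: "(\<lambda>x. x) \<in> \<mu> \<rightarrow>\<^sub>M borel"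
      unfolding measurable_cong_sets[OF s refl] by (rule measurable_restrict_space1) simp
    let ?\<mu> = "distr \<mu> borel (\<lambda>x. x)"
    have "?\<mu> = sphere_law L"
    proof (rule reflection_invariant_law_unique[OF L(1) _ _ _ _ sl(1-3)])
      show "prob_space ?\<mu>" by (rule M.prob_space_distr[OF idm])
      show "emeasure ?\<mu> ?S = 1"
        using M.emeasure_space_1 sp by (subst emeasure_distr[OF idm S]) simp
      fix a assume a: "a \<in> L"
      let ?R = "reflection a"
      note R = orthogonal_transformation_reflection[of a] reflection_image_subspace[OF L(1) a]
      show "distr (sphere_law L) borel ?R = sphere_law L" using sl(4)[OF R] .
      have Rm: "?R \<in> \<mu> \<rightarrow>\<^sub>M ?N" using Tm[OF R] by (simp add: measurable_cong_sets[OF s refl])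
      have idN: "(\<lambda>x. x) \<in> ?N \<rightarrow>\<^sub>M borel" by (rule measurable_restrict_space1) simp
      have "distr ?\<mu> borel ?R = distr (distr \<mu> ?N ?R) borel (\<lambda>x. x)"
        using orthogonal_transformation_measurable[OF R(1)]
        by (subst distr_distr[OF _ idm], simp, subst distr_distr[OF idN Rm]) (simp add: comp_def)
      also have "distr \<mu> ?N ?R = \<mu>" using asm R by blast
      finally show "distr ?\<mu> borel ?R = ?\<mu>" .
    qed simp
    then have eq: "emeasure \<mu> A = emeasure (sphere_law L) A" if "A \<in> sets borel" "A \<subseteq> ?S" for A
    proof -
      have "emeasure ?\<mu> A = emeasure \<mu> A"
        using that sp by (subst emeasure_distr[OF idm]) (auto simp: Int_absorb2)
      then show ?thesis using \<open>?\<mu> = sphere_law L\<close> by simp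
    qed
    show "\<mu> = restrict_space (sphere_law L) ?S"
    proof (rule measure_eqI)
      show "sets \<mu> = sets (restrict_space (sphere_law L) ?S)"
        using s sets_restrict_space_cong[OF sl(2)] by simp
      fix A assume A: "A \<in> sets \<mu>"
      then have AS: "A \<in> sets borel" "A \<subseteq> ?S"
        using sets.sets_into_space[OF A] S sp s by (auto simp: sets_restrict_space_iff)
      have S': "?S \<inter> space (sphere_law L) \<in> sets (sphere_law L)" using S sl(2) sets_eq_imp_space_eq[OF sl(2)] by simp
      show "emeasure \<mu> A = emeasure (restrict_space (sphere_law L) ?S) A"
        using eq[OF AS] emeasure_restrict_space[OF S' AS(2)] by simp
    qed
  qed
qed

lemma cone_sgn_iff:
  fixes C :: "'a::euclidean_space set"
  assumes "cone C"
  shows "sgn x \<in> C \<longleftrightarrow> x \<in> C \<or> (x = 0 \<and> 0 \<in> C)"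
proof (cases "x = 0")
  case False
  have "norm x *\<^sub>R sgn x = x" using False by (simp add: sgn_div_norm)
  then have "sgn x \<in> C \<Longrightarrow> x \<in> C" using mem_cone[OF assms, of "sgn x" "norm x"] by simp
  moreover have "x \<in> C \<Longrightarrow> sgn x \<in> C" using mem_cone[OF assms, of x "inverse (norm x)"] by (simp add: sgn_div_norm)
  ultimately show ?thesis using False by blast
qed (use assms in \<open>auto simp: sgn_zero\<close>)

lemma cone_angle_sphere_law:
  fixes C :: "'a::euclidean_space set"
  assumes C: "closed C" "cone C" "C \<noteq> {}"
  shows "cone_angle C = emeasure (sphere_law (span C)) C"
proof -
  have "(0::'a) \<in> C" using C mem_cone[OF C(2), of _ 0] by fastforce
  then have "{z. closest_point (span C) z \<in> C} = (\<lambda>z. sgn (closest_point (span C) z)) -` C"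
    using cone_sgn_iff[OF C(2)] by auto
  moreover have "C \<in> sets borel" using C(1) by (rule borel_closed)
  ultimately show ?thesis
    unfolding cone_angle_def sphere_law_def
    by (subst emeasure_distr[OF measurable_sphere_law_map]) simp_all
qed

lemma cone_angle_subspace:
  fixes C :: "'a::euclidean_space set"
  assumes "subspace C"
  shows "cone_angle C = 1"
proof -
  interpret B: prob_space "unit_ball_law :: 'a measure" by (rule prob_space_unit_ball_law)
  have sp: "span C = C" using assms by (simp add: span_eq_iff)
  have "{z. closest_point (span C) z \<in> C} = space unit_ball_law"
    using closest_point_in_set[OF subspace_convex_closed(1,3)[OF assms]] unfolding sp by simp
  then show ?thesis using B.emeasure_space_1 by (simp add: cone_angle_def)
qed

text \<open>
  Whether a vector lies in a cone depends only on its direction.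
\<close>

lemma solid_angle_eq_cone_angle:
  fixes C :: "'a::euclidean_space set"
  assumes C: "closed C" "cone C" "C \<noteq> {}"
  shows "ennreal (solid_angle C) = cone_angle C"
proof (cases "subspace C")
  case True
  then show ?thesis by (simp add: solid_angle_def cone_angle_subspace)
next
  case False
  let ?L = "span C" let ?S = "sphere 0 1 \<inter> span C"
  have "0 \<in> C" using C mem_cone[OF C(2), of _ 0] by fastforce
  have L: "subspace ?L" "?L \<noteq> {0}"
  proof -
    have "C \<noteq> {0}" using False by auto
    then show "?L \<noteq> {0}" using span_superset[of C] \<open>0 \<in> C\<close> by fastforce
  qed simp
  note sl = sphere_law[OF L]
  interpret S: prob_space "sphere_law ?L" by (rule sl(1))
  have Ss: "?S \<in> sets borel" using subspace_convex_closed[OF L(1)] by (intro sets.Int borel_closed) auto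
  have S': "?S \<inter> space (sphere_law ?L) \<in> sets (sphere_law ?L)" using Ss sl(2) sets_eq_imp_space_eq[OF sl(2)] by simp
  have "AE x in sphere_law ?L. x \<in> ?S"
    using sl(2,3) Ss by (intro S.AE_prob_1) (simp add: S.emeasure_eq_measure)
  have sp: "space (uniform_sphere ?L) = ?S"
    using sets_eq_imp_space_eq[OF sl(2)] by (simp add: uniform_sphere_eq[OF L] space_restrict_space)
  have "{z \<in> space (uniform_sphere ?L). z \<in> C} = ?S \<inter> C" using sp by auto
  then have "solid_angle C = measure (uniform_sphere ?L) (?S \<inter> C)" using False by (simp add: solid_angle_def)
  also have "\<dots> = measure (sphere_law ?L) (?S \<inter> C)"
    unfolding uniform_sphere_eq[OF L] by (rule measure_restrict_space[OF S']) auto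
  finally have "solid_angle C = measure (sphere_law ?L) (?S \<inter> C)" .
  then have "ennreal (solid_angle C) = emeasure (sphere_law ?L) (?S \<inter> C)"
    by (simp add: S.emeasure_eq_measure)
  also have "\<dots> = emeasure (sphere_law ?L) C"
    using \<open>AE x in sphere_law ?L. x \<in> ?S\<close> Ss C(1) sl(2)
    by (intro emeasure_eq_AE) (auto intro: borel_closed)
  finally show ?thesis using cone_angle_sphere_law[OF C] by simp
qed

text \<open>
  The direction of a random vector whose law is invariant under the reflections of its linear hull is
  uniform on the unit sphere there. It is in this form that solid angles enter the averaging argument.
\<close>

lemma reflection_invariant_law_cone:
  fixes C :: "'a::euclidean_space set"
  assumes C: "closed C" "cone C" "C \<noteq> {}"
    and \<rho>: "finite_measure \<rho>" "sets \<rho> = sets borel" "AE x in \<rho>. x \<in> span C"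
      "span C \<noteq> {0} \<Longrightarrow> AE x in \<rho>. x \<noteq> 0"
      "\<And>a. a \<in> span C \<Longrightarrow> distr \<rho> borel (reflection a) = \<rho>"
  shows "emeasure \<rho> C = cone_angle C * emeasure \<rho> UNIV"
proof -
  interpret R: finite_measure \<rho> by fact
  have spR: "space \<rho> = UNIV" using sets_eq_imp_space_eq[OF \<rho>(2)] by simp
  have Cb: "C \<in> sets borel" using C(1) by (rule borel_closed)
  have "0 \<in> C" using C mem_cone[OF C(2), of _ 0] by fastforce
  consider "span C = {0}" | "emeasure \<rho> UNIV = 0" | "span C \<noteq> {0}" "emeasure \<rho> UNIV \<noteq> 0" by blast
  then show ?thesis
  proof cases
    case 1
    then have C0: "C = {0}" using span_superset[of C] \<open>0 \<in> C\<close> by auto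
    then have "cone_angle C = 1" by (simp add: cone_angle_subspace)
    moreover have "emeasure \<rho> C = emeasure \<rho> UNIV"
      using \<rho>(2,3) 1 C0 Cb by (intro emeasure_eq_AE) auto
    ultimately show ?thesis by simp
  next
    case 2
    have "emeasure \<rho> C \<le> emeasure \<rho> UNIV" using \<rho>(2) by (intro emeasure_mono) auto
    then show ?thesis using 2 by simp
  next
    case 3
    let ?L = "span C"
    define m where "m = emeasure \<rho> UNIV"
    have m: "m \<noteq> 0" "m \<noteq> \<infinity>" using 3 R.emeasure_finite by (simp_all add: m_def)
    have sm: "sgn \<in> \<rho> \<rightarrow>\<^sub>M borel" using borel_measurable_sgn_vector by (simp add: measurable_cong_sets[OF \<rho>(2) refl])
    (* The law of the direction, normalized to a probability measure. *)
    define \<rho>' where "\<rho>' = scale_measure (inverse m) (distr \<rho> borel sgn)"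
    have s': "sets \<rho>' = sets borel" by (simp add: \<rho>'_def)
    have em': "emeasure \<rho>' A = inverse m * emeasure \<rho> (sgn -` A)" if "A \<in> sets borel" for A
      using that by (simp add: \<rho>'_def emeasure_distr[OF sm] spR)
    have Ss: "sphere 0 1 \<inter> ?L \<in> sets borel"
      using subspace_convex_closed[of ?L] by (intro sets.Int borel_closed) auto
    have inv1: "inverse m * m = 1" using m by (simp add: mult.commute[of "inverse m"] divide_ennreal_def[symmetric] ennreal_divide_self less_top[symmetric])
    have "\<rho>' = sphere_law ?L"
    proof (rule reflection_invariant_law_unique[of ?L])
      show "prob_space \<rho>'"
        using em'[of UNIV] inv1 sets_eq_imp_space_eq[OF s'] by (intro prob_spaceI) (simp add: m_def)
      have "emeasure \<rho> (sgn -` (sphere 0 1 \<inter> ?L)) = emeasure \<rho> UNIV"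
      proof (rule emeasure_eq_AE)
        show "AE x in \<rho>. (x \<in> sgn -` (sphere 0 1 \<inter> ?L)) = (x \<in> UNIV)"
          using \<rho>(3) \<rho>(4)[OF 3(1)]
          by eventually_elim (auto simp: norm_sgn sgn_div_norm intro: span_mul)
        show "sgn -` (sphere 0 1 \<inter> ?L) \<in> sets \<rho>" using measurable_sets[OF sm Ss] spR by simp
      qed (use \<rho>(2) in simp)
      then show "emeasure \<rho>' (sphere 0 1 \<inter> ?L) = 1" using em'[OF Ss] inv1 by (simp add: m_def)
      fix a assume a: "a \<in> ?L"
      let ?R = "reflection a"
      note R = orthogonal_transformation_reflection[of a] reflection_image_subspace[OF subspace_span a]
      show "distr (sphere_law ?L) borel ?R = sphere_law ?L" using sphere_law(4)[OF subspace_span 3(1) R] .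
      have Rm: "?R \<in> borel_measurable borel" by (rule orthogonal_transformation_measurable[OF R(1)])
      have Rm': "?R \<in> \<rho> \<rightarrow>\<^sub>M borel" using Rm by (simp add: measurable_cong_sets[OF \<rho>(2) refl])
      have Rm'': "?R \<in> \<rho>' \<rightarrow>\<^sub>M borel" using Rm by (simp add: measurable_cong_sets[OF s' refl])
      have sR: "sgn (?R x) = ?R (sgn x)" for x
        using R(1) by (simp add: sgn_div_norm linear_scale[OF linear_reflection] orthogonal_transformation_norm)
      show "distr \<rho>' borel ?R = \<rho>'"
      proof (rule measure_eqI)
        fix A assume "A \<in> sets (distr \<rho>' borel ?R)"
        then have A: "A \<in> sets borel" by simp
        have RA: "?R -` A \<in> sets borel" using measurable_sets[OF Rm A] by simp
        have sA: "sgn -` A \<in> sets borel" using measurable_sets[OF borel_measurable_sgn_vector A] by simp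
        have "emeasure (distr \<rho>' borel ?R) A = inverse m * emeasure \<rho> (sgn -` (?R -` A))"
          using sets_eq_imp_space_eq[OF s'] by (subst emeasure_distr[OF Rm'' A]) (simp add: em'[OF RA])
        also have "sgn -` (?R -` A) = ?R -` (sgn -` A)" by (auto simp: sR)
        also have "emeasure \<rho> (?R -` (sgn -` A)) = emeasure (distr \<rho> borel ?R) (sgn -` A)"
          by (subst emeasure_distr[OF Rm' sA]) (simp add: spR)
        also have "\<dots> = emeasure \<rho> (sgn -` A)" by (simp add: \<rho>(5)[OF a])
        finally show "emeasure (distr \<rho>' borel ?R) A = emeasure \<rho>' A" using em'[OF A] by simp
      qed (simp add: s')
    qed (use s' sphere_law[OF subspace_span 3(1)] in simp_all)
    then have "cone_angle C = inverse m * emeasure \<rho> (sgn -` C)"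
      using cone_angle_sphere_law[OF C] em'[OF Cb] by simp
    also have "sgn -` C = C" using cone_sgn_iff[OF C(2)] \<open>0 \<in> C\<close> by auto
    finally have "cone_angle C * m = (inverse m * m) * emeasure \<rho> C" by (simp add: mult_ac)
    then show ?thesis using inv1 by (simp add: m_def)
  qed
qed

section \<open>Haar measure on the orthogonal group\<close>

lemma orthogonal_matrix_transformation:
  fixes R :: "real^'n^'n"
  assumes "orthogonal_matrix R"
  shows "orthogonal_transformation ((*v) R)"
  using assms by (simp add: orthogonal_transformation_matrix)

lemma borel_measurable_matrix_vector_mult [measurable (raw)]:
  fixes X :: "'w \<Rightarrow> real^'n^'m"
  assumes "X \<in> borel_measurable M" "Z \<in> borel_measurable M"
  shows "(\<lambda>\<omega>. X \<omega> *v Z \<omega>) \<in> borel_measurable M"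
proof -
  have "continuous_on UNIV (\<lambda>p :: (real^'n^'m) \<times> (real^'n). fst p *v snd p)"
    unfolding matrix_vector_mult_def by (intro continuous_intros continuous_on_vec_lambda)
  from borel_measurable_continuous_onI[OF this]
  have 2: "(\<lambda>p :: (real^'n^'m) \<times> (real^'n). fst p *v snd p) \<in> borel_measurable borel" .
  have 1: "(\<lambda>\<omega>. (X \<omega>, Z \<omega>)) \<in> M \<rightarrow>\<^sub>M borel"
    unfolding borel_prod[symmetric] using assms by measurable
  show ?thesis using measurable_compose[OF 1 2] by simp
qed

lemma continuous_on_matrix_mult_right:
  fixes R :: "real^'n^'n"
  shows "continuous_on UNIV (\<lambda>X::real^'n^'m. X ** R)"
  unfolding matrix_matrix_mult_def by (intro continuous_intros continuous_on_vec_lambda)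

lemma continuous_on_transpose:
  shows "continuous_on UNIV (transpose :: real^'n^'m \<Rightarrow> real^'m^'n)"
  unfolding transpose_def by (intro continuous_intros continuous_on_vec_lambda)

lemma row_matrix_mult:
  fixes X :: "real^'n^'m" and R :: "real^'p^'n"
  shows "(X ** R) $ i = transpose R *v (X $ i)"
  by (simp add: vec_eq_iff matrix_matrix_mult_def matrix_vector_mult_def transpose_def mult.commute)

lemma orthogonal_transformation_mult_orthogonal_matrix:
  fixes R :: "real^'n^'n"
  assumes R: "orthogonal_matrix R"
  shows "orthogonal_transformation (\<lambda>X::real^'n^'n. X ** R)"
  unfolding orthogonal_transformation_def
proof (intro conjI allI)
  show "linear (\<lambda>X::real^'n^'n. X ** R)"
    by (rule linearI)
      (simp_all add: vec_eq_iff matrix_matrix_mult_def sum.distrib sum_distrib_left algebra_simps)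
  fix X Y :: "real^'n^'n"
  have "orthogonal_transformation ((*v) (transpose R))"
    using R by (intro orthogonal_matrix_transformation) (simp add: orthogonal_matrix_transpose)
  then have "(transpose R *v x) \<bullet> (transpose R *v y) = x \<bullet> y" for x y :: "real^'n"
    by (simp add: orthogonal_transformation_def)
  then show "(X ** R) \<bullet> (Y ** R) = X \<bullet> Y"
    by (simp add: inner_vec_def[of "X ** R" "Y ** R"] inner_vec_def[of X Y] row_matrix_mult)
qed

text \<open>
  An arbitrary linear order of the rows, as needed for orthonormalization.
\<close>

definition row_index :: "'n::finite \<Rightarrow> nat" where
  "row_index = (SOME f. inj f)"

lemma inj_row_index: "inj (row_index :: 'n::finite \<Rightarrow> nat)"
proof -
  have "\<exists>f :: 'n \<Rightarrow> nat. inj f"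
    using finite_imp_inj_to_nat_seg[of "UNIV :: 'n set"] by auto
  then show ?thesis unfolding row_index_def by (rule someI_ex)
qed

definition earlier_rows_span :: "real^'n^'n \<Rightarrow> 'n \<Rightarrow> (real^'n) set" where
  "earlier_rows_span X i = span {X $ j |j. row_index j < row_index i}"

definition gram_schmidt :: "real^'n^'n \<Rightarrow> real^'n^'n" where
  "gram_schmidt X = (\<chi> i. sgn (X $ i - closest_point (earlier_rows_span X i) (X $ i)))"

text \<open>
  Each new row is orthogonal to the span of the earlier ones, and it does not vanish because the rows of an
  invertible matrix are linearly independent.
\<close>

lemma gram_schmidt_orthogonal:
  fixes X :: "real^'n^'n"
  assumes X: "det X \<noteq> 0"
  shows "orthogonal_matrix (gram_schmidt X)"
proof -
  let ?L = "earlier_rows_span X"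
  let ?v = "\<lambda>i. X $ i - closest_point (?L i) (X $ i)"
  have sub: "subspace (?L i)" for i by (simp add: earlier_rows_span_def)
  have v0: "?v i \<noteq> 0" for i
  proof
    assume "?v i = 0"
    then have "X $ i \<in> ?L i"
      using closest_point_in_set[OF subspace_convex_closed(1,3)[OF sub]] by (metis eq_iff_diff_eq_0)
    moreover have "?L i \<subseteq> span {row j X |j. j \<noteq> i}"
      unfolding earlier_rows_span_def by (intro span_mono) (auto simp: row_def)
    ultimately have "- row i X \<in> vec.span {row j X |j. j \<noteq> i}"
      by (auto simp: row_def span_neg span_vec_eq)
    from det_row_span[OF this] have "det (\<chi> k. if k = i then row i X + - row i X else row k X) = det X" .
    moreover have "(\<chi> k. if k = i then row i X + - row i X else row k X) =
        ((\<chi> k. if k = i then 0 else row k X) :: real^'n^'n)"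
      by (simp add: vec_eq_iff)
    ultimately have "det ((\<chi> k. if k = i then 0 else row k X) :: real^'n^'n) = det X" by simp
    moreover have "det ((\<chi> k. if k = i then 0 else row k X) :: real^'n^'n) = 0"
      by (rule det_zero_row(1)[of i]) (simp add: row_def vec_eq_iff)
    ultimately show False using X by simp
  qed
  have row: "row i (gram_schmidt X) = sgn (?v i)" for i by (simp add: gram_schmidt_def row_def vec_eq_iff)
  have vin: "?v j \<in> ?L i" if "row_index j < row_index i" for i j
  proof (rule subspace_diff[OF sub])
    show "X $ j \<in> ?L i" unfolding earlier_rows_span_def using that by (intro span_base) auto
    have "?L j \<subseteq> ?L i" unfolding earlier_rows_span_def using that by (intro span_mono) auto
    then show "closest_point (?L j) (X $ j) \<in> ?L i"
      using closest_point_in_set[OF subspace_convex_closed(1,3)[OF sub]] by blast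
  qed
  have ord: "?v i \<bullet> ?v j = 0" if "row_index j < row_index i" for i j
    by (rule subspace_closest_point_orthogonal[OF sub vin[OF that]])
  have orth: "?v i \<bullet> ?v j = 0" if "i \<noteq> j" for i j
  proof (cases "row_index j < row_index i")
    case False
    then have "row_index i < row_index j" using that injD[OF inj_row_index, of i j] by force
    from ord[OF this] show ?thesis by (simp add: inner_commute)
  qed (rule ord)
  show ?thesis
    unfolding orthogonal_matrix_orthonormal_rows
  proof (intro conjI allI impI)
    show "norm (row i (gram_schmidt X)) = 1" for i unfolding row using v0 by (simp add: norm_sgn)
    show "orthogonal (row i (gram_schmidt X)) (row j (gram_schmidt X))" if "i \<noteq> j" for i j
      unfolding row orthogonal_def sgn_div_norm using orth[OF that] by simp
  qed
qed

text \<open>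
  Multiplication from the right by an orthogonal matrix acts on the rows as an isometry, and
  orthonormalization commutes with isometries.
\<close>

lemma gram_schmidt_mult_orthogonal_matrix:
  fixes X R :: "real^'n^'n"
  assumes R: "orthogonal_matrix R"
  shows "gram_schmidt (X ** R) = gram_schmidt X ** R"
proof -
  define T where "T = (*v) (transpose R)"
  have T: "orthogonal_transformation T"
    unfolding T_def using R by (intro orthogonal_matrix_transformation) (simp add: orthogonal_matrix_transpose)
  then have lin: "linear T" by (simp add: orthogonal_transformation_def)
  have row: "(Y ** R) $ i = T (Y $ i)" for Y :: "real^'n^'n" and i unfolding T_def by (rule row_matrix_mult)
  have "earlier_rows_span (X ** R) i = T ` earlier_rows_span X i" for i
  proof -
    have *: "{(X ** R) $ j |j. row_index j < row_index i} = T ` {X $ j |j. row_index j < row_index i}"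
      by (auto simp: row)
    show ?thesis unfolding earlier_rows_span_def * by (rule linear_span_image[OF lin])
  qed
  moreover have "closest_point (T ` earlier_rows_span X i) (T z) = T (closest_point (earlier_rows_span X i) z)" for i z
    by (rule closest_point_orthogonal_image[OF T subspace_convex_closed]) (simp_all add: earlier_rows_span_def)
  moreover have "sgn (T x) = T (sgn x)" for x
    using T by (simp add: sgn_div_norm linear_scale[OF lin] orthogonal_transformation_norm)
  ultimately have "gram_schmidt (X ** R) $ i = T (gram_schmidt X $ i)" for i
    by (simp add: gram_schmidt_def row linear_diff[OF lin, symmetric])
  then show ?thesis by (simp add: vec_eq_iff[of "gram_schmidt (X ** R)"] row)
qed

text \<open>
  The span of the earlier rows is a random closed set, so the projection to it is measurable.
\<close>

lemma borel_measurable_gram_schmidt: "gram_schmidt \<in> borel_measurable (borel :: (real^'n^'n) measure)"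
proof -
  have comp: "(\<lambda>X::real^'n^'n. X $ i) \<in> borel_measurable borel" for i
    by (intro borel_measurable_continuous_onI continuous_intros)
  have L: "random_nonempty_closed borel (\<lambda>X::real^'n^'n. earlier_rows_span X i)" for i
  proof -
    let ?J = "{j :: 'n. row_index j < row_index i}"
    (* The earlier rows, enumerated with the zero vector in place of row i; inserting i keeps the index
       set nonempty. *)
    define \<xi> where "\<xi> n X = (let j = from_nat_into (insert i ?J) n in if j \<in> ?J then X $ j else 0)"
      for n and X :: "real^'n^'n"
    show ?thesis unfolding earlier_rows_span_def
    proof (rule random_nonempty_closed_span)
      show "\<xi> n \<in> borel_measurable borel" for n unfolding \<xi>_def Let_def using comp by simp
      show "range (\<lambda>n. \<xi> n X) \<subseteq> span {X $ j |j. row_index j < row_index i}" for X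
        unfolding \<xi>_def Let_def by (auto intro: span_base span_zero)
      show "{X $ j |j. row_index j < row_index i} \<subseteq> closure (range (\<lambda>n. \<xi> n X))" for X
      proof -
        have "X $ j \<in> range (\<lambda>n. \<xi> n X)" if j: "row_index j < row_index i" for j
        proof -
          obtain n where "from_nat_into (insert i ?J) n = j"
            using from_nat_into_surj[of "insert i ?J" j] j by auto
          then have "\<xi> n X = X $ j" using j by (simp add: \<xi>_def)
          then show ?thesis by (metis rangeI)
        qed
        then have "{X $ j |j. row_index j < row_index i} \<subseteq> range (\<lambda>n. \<xi> n X)" by auto
        then show ?thesis using closure_subset by (rule order_trans)
      qed
    qed
  qed
  have "(\<lambda>X::real^'n^'n. sgn (X $ i - closest_point (earlier_rows_span X i) (X $ i))) \<in> borel_measurable borel" for i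
  proof -
    have "(\<lambda>X::real^'n^'n. closest_point (earlier_rows_span X i) (X $ i)) \<in> borel_measurable borel"
      by (rule borel_measurable_closest_point[OF L _ comp]) (simp add: earlier_rows_span_def subspace_imp_convex)
    then show ?thesis using comp by (intro measurable_compose[OF _ borel_measurable_sgn_vector]) simp
  qed
  note row = this
  show ?thesis
  proof (rule borel_measurable_euclidean_space[THEN iffD2], intro ballI)
    fix b :: "real^'n^'n" assume "b \<in> Basis"
    then obtain i u where b: "b = axis i u" by (auto simp: Basis_vec_def)
    have "(\<lambda>X. gram_schmidt X \<bullet> b) = (\<lambda>X. sgn (X $ i - closest_point (earlier_rows_span X i) (X $ i)) \<bullet> u)"
      by (simp add: b inner_axis gram_schmidt_def)
    then show "(\<lambda>X. gram_schmidt X \<bullet> b) \<in> borel_measurable borel" using row[of i] by simp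
  qed
qed

definition orthogonal_group :: "(real^'n^'n) measure" where
  "orthogonal_group = restrict_space borel {X. orthogonal_matrix X}"

lemma space_orthogonal_group: "space orthogonal_group = {X. orthogonal_matrix X}"
  by (simp add: orthogonal_group_def space_restrict_space)

text \<open>
  Orthonormalize the rows of a matrix drawn uniformly from the invertible matrices in the unit ball.
  Multiplication from the right by an orthogonal matrix is an isometry of the space of matrices that
  preserves this set. Restricting to invertible matrices from the start avoids the null set on which
  orthonormalization breaks down.
\<close>

lemma ex_right_invariant_law:
  "\<exists>H :: (real^'n^'n) measure. prob_space H \<and> sets H = sets orthogonal_group \<and>
    (\<forall>R. orthogonal_matrix R \<longrightarrow> distr H orthogonal_group (\<lambda>X. X ** R) = H)"
proof -
  define S where "S = {X :: real^'n^'n. norm X < 1 \<and> det X \<noteq> 0}"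
  have cdet: "continuous_on UNIV (det :: real^'n^'n \<Rightarrow> real)"
    unfolding det_def by (intro continuous_intros)
  have "open S"
    unfolding S_def using cdet by (intro open_Collect_conj open_Collect_less open_Collect_neq continuous_intros)
  have "S \<noteq> {}"
  proof -
    define c where "c = 1 / (1 + norm (mat 1 :: real^'n^'n))"
    have "c > 0" unfolding c_def by (simp add: add_pos_nonneg)
    have "norm (c *\<^sub>R (mat 1 :: real^'n^'n)) < 1"
      unfolding c_def by (simp add: add_pos_nonneg divide_simps)
    moreover have "det (c *\<^sub>R (mat 1 :: real^'n^'n)) \<noteq> 0"
      using \<open>c > 0\<close> by (subst det_diagonal) (auto simp: mat_def)
    ultimately show ?thesis unfolding S_def by blast
  qed
  let ?U = "uniform_measure lborel S"
  have Sb: "S \<in> sets borel" using \<open>open S\<close> by simp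
  have S0: "emeasure lborel S \<noteq> 0"
  proof
    assume "emeasure lborel S = 0"
    then have "S \<in> null_sets lborel" using Sb by auto
    then have "negligible S" using negligible_iff_null_sets null_sets_completionI by blast
    then show False using open_not_negligible \<open>open S\<close> \<open>S \<noteq> {}\<close> by blast
  qed
  have Sfin: "emeasure lborel S \<noteq> \<infinity>"
  proof -
    have "S \<subseteq> ball 0 1" by (auto simp: S_def)
    then have "emeasure lborel S \<le> emeasure lborel (ball (0::real^'n^'n) 1)" by (intro emeasure_mono) auto
    also have "\<dots> < \<infinity>" using emeasure_lborel_ball_finite[of "0::real^'n^'n" 1] by simp
    finally show ?thesis by simp
  qed
  interpret U: prob_space ?U using S0 Sfin by (intro prob_space_uniform_measure) auto
  (* The value outside S only serves to make every value orthogonal; S has full measure. *)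
  define \<Phi> where "\<Phi> X = (if X \<in> S then gram_schmidt X else mat 1)" for X :: "real^'n^'n"
  have \<Phi>o: "orthogonal_matrix (\<Phi> X)" for X
    using gram_schmidt_orthogonal by (auto simp: \<Phi>_def S_def orthogonal_matrix_id)
  have sU: "sets ?U = sets borel" by simp
  have \<Phi>m: "\<Phi> \<in> ?U \<rightarrow>\<^sub>M orthogonal_group"
    unfolding orthogonal_group_def measurable_cong_sets[OF sU refl]
  proof (rule measurable_restrict_space2)
    show "\<Phi> \<in> borel \<rightarrow>\<^sub>M borel"
      unfolding \<Phi>_def using borel_measurable_gram_schmidt Sb by (intro measurable_If_set) auto
  qed (use \<Phi>o in auto)
  have \<Phi>b: "\<Phi> \<in> borel \<rightarrow>\<^sub>M orthogonal_group"
    using \<Phi>m by (simp only: measurable_cong_sets[OF sU refl])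
  have Rm: "(\<lambda>X. X ** R) \<in> borel_measurable borel" for R :: "real^'n^'n"
    by (rule borel_measurable_continuous_onI[OF continuous_on_matrix_mult_right])
  have Rmo: "(\<lambda>X. X ** R) \<in> orthogonal_group \<rightarrow>\<^sub>M orthogonal_group" if "orthogonal_matrix R" for R :: "real^'n^'n"
    unfolding orthogonal_group_def
  proof (rule measurable_restrict_space2)
    show "(\<lambda>X. X ** R) \<in> restrict_space borel {X. orthogonal_matrix X} \<rightarrow>\<^sub>M borel"
      by (rule measurable_restrict_space1[OF Rm])
  qed (use that in \<open>auto simp: space_restrict_space orthogonal_matrix_mul\<close>)
  define H where "H = distr ?U orthogonal_group \<Phi>"
  have "distr H orthogonal_group (\<lambda>X. X ** R) = H" if R: "orthogonal_matrix R" for R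
  proof -
    have det: "det (X ** R) \<noteq> 0 \<longleftrightarrow> det X \<noteq> 0" for X :: "real^'n^'n"
      using det_orthogonal_matrix[OF R] by (auto simp: det_mul)
    have nrm: "norm (X ** R) = norm X" for X :: "real^'n^'n"
      using orthogonal_transformation_norm[OF orthogonal_transformation_mult_orthogonal_matrix[OF R]] .
    have SR: "X ** R \<in> S \<longleftrightarrow> X \<in> S" for X by (simp add: S_def nrm det)
    have "distr H orthogonal_group (\<lambda>X. X ** R) = distr ?U orthogonal_group (\<lambda>X. \<Phi> X ** R)"
      unfolding H_def by (subst distr_distr[OF Rmo[OF R] \<Phi>m]) (simp add: comp_def)
    also have "\<dots> = distr ?U orthogonal_group (\<lambda>X. \<Phi> (X ** R))"
    proof (rule distr_cong_AE)
      show "AE X in ?U. \<Phi> X ** R = \<Phi> (X ** R)"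
        by (rule AE_uniform_measureI)
          (use Sb in \<open>auto simp: \<Phi>_def SR gram_schmidt_mult_orthogonal_matrix[OF R]\<close>)
      show "(\<lambda>X. \<Phi> X ** R) \<in> ?U \<rightarrow>\<^sub>M orthogonal_group"
        using measurable_compose[OF \<Phi>m Rmo[OF R]] .
      show "(\<lambda>X. \<Phi> (X ** R)) \<in> ?U \<rightarrow>\<^sub>M orthogonal_group"
        using measurable_compose[OF Rm \<Phi>b] by (simp only: measurable_cong_sets[OF sU refl])
    qed simp_all
    also have "\<dots> = distr (distr ?U borel (\<lambda>X. X ** R)) orthogonal_group \<Phi>"
      using Rm by (subst distr_distr[OF \<Phi>b]) (simp_all add: comp_def measurable_cong_sets[OF sU refl])
    also have "distr ?U borel (\<lambda>X. X ** R) = ?U"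
      using SR by (intro distr_uniform_measure_orthogonal_transformation
        orthogonal_transformation_mult_orthogonal_matrix R Sb) auto
    finally show ?thesis by (simp add: H_def)
  qed
  moreover have "prob_space H" unfolding H_def by (rule U.prob_space_distr[OF \<Phi>m])
  moreover have "sets H = sets orthogonal_group" by (simp add: H_def)
  ultimately show ?thesis by blast
qed

text \<open>
  A right invariant law; transposition turns it into a left invariant one.
\<close>

definition haar :: "(real^'n^'n) measure" where
  "haar = (SOME H. prob_space H \<and> sets H = sets orthogonal_group \<and>
    (\<forall>R. orthogonal_matrix R \<longrightarrow> distr H orthogonal_group (\<lambda>X. X ** R) = H))"

lemma haar:
  shows prob_space_haar: "prob_space (haar :: (real^'n^'n) measure)"
    and sets_haar: "sets (haar :: (real^'n^'n) measure) = sets orthogonal_group"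
    and haar_right_invariant:
      "orthogonal_matrix R \<Longrightarrow> distr haar orthogonal_group (\<lambda>X. X ** R) = (haar :: (real^'n^'n) measure)"
  using someI_ex[OF ex_right_invariant_law[where 'n='n]] unfolding haar_def[symmetric] by auto

lemma space_haar: "space haar = {X. orthogonal_matrix X}"
  unfolding sets_eq_imp_space_eq[OF sets_haar] by (rule space_orthogonal_group)

lemma measurable_haar_mult_right:
  fixes R :: "real^'n^'n"
  assumes "orthogonal_matrix R"
  shows "(\<lambda>X. X ** R) \<in> haar \<rightarrow>\<^sub>M haar"
  unfolding measurable_cong_sets[OF sets_haar sets_haar] orthogonal_group_def
proof (rule measurable_restrict_space2)
  show "(\<lambda>X. X ** R) \<in> restrict_space borel {X. orthogonal_matrix X} \<rightarrow>\<^sub>M borel"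
    by (rule measurable_restrict_space1[OF borel_measurable_continuous_onI[OF continuous_on_matrix_mult_right]])
qed (use assms in \<open>auto simp: space_restrict_space orthogonal_matrix_mul\<close>)

lemma measurable_haar_id: "(\<lambda>X. X) \<in> haar \<rightarrow>\<^sub>M borel"
  unfolding measurable_cong_sets[OF sets_haar refl] orthogonal_group_def
  by (rule measurable_restrict_space1) simp

lemma nn_integral_haar_mult_right:
  fixes R :: "real^'n^'n"
  assumes R: "orthogonal_matrix R" and f: "f \<in> borel_measurable haar"
  shows "(\<integral>\<^sup>+X. f (X ** R) \<partial>haar) = (\<integral>\<^sup>+X. f X \<partial>haar)"
proof -
  have m: "(\<lambda>X. X ** R) \<in> haar \<rightarrow>\<^sub>M orthogonal_group"
    using measurable_haar_mult_right[OF R] by (simp add: measurable_cong_sets[OF refl sets_haar])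
  have "(\<integral>\<^sup>+X. f X \<partial>haar) = (\<integral>\<^sup>+X. f X \<partial>distr haar orthogonal_group (\<lambda>X. X ** R))"
    by (simp add: haar_right_invariant[OF R])
  also have "\<dots> = (\<integral>\<^sup>+X. f (X ** R) \<partial>haar)"
    using f by (intro nn_integral_distr m) (simp add: measurable_cong_sets[OF sets_haar refl])
  finally show ?thesis by simp
qed

section \<open>The uniform law on the Grassmannian\<close>

lemma bij_matrix_vector_mult:
  fixes X :: "real^'n^'n"
  assumes "det X \<noteq> 0"
  shows "bij ((*v) X)"
proof -
  have "inj ((*v) X)"
    using assms det_nz_iff_inj[of "(*v) X"] by simp
  then show ?thesis
    using linear_injective_imp_surjective[of "(*v) X"] by (simp add: bij_def)
qed

lemma random_matrix_image:
  fixes f :: "'w \<Rightarrow> (real^'n) set" and X :: "'w \<Rightarrow> real^'n^'n"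
  assumes f: "random_nonempty_closed N f" and cv: "\<And>\<omega>. \<omega> \<in> space N \<Longrightarrow> convex (f \<omega>)"
    and X[measurable]: "X \<in> borel_measurable N" and det: "\<And>\<omega>. \<omega> \<in> space N \<Longrightarrow> det (X \<omega>) \<noteq> 0"
  shows "random_nonempty_closed N (\<lambda>\<omega>. (*v) (X \<omega>) ` f \<omega>)"
proof (rule random_nonempty_closed_image[OF f cv])
  show "(\<lambda>\<omega>. X \<omega> *v Z \<omega>) \<in> borel_measurable N" if "Z \<in> borel_measurable N" for Z
    using borel_measurable_matrix_vector_mult[OF X that] .
  show "continuous_on UNIV ((*v) (X \<omega>))" for \<omega>
    by (simp add: linear_continuous_on matrix_vector_mul_bounded_linear)
  show "closed ((*v) (X \<omega>) ` f \<omega>)" if "\<omega> \<in> space N" for \<omega>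
    using random_nonempty_closedD(1)[OF f that] det[OF that]
    by (intro closed_injective_linear_image) (auto intro: bij_is_inj bij_matrix_vector_mult)
qed

lemma det_orthogonal_matrix_nonzero:
  fixes X :: "real^'n^'n"
  assumes "orthogonal_matrix X"
  shows "det X \<noteq> 0"
  using det_orthogonal_matrix[OF assms] by auto

lemma closest_point_subspace_unique:
  fixes L :: "'a::euclidean_space set"
  assumes L: "subspace L" and p: "p \<in> L" "\<And>v. v \<in> L \<Longrightarrow> (z - p) \<bullet> v = 0"
  shows "closest_point L z = p"
proof -
  let ?q = "closest_point L z"
  have q: "?q \<in> L" using closest_point_in_set[OF subspace_convex_closed(1,3)[OF L]] .
  then have d: "?q - p \<in> L" using L p by (intro subspace_diff)
  have "(?q - p) \<bullet> (?q - p) = (z - p) \<bullet> (?q - p) - (z - ?q) \<bullet> (?q - p)"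
    by (simp add: inner_diff_left)
  also have "\<dots> = 0" using p(2)[OF d] subspace_closest_point_orthogonal[OF L d] by simp
  finally show ?thesis by simp
qed

lemma linear_closest_point_subspace:
  fixes L :: "'a::euclidean_space set"
  assumes L: "subspace L"
  shows "linear (closest_point L)"
proof (rule linearI)
  have in_L: "closest_point L z \<in> L" for z using closest_point_in_set[OF subspace_convex_closed(1,3)[OF L]] .
  note o = subspace_closest_point_orthogonal[OF L]
  show "closest_point L (x + y) = closest_point L x + closest_point L y" for x y
  proof (rule closest_point_subspace_unique[OF L])
    show "closest_point L x + closest_point L y \<in> L" using in_L L by (intro subspace_add)
    show "(x + y - (closest_point L x + closest_point L y)) \<bullet> v = 0" if "v \<in> L" for v
      using o[OF that, of x] o[OF that, of y] by (simp add: inner_diff_left inner_add_left)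
  qed
  show "closest_point L (c *\<^sub>R x) = c *\<^sub>R closest_point L x" for c x
  proof (rule closest_point_subspace_unique[OF L])
    show "c *\<^sub>R closest_point L x \<in> L" using in_L L by (intro subspace_mul)
    show "(c *\<^sub>R x - c *\<^sub>R closest_point L x) \<bullet> v = 0" if "v \<in> L" for v
      using o[OF that, of x] by (simp add: inner_diff_left)
  qed
qed

lemma dim_orthogonal_comp:
  fixes L :: "'a::euclidean_space set"
  assumes "subspace L"
  shows "dim (L\<^sup>\<bottom>) + dim L = DIM('a)"
  using dim_subspace_orthogonal_to_vectors[of L UNIV] assms
  by (simp add: orthogonal_comp_def)

text \<open>
  Glue an isometry between the subspaces with one between their orthogonal complements.
\<close>

lemma orthogonal_transformation_between_subspaces:
  fixes V W :: "'a::euclidean_space set"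
  assumes V: "subspace V" and W: "subspace W" and dim: "dim V = dim W"
  obtains T where "orthogonal_transformation T" "T ` V = W"
proof -
  obtain f where f: "linear f" "f ` V = W" "\<And>x. x \<in> V \<Longrightarrow> norm (f x) = norm x"
    using isometries_subspaces[OF V W dim] by metis
  have dimc: "dim (V\<^sup>\<bottom>) = dim (W\<^sup>\<bottom>)"
    using dim_orthogonal_comp[OF V] dim_orthogonal_comp[OF W] dim by linarith
  obtain g gi where g: "linear g" "g ` (V\<^sup>\<bottom>) = W\<^sup>\<bottom>" "\<And>x. x \<in> V\<^sup>\<bottom> \<Longrightarrow> norm (g x) = norm x"
    and "linear gi" "gi ` (W\<^sup>\<bottom>) = V\<^sup>\<bottom>"
    by (rule isometries_subspaces[OF subspace_orthogonal_comp[of V] subspace_orthogonal_comp[of W] dimc]) (rule that)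
  let ?p = "closest_point V"
  define T where "T z = f (?p z) + g (z - ?p z)" for z
  have pV: "?p z \<in> V" for z using closest_point_in_set[OF subspace_convex_closed(1,3)[OF V]] .
  have qV: "z - ?p z \<in> V\<^sup>\<bottom>" for z
    using subspace_closest_point_orthogonal[OF V] by (auto simp: orthogonal_comp_def orthogonal_def inner_commute)
  have linT: "linear T"
    unfolding T_def
    by (intro linear_compose_add linear_compose[OF _ f(1), unfolded comp_def]
        linear_compose[OF _ g(1), unfolded comp_def] linear_compose_sub linear_closest_point_subspace[OF V] linear_ident)
  have nT: "norm (T z) = norm z" for z
  proof -
    have "orthogonal (f (?p z)) (g (z - ?p z))"
      using f(2) g(2) pV[of z] qV[of z] by (auto simp: orthogonal_comp_def)
    then have "(norm (T z))\<^sup>2 = (norm (?p z))\<^sup>2 + (norm (z - ?p z))\<^sup>2"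
      unfolding T_def by (simp add: norm_add_Pythagorean f(3)[OF pV] g(3)[OF qV])
    also have "\<dots> = (norm (?p z + (z - ?p z)))\<^sup>2"
      using subspace_closest_point_orthogonal[OF V pV, of z z]
      by (intro norm_add_Pythagorean[symmetric]) (simp add: orthogonal_def inner_commute)
    finally show ?thesis by simp
  qed
  have "T z = f z" if "z \<in> V" for z
    using closest_point_self[OF that] linear_0[OF g(1)] by (simp add: T_def)
  then have "T ` V = W" using f(2) by (auto simp: image_iff)
  moreover have "orthogonal_transformation T" using linT nT by (simp add: orthogonal_transformation)
  ultimately show ?thesis using that by blast
qed

definition subspaces_of_dim :: "nat \<Rightarrow> (real^'n) set set" where
  "subspaces_of_dim m = {W. subspace W \<and> dim W = m}"

definition grassmannian :: "nat \<Rightarrow> (real^'n) set measure" where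
  "grassmannian m = restrict_space closed_sets_borel {W. subspace W \<and> dim W = m}"

lemma space_grassmannian: "space (grassmannian m) = subspaces_of_dim m"
  using closed_subspace
  by (auto simp: grassmannian_def space_restrict_space space_closed_sets_borel subspaces_of_dim_def)

lemma subspaces_of_dim_matrix_image:
  fixes X :: "real^'n^'n"
  assumes X: "det X \<noteq> 0" and W: "W \<in> subspaces_of_dim m"
  shows "(*v) X ` W \<in> subspaces_of_dim m"
proof -
  have "inj ((*v) X)" using bij_matrix_vector_mult[OF X] by (rule bij_is_inj)
  then have "dim ((*v) X ` W) = dim W"
    by (intro dim_image_eq) (auto intro: inj_on_subset)
  then show ?thesis using W by (simp add: subspaces_of_dim_def linear_subspace_image)
qed

lemma measurable_grassmannian_iff:
  fixes f :: "'w \<Rightarrow> (real^'n) set"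
  shows "f \<in> N \<rightarrow>\<^sub>M grassmannian m \<longleftrightarrow>
    random_nonempty_closed N f \<and> (\<forall>\<omega>\<in>space N. f \<omega> \<in> subspaces_of_dim m)"
proof
  assume f: "f \<in> N \<rightarrow>\<^sub>M grassmannian m"
  have 1: "f \<omega> \<in> subspaces_of_dim m" if "\<omega> \<in> space N" for \<omega>
    using measurable_space[OF f that] by (simp add: space_grassmannian)
  have "f \<in> N \<rightarrow>\<^sub>M closed_sets_borel"
    using f unfolding grassmannian_def by (simp add: measurable_restrict_space2_iff)
  then show "random_nonempty_closed N f \<and> (\<forall>\<omega>\<in>space N. f \<omega> \<in> subspaces_of_dim m)"
    unfolding random_nonempty_closed_def using 1 subspace_0 by (auto simp: subspaces_of_dim_def)
next
  assume "random_nonempty_closed N f \<and> (\<forall>\<omega>\<in>space N. f \<omega> \<in> subspaces_of_dim m)"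
  then show "f \<in> N \<rightarrow>\<^sub>M grassmannian m"
    unfolding grassmannian_def random_nonempty_closed_def subspaces_of_dim_def
    by (intro measurable_restrict_space2) auto
qed

lemma measurable_grassmannian_matrix_image:
  fixes f :: "'w \<Rightarrow> (real^'n) set" and X :: "'w \<Rightarrow> real^'n^'n"
  assumes f: "f \<in> N \<rightarrow>\<^sub>M grassmannian m" and X: "X \<in> borel_measurable N"
    and det: "\<And>\<omega>. \<omega> \<in> space N \<Longrightarrow> det (X \<omega>) \<noteq> 0"
  shows "(\<lambda>\<omega>. (*v) (X \<omega>) ` f \<omega>) \<in> N \<rightarrow>\<^sub>M grassmannian m"
  unfolding measurable_grassmannian_iff
proof (intro conjI ballI)
  have f': "random_nonempty_closed N f" "\<And>\<omega>. \<omega> \<in> space N \<Longrightarrow> f \<omega> \<in> subspaces_of_dim m"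
    using f unfolding measurable_grassmannian_iff by auto
  show "random_nonempty_closed N (\<lambda>\<omega>. (*v) (X \<omega>) ` f \<omega>)"
    using f'(2) by (intro random_matrix_image[OF f'(1) _ X det]) (auto simp: subspaces_of_dim_def subspace_imp_convex)
  show "(*v) (X \<omega>) ` f \<omega> \<in> subspaces_of_dim m" if "\<omega> \<in> space N" for \<omega>
    by (rule subspaces_of_dim_matrix_image[OF det[OF that] f'(2)[OF that]])
qed

lemma measurable_transpose: "(transpose :: real^'n^'m \<Rightarrow> real^'m^'n) \<in> borel_measurable borel"
  by (rule borel_measurable_continuous_onI[OF continuous_on_transpose])

definition grassmannian_invariant :: "nat \<Rightarrow> (real^'n) set measure \<Rightarrow> bool" where
  "grassmannian_invariant m \<mu> \<longleftrightarrow> sets \<mu> = sets (grassmannian m) \<and> prob_space \<mu> \<and>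
    (\<forall>g\<in>{\<lambda>W. T ` W |T. orthogonal_transformation T}. distr \<mu> (grassmannian m) g = \<mu>)"

lemma measurable_haar_transpose_image:
  fixes V :: "(real^'n) set"
  assumes V: "V \<in> subspaces_of_dim m"
  shows "(\<lambda>X. (*v) (transpose X) ` V) \<in> haar \<rightarrow>\<^sub>M grassmannian m"
proof (rule measurable_grassmannian_matrix_image)
  show "(\<lambda>X. V) \<in> haar \<rightarrow>\<^sub>M grassmannian m" using V by (simp add: space_grassmannian)
  show "transpose \<in> borel_measurable haar" using measurable_compose[OF measurable_haar_id measurable_transpose] .
  show "det (transpose X) \<noteq> 0" if "X \<in> space haar" for X :: "real^'n^'n"
    using that by (simp add: space_haar det_orthogonal_matrix_nonzero)
qed

lemma measurable_haar_image:
  fixes V :: "(real^'n) set"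
  assumes V: "V \<in> subspaces_of_dim m"
  shows "(\<lambda>X. (*v) X ` V) \<in> haar \<rightarrow>\<^sub>M grassmannian m"
proof (rule measurable_grassmannian_matrix_image)
  show "(\<lambda>X. V) \<in> haar \<rightarrow>\<^sub>M grassmannian m" using V by (simp add: space_grassmannian)
  show "(\<lambda>X. X) \<in> borel_measurable haar" by (rule measurable_haar_id)
  show "det X \<noteq> 0" if "X \<in> space haar" for X :: "real^'n^'n"
    using that by (simp add: space_haar det_orthogonal_matrix_nonzero)
qed

text \<open>
  The image of a fixed subspace under the transpose of a Haar matrix has an invariant law, since
  transposition turns the right invariance of the Haar measure into left invariance.
\<close>

lemma haar_transpose_image_invariant:
  fixes V :: "(real^'n) set"
  assumes V: "V \<in> subspaces_of_dim m"
  shows "grassmannian_invariant m (distr haar (grassmannian m) (\<lambda>X. (*v) (transpose X) ` V))"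
  unfolding grassmannian_invariant_def
proof (intro conjI ballI)
  let ?\<phi> = "\<lambda>X. (*v) (transpose X) ` V"
  interpret H: prob_space "haar :: (real^'n^'n) measure" by (rule prob_space_haar)
  note m = measurable_haar_transpose_image[OF V]
  show "prob_space (distr haar (grassmannian m) ?\<phi>)" by (rule H.prob_space_distr[OF m])
  fix g :: "(real^'n) set \<Rightarrow> (real^'n) set" assume "g \<in> {\<lambda>W. T ` W |T. orthogonal_transformation T}"
  then obtain T where T: "orthogonal_transformation T" "g = (\<lambda>W. T ` W)" by auto
  define R where "R = matrix T"
  have R: "orthogonal_matrix R" "T = (*v) R"
    using T(1) unfolding R_def orthogonal_transformation_matrix[of T]
    by (auto simp: orthogonal_transformation_matrix matrix_works)
  then have Rt: "orthogonal_matrix (transpose R)" by (simp add: orthogonal_matrix_transpose)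
  have gm: "g \<in> grassmannian m \<rightarrow>\<^sub>M grassmannian m"
    unfolding T(2) R(2)
    by (rule measurable_grassmannian_matrix_image) (simp_all add: det_orthogonal_matrix_nonzero[OF R(1)])
  have "distr (distr haar (grassmannian m) ?\<phi>) (grassmannian m) g = distr haar (grassmannian m) (\<lambda>X. ?\<phi> (X ** transpose R))"
    unfolding distr_distr[OF gm m]
    by (simp only: comp_def T(2) R(2) image_image matrix_transpose_mul transpose_transpose matrix_vector_mul_assoc)
  also have "\<dots> = distr (distr haar orthogonal_group (\<lambda>X. X ** transpose R)) (grassmannian m) ?\<phi>"
  proof (subst distr_distr)
    show "?\<phi> \<in> orthogonal_group \<rightarrow>\<^sub>M grassmannian m"
      using m by (simp add: measurable_cong_sets[OF sets_haar refl])
    show "(\<lambda>X. X ** transpose R) \<in> haar \<rightarrow>\<^sub>M orthogonal_group"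
      using measurable_haar_mult_right[OF Rt] by (simp add: measurable_cong_sets[OF refl sets_haar])
  qed (simp add: comp_def)
  also have "\<dots> = distr haar (grassmannian m) ?\<phi>" by (simp add: haar_right_invariant[OF Rt])
  finally show "distr (distr haar (grassmannian m) ?\<phi>) (grassmannian m) g = distr haar (grassmannian m) ?\<phi>" .
qed simp

text \<open>
  Rotate \<open>W\<close> by an independent Haar matrix, which does not change its law, and integrate over the matrix
  first: by right invariance and transitivity of the action the inner integral does not depend on \<open>W\<close>. So
  an invariant law is determined.
\<close>

lemma grassmannian_invariant_emeasure:
  fixes V :: "(real^'n) set"
  assumes \<mu>: "grassmannian_invariant m \<mu>" and V: "V \<in> subspaces_of_dim m" and S: "S \<in> sets (grassmannian m)"
  shows "emeasure \<mu> S = (\<integral>\<^sup>+X. indicator S ((*v) X ` V) \<partial>haar)"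
proof -
  have s: "sets \<mu> = sets (grassmannian m)" and "prob_space \<mu>"
    and inv: "\<And>T. orthogonal_transformation T \<Longrightarrow> distr \<mu> (grassmannian m) ((`) T) = \<mu>"
    using \<mu> unfolding grassmannian_invariant_def by auto
  interpret M: prob_space \<mu> by fact
  interpret H: prob_space "haar :: (real^'n^'n) measure" by (rule prob_space_haar)
  interpret pair_sigma_finite \<mu> "haar :: (real^'n^'n) measure" ..
  have idW: "(\<lambda>W. W) \<in> \<mu> \<rightarrow>\<^sub>M grassmannian m" by (simp add: measurable_cong_sets[OF s refl])
  have act: "(\<lambda>p. (*v) (snd p) ` fst p) \<in> \<mu> \<Otimes>\<^sub>M haar \<rightarrow>\<^sub>M grassmannian m"
  proof (rule measurable_grassmannian_matrix_image)
    show "fst \<in> \<mu> \<Otimes>\<^sub>M haar \<rightarrow>\<^sub>M grassmannian m" using measurable_compose[OF measurable_fst idW] .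
    show "snd \<in> borel_measurable (\<mu> \<Otimes>\<^sub>M haar)" using measurable_compose[OF measurable_snd measurable_haar_id] .
    show "det (snd p) \<noteq> 0" if "p \<in> space (\<mu> \<Otimes>\<^sub>M (haar :: (real^'n^'n) measure))" for p
      using that det_orthogonal_matrix_nonzero[of "snd p"] by (auto simp: space_pair_measure space_haar)
  qed
  have ind: "(indicator S :: _ \<Rightarrow> ennreal) \<in> borel_measurable (grassmannian m)" using S by simp
  have indV: "(\<lambda>X. indicator S ((*v) X ` V) :: ennreal) \<in> borel_measurable haar"
    using measurable_compose[OF measurable_haar_image[OF V] ind] .
  have "emeasure \<mu> S = (\<integral>\<^sup>+X. emeasure \<mu> S \<partial>(haar :: (real^'n^'n) measure))" by (simp add: H.emeasure_space_1)
  also have "\<dots> = (\<integral>\<^sup>+X. (\<integral>\<^sup>+W. indicator S ((*v) X ` W) \<partial>\<mu>) \<partial>haar)"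
  proof (rule nn_integral_cong)
    fix X :: "real^'n^'n" assume "X \<in> space haar"
    then have X: "orthogonal_matrix X" by (simp add: space_haar)
    have gm: "(`) ((*v) X) \<in> \<mu> \<rightarrow>\<^sub>M grassmannian m"
      by (rule measurable_grassmannian_matrix_image[OF idW]) (simp_all add: det_orthogonal_matrix_nonzero[OF X])
    have "emeasure \<mu> S = (\<integral>\<^sup>+W. indicator S W \<partial>distr \<mu> (grassmannian m) ((`) ((*v) X)))"
      using S by (simp add: inv[OF orthogonal_matrix_transformation[OF X]] s)
    also have "\<dots> = (\<integral>\<^sup>+W. indicator S ((*v) X ` W) \<partial>\<mu>)" using ind by (intro nn_integral_distr gm) simp
    finally show "emeasure \<mu> S = (\<integral>\<^sup>+W. indicator S ((*v) X ` W) \<partial>\<mu>)" .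
  qed
  also have "\<dots> = (\<integral>\<^sup>+W. (\<integral>\<^sup>+X. indicator S ((*v) X ` W) \<partial>haar) \<partial>\<mu>)"
    by (rule Fubini') (use measurable_compose[OF act ind] in \<open>simp add: case_prod_beta'\<close>)
  also have "\<dots> = (\<integral>\<^sup>+W. (\<integral>\<^sup>+X. indicator S ((*v) X ` V) \<partial>haar) \<partial>\<mu>)"
  proof (rule nn_integral_cong)
    fix W assume "W \<in> space \<mu>"
    then have W: "W \<in> subspaces_of_dim m" using sets_eq_imp_space_eq[OF s] by (simp add: space_grassmannian)
    obtain T where T: "orthogonal_transformation T" "T ` V = W"
      using orthogonal_transformation_between_subspaces[of V W] V W by (auto simp: subspaces_of_dim_def)
    define R where "R = matrix T"
    have R: "orthogonal_matrix R" "T = (*v) R"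
      using T(1) unfolding R_def orthogonal_transformation_matrix[of T]
      by (auto simp: orthogonal_transformation_matrix matrix_works)
    have "(\<integral>\<^sup>+X. indicator S ((*v) X ` W) \<partial>haar) = (\<integral>\<^sup>+X. indicator S ((*v) (X ** R) ` V) \<partial>haar)"
      using T(2) R(2) by (auto simp: image_image matrix_vector_mul_assoc)
    also have "\<dots> = (\<integral>\<^sup>+X. indicator S ((*v) X ` V) \<partial>haar)"
      by (rule nn_integral_haar_mult_right[OF R(1) indV])
    finally show "(\<integral>\<^sup>+X. indicator S ((*v) X ` W) \<partial>haar) = (\<integral>\<^sup>+X. indicator S ((*v) X ` V) \<partial>haar)" .
  qed
  also have "\<dots> = (\<integral>\<^sup>+X. indicator S ((*v) X ` V) \<partial>haar)" by (simp add: M.emeasure_space_1)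
  finally show ?thesis .
qed

lemma grassmannian_invariant_unique:
  fixes \<mu> \<nu> :: "(real^'n) set measure"
  assumes \<mu>: "grassmannian_invariant m \<mu>" and \<nu>: "grassmannian_invariant m \<nu>"
  shows "\<mu> = \<nu>"
proof -
  have s: "sets \<mu> = sets (grassmannian m)" "sets \<nu> = sets (grassmannian m)" and "prob_space \<mu>"
    using \<mu> \<nu> unfolding grassmannian_invariant_def by auto
  have "space \<mu> \<noteq> {}" using \<open>prob_space \<mu>\<close> by (rule prob_space.not_empty)
  then obtain V :: "(real^'n) set" where V: "V \<in> subspaces_of_dim m"
    using sets_eq_imp_space_eq[OF s(1)] by (auto simp: space_grassmannian)
  show ?thesis
  proof (rule measure_eqI)
    fix S assume "S \<in> sets \<mu>"
    then have "S \<in> sets (grassmannian m)" using s by simp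
    then show "emeasure \<mu> S = emeasure \<nu> S"
      using grassmannian_invariant_emeasure[OF \<mu> V] grassmannian_invariant_emeasure[OF \<nu> V] by simp
  qed (simp add: s)
qed

text \<open>
  The existence and uniqueness behind the definite description; in addition, every subspace \<open>V\<close> of the right
  dimension may serve as the starting point.
\<close>

lemma uniform_grassmannian_eq:
  fixes V :: "(real^'n) set"
  assumes V: "V \<in> subspaces_of_dim m"
  shows "uniform_grassmannian m = distr haar (grassmannian m) (\<lambda>X. (*v) (transpose X) ` V)"
proof -
  have "uniform_grassmannian m = (THE \<mu>. grassmannian_invariant m (\<mu> :: (real^'n) set measure))"
    unfolding uniform_grassmannian_def uniform_law_def grassmannian_invariant_def grassmannian_def ..
  also have "\<dots> = distr haar (grassmannian m) (\<lambda>X. (*v) (transpose X) ` V)"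
    using haar_transpose_image_invariant[OF V]
    by (rule the_equality) (rule grassmannian_invariant_unique[OF _ haar_transpose_image_invariant[OF V]])
  finally show ?thesis .
qed

lemma ex_subspace_of_dim:
  assumes "m \<le> CARD('n)"
  shows "\<exists>V :: (real^'n) set. V \<in> subspaces_of_dim m"
proof -
  have "m \<le> dim (UNIV :: (real^'n) set)" using assms by (simp add: dim_UNIV)
  then obtain V :: "(real^'n) set" where "subspace V" "dim V = m"
    using choose_subspace_of_subspace by metis
  then show ?thesis by (auto simp: subspaces_of_dim_def)
qed

lemma uniform_grassmannian:
  assumes "m \<le> CARD('n)"
  shows "prob_space (uniform_grassmannian m :: (real^'n) set measure)"
    "sets (uniform_grassmannian m :: (real^'n) set measure) = sets (grassmannian m)"
proof -
  obtain V :: "(real^'n) set" where V: "V \<in> subspaces_of_dim m" using ex_subspace_of_dim[OF assms] by blast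
  show "prob_space (uniform_grassmannian m :: (real^'n) set measure)"
    "sets (uniform_grassmannian m :: (real^'n) set measure) = sets (grassmannian m)"
    using haar_transpose_image_invariant[OF V]
    unfolding uniform_grassmannian_eq[OF V] grassmannian_invariant_def by auto
qed

section \<open>Averages of solid angles over the orthogonal group\<close>

lemma measurable_transpose_mult:
  fixes B :: "real^'n^'n"
  shows "(\<lambda>X. transpose X ** B) \<in> borel_measurable (haar :: (real^'n^'n) measure)"
proof -
  have "(\<lambda>Y::real^'n^'n. Y ** B) \<in> borel_measurable borel"
    by (rule borel_measurable_continuous_onI[OF continuous_on_matrix_mult_right])
  then show ?thesis
    using measurable_compose[OF measurable_compose[OF measurable_haar_id measurable_transpose]] by fast
qed

lemma measurable_mult_left:
  fixes B :: "real^'n^'n"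
  shows "(\<lambda>X. B ** X) \<in> borel_measurable (haar :: (real^'n^'n) measure)"
proof -
  have "continuous_on UNIV (\<lambda>X::real^'n^'n. B ** X)"
    unfolding matrix_matrix_mult_def by (intro continuous_intros continuous_on_vec_lambda)
  then have "(\<lambda>X::real^'n^'n. B ** X) \<in> borel_measurable borel"
    by (rule borel_measurable_continuous_onI)
  then show ?thesis using measurable_compose[OF measurable_haar_id] by fast
qed

lemma det_mult_orthogonal_nonzero:
  fixes B X :: "real^'n^'n"
  assumes "det B \<noteq> 0" "orthogonal_matrix X"
  shows "det (B ** X) \<noteq> 0"
  using assms det_orthogonal_matrix_nonzero by (auto simp: det_mul)

lemma image_matrix_mult:
  fixes A B :: "real^'n^'n"
  shows "(*v) (A ** B) ` S = (*v) A ` (*v) B ` S"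
  by (simp add: image_image matrix_vector_mul_assoc)

lemma cone_matrix_image:
  fixes B :: "real^'n^'n"
  assumes "cone C"
  shows "cone ((*v) B ` C)"
  unfolding cone_def
proof (intro ballI allI impI)
  fix y and c :: real assume "y \<in> (*v) B ` C" "c \<ge> 0"
  then obtain x where x: "x \<in> C" "y = B *v x" by auto
  have "c *\<^sub>R y = B *v (c *\<^sub>R x)" by (simp add: x(2) matrix_vector_mult_scaleR)
  then show "c *\<^sub>R y \<in> (*v) B ` C" using mem_cone[OF assms x(1) \<open>c \<ge> 0\<close>] by blast
qed

lemma borel_measurable_cone_angle_image:
  fixes C :: "(real^'n) set" and B :: "real^'n^'n"
  assumes C: "closed C" "convex C" "C \<noteq> {}" and B: "det B \<noteq> 0"
  shows "(\<lambda>X. cone_angle ((*v) (B ** X) ` C)) \<in> borel_measurable haar"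
proof (rule borel_measurable_cone_angle)
  show "random_nonempty_closed haar (\<lambda>X. (*v) (B ** X) ` C)"
    by (rule random_matrix_image[OF random_nonempty_closed_const[OF C(1,3)] C(2) measurable_mult_left])
      (simp add: space_haar det_mult_orthogonal_nonzero[OF B])
qed (intro convex_linear_image matrix_vector_mul_linear C(2))

lemma matrix_reflection:
  fixes a :: "real^'n"
  shows "(*v) (matrix (reflection a)) = reflection a" "orthogonal_matrix (matrix (reflection a))"
    "transpose (matrix (reflection a)) = matrix (reflection a)"
proof -
  let ?R = "matrix (reflection a)"
  show R: "(*v) ?R = reflection a" using matrix_vector_mul(2)[OF linear_reflection[of a]] by simp
  show o: "orthogonal_matrix ?R"
    using orthogonal_transformation_reflection[of a] by (simp add: orthogonal_transformation_matrix)
  have "?R ** ?R = mat 1"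
    by (rule matrix_eq[THEN iffD2]) (simp add: matrix_vector_mul_assoc[symmetric] R reflection_involution)
  moreover have "transpose ?R ** ?R = mat 1" using o by (simp add: orthogonal_matrix)
  ultimately show "transpose ?R = ?R"
    by (metis matrix_mul_assoc matrix_mul_lid matrix_mul_rid)
qed

text \<open>
  The heart of the matter. Let \<open>L\<close> be the linear hull of \<open>C\<close>. Draw \<open>X\<close> from the Haar measure weighted by \<open>b\<close>, draw
  an independent uniform point of the unit ball, project it to the subspace \<open>A X L\<close> and pull it back by \<open>A X\<close>
  to a vector \<open>U\<close> of \<open>L\<close>. Then \<open>U\<close> lies in \<open>C\<close> exactly when the projected point lies in \<open>A X C\<close>. A reflection of
  \<open>L\<close> carries \<open>U\<close> to the vector built from \<open>X\<close> times that reflection, so by right invariance the law of \<open>U\<close> is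
  invariant under the reflections of \<open>L\<close>, and its direction is uniform on the unit sphere of \<open>L\<close>. Thus the
  distortion by \<open>A\<close> is averaged out, even in the presence of a weight \<open>b\<close> that does not see rotations
  inside \<open>L\<close>.
\<close>

lemma cone_angle_average:
  fixes C :: "(real^'n) set" and A :: "real^'n^'n" and b :: "real^'n^'n \<Rightarrow> ennreal"
  assumes C: "closed C" "convex C" "cone C" "C \<noteq> {}" and A: "det A \<noteq> 0"
    and b: "b \<in> borel_measurable haar" "\<And>X. b X \<le> 1"
      "\<And>X a. a \<in> span C \<Longrightarrow> b (X ** matrix (reflection a)) = b X"
  shows "(\<integral>\<^sup>+X. cone_angle ((*v) (A ** X) ` C) * b X \<partial>haar) = cone_angle C * (\<integral>\<^sup>+X. b X \<partial>haar)"
proof -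
  let ?H = "haar :: (real^'n^'n) measure" and ?B = "unit_ball_law :: (real^'n) measure"
  interpret H: prob_space ?H by (rule prob_space_haar)
  interpret B: prob_space ?B by (rule prob_space_unit_ball_law)
  interpret pair_sigma_finite ?H ?B ..
  define L where "L = span C"
  have L: "subspace L" by (simp add: L_def)
  define V where "V X = (*v) (A ** X) ` L" for X
  have V: "subspace (V X)" for X unfolding V_def using L by (simp add: linear_subspace_image)
  obtain A' where invA: "A' ** A = mat 1" using A invertible_det_nz[of A] by (auto simp: invertible_def)
  (* For orthogonal X the matrix X\<^sup>T A\<^sup>-\<^sup>1 inverts A X. *)
  define U where "U X z = (transpose X ** A') *v closest_point (V X) z" for X z
  have inv: "(transpose X ** A') ** (A ** X) = mat 1" if "orthogonal_matrix X" for X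
    using that invA(1) by (metis matrix_mul_assoc matrix_mul_lid orthogonal_matrix)
  have inv_v: "(transpose X ** A') *v ((A ** X) *v x) = x" if "orthogonal_matrix X" for X x
    using inv[OF that] by (metis matrix_vector_mul_assoc matrix_vector_mul_lid)
  have cpV: "closest_point (V X) z \<in> V X" for X z
    using closest_point_in_set[OF subspace_convex_closed(1,3)[OF V]] .
  have U_in: "U X z \<in> L" and U_eq: "(A ** X) *v U X z = closest_point (V X) z"
    if "orthogonal_matrix X" for X z
  proof -
    obtain x where x: "x \<in> L" "closest_point (V X) z = (A ** X) *v x" using cpV[of X z] unfolding V_def by auto
    then have "U X z = x" unfolding U_def using inv_v[OF that] by simp
    then show "U X z \<in> L" "(A ** X) *v U X z = closest_point (V X) z" using x by auto
  qed
  have Vr: "random_nonempty_closed (?H \<Otimes>\<^sub>M ?B) (\<lambda>p. V (fst p))"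
    unfolding V_def
  proof (rule random_matrix_image)
    show "random_nonempty_closed (?H \<Otimes>\<^sub>M ?B) (\<lambda>p. L)"
      using subspace_convex_closed[OF L] by (intro random_nonempty_closed_const)
    show "convex L" using L by (rule subspace_imp_convex)
    show "(\<lambda>p. A ** fst p) \<in> borel_measurable (?H \<Otimes>\<^sub>M ?B)"
      by (rule measurable_compose[OF measurable_fst measurable_mult_left])
    show "det (A ** fst p) \<noteq> 0" if "p \<in> space (?H \<Otimes>\<^sub>M ?B)" for p
      using that by (intro det_mult_orthogonal_nonzero A) (auto simp: space_pair_measure space_haar)
  qed
  have cpm: "(\<lambda>p. closest_point (V (fst p)) (snd p)) \<in> borel_measurable (?H \<Otimes>\<^sub>M ?B)"
    by (rule borel_measurable_closest_point[OF Vr subspace_imp_convex[OF V]]) simp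
  have Um: "(\<lambda>p. U (fst p) (snd p)) \<in> borel_measurable (?H \<Otimes>\<^sub>M ?B)"
    unfolding U_def
    by (rule borel_measurable_matrix_vector_mult[OF measurable_compose[OF measurable_fst measurable_transpose_mult] cpm])
  have bm: "(\<lambda>p. b (fst p)) \<in> borel_measurable (?H \<Otimes>\<^sub>M ?B)" by (rule measurable_compose[OF measurable_fst b(1)])
  define \<delta> where "\<delta> = density (?H \<Otimes>\<^sub>M ?B) (\<lambda>p. b (fst p))"
  define \<rho> where "\<rho> = distr \<delta> borel (\<lambda>p. U (fst p) (snd p))"
  have sd: "sets \<delta> = sets (?H \<Otimes>\<^sub>M ?B)" by (simp add: \<delta>_def)
  have Um': "(\<lambda>p. U (fst p) (snd p)) \<in> \<delta> \<rightarrow>\<^sub>M borel" using Um by (simp add: measurable_cong_sets[OF sd refl])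
  have Umz: "(\<lambda>z. U X z) \<in> borel_measurable ?B" if "X \<in> space ?H" for X
    using measurable_compose[OF measurable_Pair1'[OF that] Um] by simp
  define w where "w S X = emeasure ?B {z. U X z \<in> S} * b X" for S X
  have wm: "w S \<in> borel_measurable ?H" if S: "S \<in> sets borel" for S
  proof -
    have "(\<lambda>X. emeasure ?B (Pair X -` {p \<in> space (?H \<Otimes>\<^sub>M ?B). U (fst p) (snd p) \<in> S})) \<in> borel_measurable ?H"
      using measurable_sets[OF Um S] by (intro B.measurable_emeasure_Pair) (simp add: vimage_def Int_def conj_commute)
    moreover have "Pair X -` {p \<in> space (?H \<Otimes>\<^sub>M ?B). U (fst p) (snd p) \<in> S} = {z. U X z \<in> S}"
      if "X \<in> space ?H" for X using that by (auto simp: space_pair_measure)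
    ultimately have "(\<lambda>X. emeasure ?B {z. U X z \<in> S}) \<in> borel_measurable ?H" by (simp cong: measurable_cong)
    then show ?thesis unfolding w_def using b(1) by (intro borel_measurable_times_ennreal)
  qed
  have em: "emeasure \<rho> S = (\<integral>\<^sup>+X. w S X \<partial>?H)" if S: "S \<in> sets borel" for S
  proof -
    have ind: "(\<lambda>p. indicator S (U (fst p) (snd p)) :: ennreal) \<in> borel_measurable (?H \<Otimes>\<^sub>M ?B)"
      using measurable_compose[OF Um borel_measurable_indicator[OF S]] .
    have "emeasure \<rho> S = (\<integral>\<^sup>+x. indicator S x \<partial>\<rho>)" using S by (simp add: \<rho>_def)
    also have "\<dots> = (\<integral>\<^sup>+p. indicator S (U (fst p) (snd p)) \<partial>\<delta>)"
      unfolding \<rho>_def using S by (intro nn_integral_distr Um') simp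
    also have "\<dots> = (\<integral>\<^sup>+p. b (fst p) * indicator S (U (fst p) (snd p)) \<partial>(?H \<Otimes>\<^sub>M ?B))"
      unfolding \<delta>_def by (rule nn_integral_density[OF bm ind])
    also have "\<dots> = (\<integral>\<^sup>+X. \<integral>\<^sup>+z. b X * indicator S (U X z) \<partial>?B \<partial>?H)"
      using B.nn_integral_fst[OF borel_measurable_times_ennreal[OF bm ind]] by simp
    also have "\<dots> = (\<integral>\<^sup>+X. w S X \<partial>?H)"
    proof (rule nn_integral_cong)
      fix X assume X: "X \<in> space ?H"
      have "(\<integral>\<^sup>+z. b X * indicator S (U X z) \<partial>?B) = (\<integral>\<^sup>+z. b X * indicator {z. U X z \<in> S} z \<partial>?B)"
        by (intro nn_integral_cong) (simp add: indicator_def)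
      also have "\<dots> = b X * emeasure ?B {z. U X z \<in> S}"
        using measurable_sets[OF Umz[OF X] S] by (intro nn_integral_cmult_indicator) (simp add: vimage_def)
      finally show "(\<integral>\<^sup>+z. b X * indicator S (U X z) \<partial>?B) = w S X" by (simp add: w_def mult.commute)
    qed
    finally show ?thesis .
  qed
  have UNIVb: "(UNIV :: (real^'n) set) \<in> sets borel" by simp
  have wU: "w UNIV X = b X" for X using B.emeasure_space_1 by (simp add: w_def)
  have "emeasure \<rho> C = cone_angle C * emeasure \<rho> UNIV"
  proof (rule reflection_invariant_law_cone[OF C(1,3,4)])
    have sr: "sets \<rho> = sets borel" by (simp add: \<rho>_def)
    then show "sets \<rho> = sets borel" .
    have spr: "space \<rho> = UNIV" by (simp add: \<rho>_def)
    have "emeasure \<rho> UNIV \<le> (\<integral>\<^sup>+X. 1 \<partial>?H)" unfolding em[OF UNIVb] wU by (intro nn_integral_mono b(2))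
    then have "emeasure \<rho> UNIV \<le> 1" using H.emeasure_space_1 by simp
    then show "finite_measure \<rho>" using spr by (intro finite_measureI) (auto simp: top_unique)
    have Lb: "L \<in> sets borel" using subspace_convex_closed(1)[OF L] by (rule borel_closed)
    have "w (- L) X = 0" if "X \<in> space ?H" for X
      using U_in that by (simp add: w_def space_haar)
    then have "emeasure \<rho> (- L) = 0" using Lb by (subst em) (auto simp: nn_integral_0_iff_AE wm)
    then have "AE x in \<rho>. x \<notin> - L" using Lb sr by (intro AE_not_in) auto
    then show "AE x in \<rho>. x \<in> span C" by (simp add: L_def)
    show "AE x in \<rho>. x \<noteq> 0" if nz: "span C \<noteq> {0}"
    proof -
      have "w {0} X = 0" if X: "X \<in> space ?H" for X
      proof -
        have o: "orthogonal_matrix X" using X by (simp add: space_haar)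
        obtain v where v: "v \<in> L" "v \<noteq> 0" using nz subspace_0[OF L] unfolding L_def by blast
        then have "(A ** X) *v v \<in> V X" "(A ** X) *v v \<noteq> 0"
          using inv_v[OF o, of v] by (auto simp: V_def)
        then have "V X \<noteq> {0}" by blast
        from AE_closest_point_subspace_nonzero[OF V this]
        have "AE z in ?B. z \<notin> {z. U X z \<in> {0}}"
          by (rule AE_mp) (auto simp: U_eq[OF o, symmetric])
        then have "emeasure ?B {z. U X z \<in> {0}} = 0"
          using measurable_sets[OF Umz[OF X], of "{0}"]
          by (subst (asm) AE_iff_measurable[OF _ refl]) (auto simp: vimage_def)
        then show ?thesis by (simp add: w_def)
      qed
      then have "emeasure \<rho> {0} = 0" by (subst em) (auto simp: nn_integral_0_iff_AE wm)
      then have "AE x in \<rho>. x \<notin> {0}" using sr by (intro AE_not_in) auto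
      then show ?thesis by simp
    qed
    fix a assume a: "a \<in> span C"
    let ?R = "matrix (reflection a)"
    note R = matrix_reflection[of a]
    have aL: "a \<in> L" using a by (simp add: L_def)
    have UR: "reflection a (U X z) = U (X ** ?R) z" for X z
    proof -
      (* The reflection preserves L, so the subspace to which the point is projected stays the same. *)
      have VR: "V (X ** ?R) = V X"
        unfolding V_def matrix_mul_assoc image_matrix_mult[of "A ** X"] R(1) reflection_image_subspace[OF L aL] ..
      have "reflection a (U X z) = ?R *v U X z" by (simp only: R(1))
      also have "\<dots> = U (X ** ?R) z"
        unfolding U_def VR matrix_transpose_mul R(3) matrix_vector_mul_assoc matrix_mul_assoc ..
      finally show ?thesis .
    qed
    have Rm: "reflection a \<in> borel_measurable borel"
      by (rule orthogonal_transformation_measurable[OF orthogonal_transformation_reflection])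
    show "distr \<rho> borel (reflection a) = \<rho>"
    proof (rule measure_eqI)
      fix S assume "S \<in> sets (distr \<rho> borel (reflection a))"
      then have S: "S \<in> sets borel" by simp
      have RS: "reflection a -` S \<in> sets borel" using measurable_sets[OF Rm S] by simp
      have "emeasure (distr \<rho> borel (reflection a)) S = emeasure \<rho> (reflection a -` S)"
        using Rm spr S by (subst emeasure_distr) (simp_all add: measurable_cong_sets[OF sr refl])
      also have "\<dots> = (\<integral>\<^sup>+X. w S (X ** ?R) \<partial>?H)"
        unfolding em[OF RS] w_def by (simp add: UR b(3)[OF a])
      also have "\<dots> = (\<integral>\<^sup>+X. w S X \<partial>?H)" by (rule nn_integral_haar_mult_right[OF R(2) wm[OF S]])
      finally show "emeasure (distr \<rho> borel (reflection a)) S = emeasure \<rho> S" using em[OF S] by simp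
    qed (simp add: sr)
  qed
  moreover have "emeasure \<rho> C = (\<integral>\<^sup>+X. cone_angle ((*v) (A ** X) ` C) * b X \<partial>?H)"
    unfolding em[OF borel_closed[OF C(1)]]
  proof (rule nn_integral_cong)
    fix X assume "X \<in> space ?H"
    then have X: "orthogonal_matrix X" by (simp add: space_haar)
    have "span ((*v) (A ** X) ` C) = V X" unfolding V_def L_def by (simp add: linear_span_image)
    moreover have "closest_point (V X) z \<in> (*v) (A ** X) ` C \<longleftrightarrow> U X z \<in> C" for z
      unfolding U_eq[OF X, symmetric]
      using bij_matrix_vector_mult[OF det_mult_orthogonal_nonzero[OF A X]]
      by (simp add: inj_image_mem_iff bij_is_inj)
    ultimately show "w C X = cone_angle ((*v) (A ** X) ` C) * b X" by (simp add: w_def cone_angle_def)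
  qed
  ultimately show ?thesis unfolding em[OF UNIVb] wU by simp
qed

section \<open>Linear images of polyhedra and their cones\<close>

lemma polar_matrix_image:
  fixes B G :: "real^'n^'n"
  assumes BG: "transpose B ** G = mat 1"
  shows "polar ((*v) B ` C) = (*v) G ` polar C"
proof -
  have GB: "G ** transpose B = mat 1" using BG matrix_left_right_inverse by blast
  have mem: "w \<in> polar ((*v) B ` C) \<longleftrightarrow> transpose B *v w \<in> polar C" for w
    by (simp add: polar_def dot_lmul_matrix)
  show ?thesis
  proof (intro set_eqI iffI)
    fix w assume "w \<in> polar ((*v) B ` C)"
    then have "transpose B *v w \<in> polar C" by (simp only: mem)
    moreover have "w = G *v (transpose B *v w)" by (simp only: matrix_vector_mul_assoc GB matrix_vector_mul_lid)
    ultimately show "w \<in> (*v) G ` polar C" by (rule rev_image_eqI)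
  next
    fix w assume "w \<in> (*v) G ` polar C"
    then obtain v where v: "v \<in> polar C" "w = G *v v" by auto
    then have "transpose B *v w = v" by (simp only: matrix_vector_mul_assoc BG matrix_vector_mul_lid)
    then show "w \<in> polar ((*v) B ` C)" using v(1) by (simp only: mem)
  qed
qed

lemma tangent_cone_matrix_image:
  fixes B :: "real^'n^'n"
  assumes B: "det B \<noteq> 0"
  shows "tangent_cone ((*v) B ` F) ((*v) B ` P) = (*v) B ` tangent_cone F P"
proof -
  have UN: "tangent_cone F P = (\<Union>f\<in>rel_interior F. dir_cone f P)" for F P :: "(real^'n) set"
    by (auto simp: tangent_cone_def dir_cone_def)
  have "rel_interior ((*v) B ` F) = (*v) B ` rel_interior F"
    using bij_matrix_vector_mult[OF B] by (intro rel_interior_injective_linear_image) (auto simp: bij_is_inj)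
  then show ?thesis
    by (simp add: UN dir_cone_linear_image[OF matrix_vector_mul_linear bij_matrix_vector_mult[OF B]] image_UN)
qed

lemma faces_matrix_image:
  fixes B :: "real^'n^'n"
  assumes B: "det B \<noteq> 0"
  shows "faces j ((*v) B ` P) = (`) ((*v) B) ` faces j P"
proof -
  have inj: "inj ((*v) B)" using bij_matrix_vector_mult[OF B] by (rule bij_is_inj)
  note lin = matrix_vector_mul_linear[of B]
  have dim: "aff_dim ((*v) B ` F) = aff_dim F" for F using aff_dim_injective_linear_image[OF lin inj] .
  have "faces j ((*v) B ` P) = {G \<in> (`) ((*v) B) ` {F. F face_of P}. aff_dim G = int j}"
    unfolding faces_def faces_of_linear_image[OF lin inj, symmetric] by auto
  also have "\<dots> = (`) ((*v) B) ` faces j P" by (auto simp: dim faces_def)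
  finally show ?thesis .
qed

lemma sum_faces_matrix_image:
  fixes B :: "real^'n^'n" and g :: "(real^'n) set \<Rightarrow> 'b::comm_monoid_add"
  assumes B: "det B \<noteq> 0"
  shows "(\<Sum>G\<in>faces j ((*v) B ` P). g G) = (\<Sum>F\<in>faces j P. g ((*v) B ` F))"
proof -
  have "inj_on ((`) ((*v) B)) (faces j P)"
    using bij_matrix_vector_mult[OF B] by (intro inj_onI) (simp add: inj_image_eq_iff bij_is_inj)
  then show ?thesis unfolding faces_matrix_image[OF B] by (simp add: sum.reindex)
qed

lemma polyhedron_matrix_image:
  fixes B :: "real^'n^'n"
  assumes "det B \<noteq> 0" "polyhedron P"
  shows "polyhedron ((*v) B ` P)"
  using assms bij_matrix_vector_mult[OF assms(1)]
  by (simp add: polyhedron_linear_image_eq[OF matrix_vector_mul_linear])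

text \<open>
  The empty set is excluded so that random polyhedra are random nonempty closed sets.
\<close>

definition polyhedra :: "(real^'n) set measure" where
  "polyhedra = restrict_space closed_sets_borel {Q. polyhedron Q \<and> Q \<noteq> {}}"

definition polyhedral_cones :: "(real^'n) set measure" where
  "polyhedral_cones = restrict_space closed_sets_borel {C. polyhedron C \<and> cone C \<and> C \<noteq> {}}"

lemma measurable_polyhedra_iff:
  fixes f :: "'w \<Rightarrow> (real^'n) set"
  shows "f \<in> N \<rightarrow>\<^sub>M polyhedra \<longleftrightarrow> random_nonempty_closed N f \<and> (\<forall>\<omega>\<in>space N. polyhedron (f \<omega>))"
  unfolding polyhedra_def measurable_restrict_space2_iff random_nonempty_closed_def by auto

lemma measurable_polyhedral_cones_iff:
  fixes f :: "'w \<Rightarrow> (real^'n) set"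
  shows "f \<in> N \<rightarrow>\<^sub>M polyhedral_cones \<longleftrightarrow>
    random_nonempty_closed N f \<and> (\<forall>\<omega>\<in>space N. polyhedron (f \<omega>) \<and> cone (f \<omega>))"
  unfolding polyhedral_cones_def measurable_restrict_space2_iff random_nonempty_closed_def by auto

lemma space_polyhedra: "space polyhedra = {Q. polyhedron Q \<and> Q \<noteq> {}}"
  using polyhedron_imp_closed by (auto simp: polyhedra_def space_restrict_space space_closed_sets_borel)

lemma space_polyhedral_cones: "space polyhedral_cones = {C. polyhedron C \<and> cone C \<and> C \<noteq> {}}"
  using polyhedron_imp_closed by (auto simp: polyhedral_cones_def space_restrict_space space_closed_sets_borel)

lemma tangent_cone_face_at:
  assumes "polyhedron P" "y \<in> P"
  shows "tangent_cone (face_at y P) P = dir_cone y P"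
  using face_at_face_of[OF polyhedron_imp_convex[OF assms(1)] assms(2)]
    tangent_cone_eq_dir_cone[OF polyhedron_imp_convex[OF assms(1)]] by blast

lemma tangent_cone_polyhedral:
  assumes P: "polyhedron P" and F: "F \<in> faces j P"
  shows "tangent_cone F P \<in> space polyhedral_cones"
proof -
  have F': "F face_of P" "F \<noteq> {}" using F by (auto simp: faces_def)
  have "convex F" using F' face_of_imp_convex by blast
  then obtain y where y: "y \<in> rel_interior F" using F' rel_interior_eq_empty by blast
  then have yP: "y \<in> P" using F' face_of_imp_subset rel_interior_subset by blast
  have "tangent_cone F P = dir_cone y P"
    using tangent_cone_eq_dir_cone[OF polyhedron_imp_convex[OF P] F'(1) y] .
  then show ?thesis
    using polyhedron_dir_cone[OF P yP] cone_dir_cone[OF polyhedron_imp_convex[OF P] yP] zero_in_dir_cone[OF yP]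
    by (auto simp: space_polyhedral_cones)
qed

lemma measurable_polyhedra_matrix_image:
  fixes f :: "'w \<Rightarrow> (real^'n) set" and Y :: "'w \<Rightarrow> real^'n^'n"
  assumes f: "f \<in> N \<rightarrow>\<^sub>M polyhedra" and Y: "Y \<in> borel_measurable N" "\<And>\<omega>. \<omega> \<in> space N \<Longrightarrow> det (Y \<omega>) \<noteq> 0"
  shows "(\<lambda>\<omega>. (*v) (Y \<omega>) ` f \<omega>) \<in> N \<rightarrow>\<^sub>M polyhedra"
  using f unfolding measurable_polyhedra_iff
  by (auto intro!: random_matrix_image Y polyhedron_matrix_image intro: polyhedron_imp_convex)

lemma measurable_haar_image_polyhedral_cone:
  fixes C :: "(real^'n) set" and A :: "real^'n^'n"
  assumes A: "det A \<noteq> 0" and C: "C \<in> space polyhedral_cones"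
  shows "(\<lambda>X. (*v) (A ** X) ` C) \<in> haar \<rightarrow>\<^sub>M polyhedral_cones"
  unfolding measurable_polyhedral_cones_iff
proof (intro conjI ballI)
  have C': "polyhedron C" "cone C" "C \<noteq> {}" using C by (auto simp: space_polyhedral_cones)
  have det: "det (A ** X) \<noteq> 0" if "X \<in> space haar" for X :: "real^'n^'n"
    using that by (intro det_mult_orthogonal_nonzero A) (simp add: space_haar)
  show "random_nonempty_closed haar (\<lambda>X. (*v) (A ** X) ` C)"
    using C' by (intro random_matrix_image[OF _ _ measurable_mult_left det] random_nonempty_closed_const)
      (auto intro: polyhedron_imp_convex polyhedron_imp_closed)
  show "polyhedron ((*v) (A ** X) ` C)" "cone ((*v) (A ** X) ` C)" if "X \<in> space haar" for X
    using polyhedron_matrix_image[OF det[OF that] C'(1)] cone_matrix_image[OF C'(2)] by auto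
qed

section \<open>Functionals with the averaging property\<close>

text \<open>
  A functional of polyhedral cones that does not feel a linear distortion \<open>A\<close> once the cone has been rotated at
  random before. The theorem holds for every such functional.
\<close>

definition averaging_functional :: "((real^'n) set \<Rightarrow> real) \<Rightarrow> bool" where
  "averaging_functional \<Phi> \<longleftrightarrow>
    (\<forall>C. \<Phi> C \<ge> 0) \<and>
    (\<lambda>C. ennreal (\<Phi> C)) \<in> borel_measurable polyhedral_cones \<and>
    (\<forall>A C. det A \<noteq> 0 \<longrightarrow> C \<in> space polyhedral_cones \<longrightarrow>
      (\<integral>\<^sup>+X. ennreal (\<Phi> ((*v) (A ** X) ` C)) \<partial>haar) = ennreal (\<Phi> C))"

lemma borel_measurable_tangent_sum:
  fixes \<Phi> :: "(real^'n) set \<Rightarrow> real"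
  assumes \<Phi>: "(\<lambda>C. ennreal (\<Phi> C)) \<in> borel_measurable polyhedral_cones"
  shows "(\<lambda>Q. \<Sum>F\<in>faces j Q. ennreal (\<Phi> (tangent_cone F Q))) \<in> borel_measurable polyhedra"
proof -
  have "(\<lambda>Q. Q) \<in> polyhedra \<rightarrow>\<^sub>M (polyhedra :: (real^'n) set measure)" by simp
  then have id: "random_nonempty_closed polyhedra (\<lambda>Q :: (real^'n) set. Q)"
    and poly: "\<And>Q :: (real^'n) set. Q \<in> space polyhedra \<Longrightarrow> polyhedron Q"
    unfolding measurable_polyhedra_iff by auto
  show ?thesis
  proof (rule borel_measurable_sum_faces[OF id poly])
    fix y :: "(real^'n) set \<Rightarrow> real^'n"
    assume y: "y \<in> borel_measurable polyhedra" "\<And>Q. Q \<in> space polyhedra \<Longrightarrow> y Q \<in> Q"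
    have "(\<lambda>Q. dir_cone (y Q) Q) \<in> polyhedra \<rightarrow>\<^sub>M polyhedral_cones"
      unfolding measurable_polyhedral_cones_iff
      using random_dir_cone[OF id poly y] polyhedron_dir_cone[OF poly y(2)]
        cone_dir_cone[OF polyhedron_imp_convex[OF poly] y(2)] by auto
    from measurable_compose[OF this \<Phi>]
    have "(\<lambda>Q. ennreal (\<Phi> (dir_cone (y Q) Q))) \<in> borel_measurable polyhedra" .
    moreover have "tangent_cone (face_at (y Q) Q) Q = dir_cone (y Q) Q" if "Q \<in> space polyhedra" for Q
      using tangent_cone_face_at[OF poly[OF that] y(2)[OF that]] .
    ultimately show "(\<lambda>Q. ennreal (\<Phi> (tangent_cone (face_at (y Q) Q) Q))) \<in> borel_measurable polyhedra"
      by (simp cong: measurable_cong)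
  qed
qed

text \<open>
  By rotation invariance the left hand side does not change if \<open>A P\<close> is replaced by \<open>A X P\<close> with an orthogonal
  \<open>X\<close>. Average over \<open>X\<close> with respect to the Haar measure and exchange the integrals: for each realization of \<open>P\<close>,
  the faces and tangent cones of \<open>A X P\<close> are the images under \<open>A X\<close> of those of \<open>P\<close>, so the averaging property
  applies to each term.
\<close>

lemma expected_tangent_sum_invariant:
  fixes M :: "'w measure" and P :: "'w \<Rightarrow> (real^'n) set" and A :: "real^'n^'n"
  assumes M: "prob_space M" and P: "P \<in> M \<rightarrow>\<^sub>M polyhedra"
    and inv: "\<And>T. orthogonal_transformation T \<Longrightarrow> distr M polyhedra (\<lambda>\<omega>. T ` P \<omega>) = distr M polyhedra P"
    and A: "det A \<noteq> 0" and \<Phi>: "averaging_functional \<Phi>"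
  shows "(\<integral>\<^sup>+\<omega>. (\<Sum>G\<in>faces j ((*v) A ` P \<omega>). ennreal (\<Phi> (tangent_cone G ((*v) A ` P \<omega>)))) \<partial>M)
    = (\<integral>\<^sup>+\<omega>. (\<Sum>F\<in>faces j (P \<omega>). ennreal (\<Phi> (tangent_cone F (P \<omega>)))) \<partial>M)"
proof -
  interpret M: prob_space M by fact
  interpret H: prob_space "haar :: (real^'n^'n) measure" by (rule prob_space_haar)
  interpret pair_sigma_finite M "haar :: (real^'n^'n) measure" ..
  have \<Phi>m: "(\<lambda>C. ennreal (\<Phi> C)) \<in> borel_measurable polyhedral_cones"
    and \<Phi>a: "\<And>A C. det A \<noteq> 0 \<Longrightarrow> C \<in> space polyhedral_cones \<Longrightarrow>
      (\<integral>\<^sup>+X. ennreal (\<Phi> ((*v) (A ** X) ` C)) \<partial>haar) = ennreal (\<Phi> C)"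
    using \<Phi> unfolding averaging_functional_def by auto
  define S where "S Q = (\<Sum>F\<in>faces j Q. ennreal (\<Phi> (tangent_cone F Q)))" for Q
  have Sm: "S \<in> borel_measurable polyhedra" unfolding S_def by (rule borel_measurable_tangent_sum[OF \<Phi>m])
  have rot: "(\<integral>\<^sup>+\<omega>. S ((*v) A ` P \<omega>) \<partial>M) = (\<integral>\<^sup>+\<omega>. S ((*v) (A ** X) ` P \<omega>) \<partial>M)"
    if X: "orthogonal_matrix X" for X
  proof -
    define f where "f Q = S ((*v) A ` Q)" for Q
    have fm: "f \<in> borel_measurable polyhedra"
      unfolding f_def by (rule measurable_compose[OF measurable_polyhedra_matrix_image Sm]) (simp_all add: A)
    have XP: "(\<lambda>\<omega>. (*v) X ` P \<omega>) \<in> M \<rightarrow>\<^sub>M polyhedra"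
      by (rule measurable_polyhedra_matrix_image[OF P]) (simp_all add: det_orthogonal_matrix_nonzero[OF X])
    have "(\<integral>\<^sup>+\<omega>. f (P \<omega>) \<partial>M) = (\<integral>\<^sup>+Q. f Q \<partial>distr M polyhedra P)"
      using fm by (intro nn_integral_distr[symmetric] P) simp
    also have "\<dots> = (\<integral>\<^sup>+Q. f Q \<partial>distr M polyhedra (\<lambda>\<omega>. (*v) X ` P \<omega>))"
      by (simp add: inv[OF orthogonal_matrix_transformation[OF X]])
    also have "\<dots> = (\<integral>\<^sup>+\<omega>. f ((*v) X ` P \<omega>) \<partial>M)"
      using fm by (intro nn_integral_distr XP) simp
    finally show ?thesis by (simp only: f_def image_matrix_mult)
  qed
  have avg: "(\<integral>\<^sup>+X. S ((*v) (A ** X) ` Q) \<partial>haar) = S Q" if Q: "Q \<in> space polyhedra" for Q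
  proof -
    have poly: "polyhedron Q" using Q by (simp add: space_polyhedra)
    have "(\<integral>\<^sup>+X. S ((*v) (A ** X) ` Q) \<partial>haar) =
        (\<integral>\<^sup>+X. (\<Sum>F\<in>faces j Q. ennreal (\<Phi> ((*v) (A ** X) ` tangent_cone F Q))) \<partial>haar)"
    proof (rule nn_integral_cong)
      fix X :: "real^'n^'n" assume "X \<in> space haar"
      then have "det (A ** X) \<noteq> 0" by (intro det_mult_orthogonal_nonzero A) (simp add: space_haar)
      then show "S ((*v) (A ** X) ` Q) = (\<Sum>F\<in>faces j Q. ennreal (\<Phi> ((*v) (A ** X) ` tangent_cone F Q)))"
        unfolding S_def by (simp add: sum_faces_matrix_image tangent_cone_matrix_image)
    qed
    also have "\<dots> = (\<Sum>F\<in>faces j Q. \<integral>\<^sup>+X. ennreal (\<Phi> ((*v) (A ** X) ` tangent_cone F Q)) \<partial>haar)"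
    proof (rule nn_integral_sum)
      fix F assume "F \<in> faces j Q"
      from tangent_cone_polyhedral[OF poly this]
      show "(\<lambda>X. ennreal (\<Phi> ((*v) (A ** X) ` tangent_cone F Q))) \<in> borel_measurable haar"
        by (rule measurable_compose[OF measurable_haar_image_polyhedral_cone[OF A] \<Phi>m])
    qed
    also have "\<dots> = S Q"
      unfolding S_def by (intro sum.cong refl \<Phi>a A tangent_cone_polyhedral[OF poly])
    finally show ?thesis .
  qed
  have Sjoint: "(\<lambda>p. S ((*v) (A ** snd p) ` P (fst p))) \<in> borel_measurable (M \<Otimes>\<^sub>M haar)"
  proof (rule measurable_compose[OF measurable_polyhedra_matrix_image Sm])
    show "(\<lambda>p. P (fst p)) \<in> M \<Otimes>\<^sub>M (haar :: (real^'n^'n) measure) \<rightarrow>\<^sub>M polyhedra"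
      by (rule measurable_compose[OF measurable_fst P])
    show "(\<lambda>p. A ** snd p) \<in> borel_measurable (M \<Otimes>\<^sub>M haar)"
      by (rule measurable_compose[OF measurable_snd measurable_mult_left])
    show "det (A ** snd p) \<noteq> 0" if "p \<in> space (M \<Otimes>\<^sub>M (haar :: (real^'n^'n) measure))" for p
      using that by (intro det_mult_orthogonal_nonzero A) (auto simp: space_pair_measure space_haar)
  qed
  have "(\<integral>\<^sup>+\<omega>. S ((*v) A ` P \<omega>) \<partial>M) =
      (\<integral>\<^sup>+X. (\<integral>\<^sup>+\<omega>. S ((*v) A ` P \<omega>) \<partial>M) \<partial>(haar :: (real^'n^'n) measure))"
    by (simp add: H.emeasure_space_1)
  also have "\<dots> = (\<integral>\<^sup>+X. (\<integral>\<^sup>+\<omega>. S ((*v) (A ** X) ` P \<omega>) \<partial>M) \<partial>haar)"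
    by (intro nn_integral_cong rot) (simp add: space_haar)
  also have "\<dots> = (\<integral>\<^sup>+\<omega>. (\<integral>\<^sup>+X. S ((*v) (A ** X) ` P \<omega>) \<partial>haar) \<partial>M)"
    by (rule Fubini') (use Sjoint in \<open>simp add: case_prod_beta'\<close>)
  also have "\<dots> = (\<integral>\<^sup>+\<omega>. S (P \<omega>) \<partial>M)"
    by (intro nn_integral_cong avg measurable_space[OF P])
  finally show ?thesis unfolding S_def .
qed

lemma measurable_polyhedral_cones_self:
  shows "random_nonempty_closed polyhedral_cones (\<lambda>C :: (real^'n) set. C)"
    and "\<And>C :: (real^'n) set. C \<in> space polyhedral_cones \<Longrightarrow> polyhedron C \<and> convex C \<and> closed C \<and> cone C \<and> C \<noteq> {}"
proof -
  have "(\<lambda>C. C) \<in> polyhedral_cones \<rightarrow>\<^sub>M (polyhedral_cones :: (real^'n) set measure)" by simp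
  then show "random_nonempty_closed polyhedral_cones (\<lambda>C :: (real^'n) set. C)"
    unfolding measurable_polyhedral_cones_iff by blast
qed (auto simp: space_polyhedral_cones intro: polyhedron_imp_convex polyhedron_imp_closed)

lemma solid_angle_nonneg: "solid_angle C \<ge> 0"
  by (simp add: solid_angle_def)

lemma averaging_functional_solid_angle: "averaging_functional (solid_angle :: (real^'n) set \<Rightarrow> real)"
  unfolding averaging_functional_def
proof (intro conjI allI impI solid_angle_nonneg)
  interpret H: prob_space "haar :: (real^'n^'n) measure" by (rule prob_space_haar)
  note self = measurable_polyhedral_cones_self
  have eq: "ennreal (solid_angle C) = cone_angle C" if "C \<in> space polyhedral_cones" for C :: "(real^'n) set"
    using self(2)[OF that] by (intro solid_angle_eq_cone_angle) auto
  have "(\<lambda>C :: (real^'n) set. cone_angle C) \<in> borel_measurable polyhedral_cones"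
    using self by (intro borel_measurable_cone_angle) auto
  then show "(\<lambda>C :: (real^'n) set. ennreal (solid_angle C)) \<in> borel_measurable polyhedral_cones"
    by (simp add: eq cong: measurable_cong)
  fix A :: "real^'n^'n" and C :: "(real^'n) set"
  assume A: "det A \<noteq> 0" and C: "C \<in> space polyhedral_cones"
  have "(\<integral>\<^sup>+X. ennreal (solid_angle ((*v) (A ** X) ` C)) \<partial>haar) = (\<integral>\<^sup>+X. cone_angle ((*v) (A ** X) ` C) * 1 \<partial>haar)"
    using measurable_space[OF measurable_haar_image_polyhedral_cone[OF A C]]
    by (intro nn_integral_cong) (simp add: eq)
  also have "\<dots> = cone_angle C * (\<integral>\<^sup>+X. 1 \<partial>(haar :: (real^'n^'n) measure))"
    using self(2)[OF C] by (intro cone_angle_average A) auto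
  finally show "(\<integral>\<^sup>+X. ennreal (solid_angle ((*v) (A ** X) ` C)) \<partial>haar) = ennreal (solid_angle C)"
    by (simp add: eq[OF C] H.emeasure_space_1)
qed

text \<open>
  A random subspace \<open>W\<close> meets \<open>A X C\<close> outside the origin exactly when \<open>X\<^sup>T A\<^sup>-\<^sup>1 W\<close> meets \<open>C\<close>. For fixed \<open>W\<close> and a Haar
  matrix \<open>X\<close> the latter subspace is uniformly distributed.
\<close>

lemma averaging_functional_grassmann_angle:
  assumes k: "k \<le> CARD('n)"
  shows "averaging_functional (grassmann_angle k :: (real^'n) set \<Rightarrow> real)"
  unfolding averaging_functional_def
proof (intro conjI allI impI)
  show "grassmann_angle k C \<ge> 0" for C :: "(real^'n) set" by (simp add: grassmann_angle_def)
  interpret H: prob_space "haar :: (real^'n^'n) measure" by (rule prob_space_haar)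
  define m where "m = CARD('n) - k"
  have m: "m \<le> CARD('n)" by (simp add: m_def)
  define U where "U = (uniform_grassmannian m :: (real^'n) set measure)"
  have "prob_space U" and sU: "sets U = sets (grassmannian m)"
    using uniform_grassmannian[OF m] unfolding U_def by auto
  interpret U: prob_space U by fact
  interpret pair_sigma_finite U "haar :: (real^'n^'n) measure" ..
  have spU: "space U = subspaces_of_dim m" using sets_eq_imp_space_eq[OF sU] by (simp add: space_grassmannian)
  have Wr: "random_nonempty_closed U (\<lambda>W. W)"
  proof -
    have "(\<lambda>W. W) \<in> U \<rightarrow>\<^sub>M grassmannian m" by (simp add: measurable_cong_sets[OF sU refl])
    then show ?thesis unfolding measurable_grassmannian_iff by blast
  qed
  have Wsub: "subspace W" if "W \<in> space U" for W using that by (simp add: spU subspaces_of_dim_def)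
  define hit where "hit C = {W \<in> space U. W \<inter> C \<noteq> {0}}" for C
  have eq: "ennreal (grassmann_angle k C) = emeasure U (hit C)" for C
    unfolding grassmann_angle_def hit_def U_def m_def by (simp add: U.emeasure_eq_measure[unfolded U_def m_def])
  note self = measurable_polyhedral_cones_self
  have "(\<lambda>C. emeasure U {W \<in> space U. W \<inter> C \<noteq> {0}}) \<in> borel_measurable polyhedral_cones"
  proof (rule U.measurable_emeasure)
    let ?N = "polyhedral_cones \<Otimes>\<^sub>M U"
    have "Measurable.pred ?N (\<lambda>p. snd p \<inter> fst p \<noteq> {0})"
    proof (rule pred_subspace_hits_cone)
      show "random_nonempty_closed ?N fst" by (rule random_nonempty_closed_compose[OF self(1)]) simp
      show "random_nonempty_closed ?N snd" by (rule random_nonempty_closed_compose[OF Wr]) simp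
      show "convex (fst p) \<and> cone (fst p)" "subspace (snd p)" if "p \<in> space ?N" for p
        using that self(2)[of "fst p"] Wsub[of "snd p"] by (auto simp: space_pair_measure)
    qed
    then have "{p \<in> space ?N. snd p \<inter> fst p \<noteq> {0}} \<in> sets ?N" by (simp add: pred_def)
    moreover have "{p \<in> space ?N. snd p \<in> {W \<in> space U. W \<inter> fst p \<noteq> {0}}} =
        {p \<in> space ?N. snd p \<inter> fst p \<noteq> {0}}"
      by (auto simp: space_pair_measure)
    ultimately show "{p \<in> space ?N. snd p \<in> {W \<in> space U. W \<inter> fst p \<noteq> {0}}} \<in> sets ?N" by (simp only:)
  qed auto
  then show "(\<lambda>C :: (real^'n) set. ennreal (grassmann_angle k C)) \<in> borel_measurable polyhedral_cones"
    unfolding eq hit_def .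
  fix A :: "real^'n^'n" and C :: "(real^'n) set"
  assume A: "det A \<noteq> 0" and C: "C \<in> space polyhedral_cones"
  obtain A' where A': "A' ** A = mat 1" "A ** A' = mat 1" using A invertible_det_nz[of A] by (auto simp: invertible_def)
  have detA': "det A' \<noteq> 0" using A' invertible_det_nz[of A'] by (auto simp: invertible_def)
  have img: "(\<lambda>X. (*v) (A ** X) ` C) \<in> haar \<rightarrow>\<^sub>M polyhedral_cones"
    by (rule measurable_haar_image_polyhedral_cone[OF A C])
  let ?P = "\<lambda>W X. W \<inter> (*v) (A ** X) ` C \<noteq> {0}"
  have pr: "Measurable.pred (U \<Otimes>\<^sub>M haar) (\<lambda>p. ?P (fst p) (snd p))"
  proof (rule pred_subspace_hits_cone)
    have "random_nonempty_closed haar (\<lambda>X. (*v) (A ** X) ` C)"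
      using img unfolding measurable_polyhedral_cones_iff by blast
    then show "random_nonempty_closed (U \<Otimes>\<^sub>M haar) (\<lambda>p. (*v) (A ** snd p) ` C)"
      by (rule random_nonempty_closed_compose) simp
    show "random_nonempty_closed (U \<Otimes>\<^sub>M (haar :: (real^'n^'n) measure)) fst"
      by (rule random_nonempty_closed_compose[OF Wr]) simp
    show "convex ((*v) (A ** snd p) ` C) \<and> cone ((*v) (A ** snd p) ` C)" for p :: "(real^'n) set \<times> (real^'n^'n)"
      using self(2)[OF C] by (auto intro: convex_linear_image cone_matrix_image)
    show "subspace (fst p)" if "p \<in> space (U \<Otimes>\<^sub>M (haar :: (real^'n^'n) measure))" for p
      using that Wsub by (auto simp: space_pair_measure)
  qed
  have hitm: "hit ((*v) (A ** X) ` C) \<in> sets U" if "X \<in> space haar" for X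
  proof -
    have "Measurable.pred U (\<lambda>W. ?P W X)"
      using measurable_compose[OF measurable_Pair2'[OF that] pr] by simp
    then show ?thesis by (simp add: hit_def pred_def)
  qed
  have hitC: "hit C \<in> sets (grassmannian m)"
  proof -
    have "Measurable.pred U (\<lambda>W. W \<inter> C \<noteq> {0})"
      using self(2)[OF C] Wsub
      by (intro pred_subspace_hits_cone Wr random_nonempty_closed_const) auto
    then show ?thesis by (simp add: hit_def pred_def sU)
  qed
  have "(\<integral>\<^sup>+X. ennreal (grassmann_angle k ((*v) (A ** X) ` C)) \<partial>haar) =
      (\<integral>\<^sup>+X. (\<integral>\<^sup>+W. of_bool (?P W X) \<partial>U) \<partial>haar)"
  proof (rule nn_integral_cong)
    fix X :: "real^'n^'n" assume X: "X \<in> space haar"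
    have "ennreal (grassmann_angle k ((*v) (A ** X) ` C)) = (\<integral>\<^sup>+W. indicator (hit ((*v) (A ** X) ` C)) W \<partial>U)"
      using hitm[OF X] by (simp add: eq)
    also have "\<dots> = (\<integral>\<^sup>+W. of_bool (?P W X) \<partial>U)"
      by (intro nn_integral_cong) (simp add: hit_def indicator_def)
    finally show "ennreal (grassmann_angle k ((*v) (A ** X) ` C)) = (\<integral>\<^sup>+W. of_bool (?P W X) \<partial>U)" .
  qed
  also have "\<dots> = (\<integral>\<^sup>+W. (\<integral>\<^sup>+X. of_bool (?P W X) \<partial>haar) \<partial>U)"
  proof (rule Fubini')
    have "(\<lambda>p. if ?P (fst p) (snd p) then 1 else 0 :: ennreal) \<in> borel_measurable (U \<Otimes>\<^sub>M haar)"
      using pr by (intro measurable_If) simp_all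
    then show "(\<lambda>(W, X). of_bool (?P W X) :: ennreal) \<in> borel_measurable (U \<Otimes>\<^sub>M haar)"
      by (simp add: case_prod_beta' of_bool_def)
  qed
  also have "\<dots> = (\<integral>\<^sup>+W. emeasure U (hit C) \<partial>U)"
  proof (rule nn_integral_cong)
    fix W assume "W \<in> space U"
    then have W: "W \<in> subspaces_of_dim m" by (simp add: spU)
    let ?W = "(*v) A' ` W"
    have W': "?W \<in> subspaces_of_dim m" by (rule subspaces_of_dim_matrix_image[OF detA' W])
    (* Apply the inverse X\<^sup>T A\<^sup>-\<^sup>1 of A X to the intersection. *)
    have eqX: "?P W X \<longleftrightarrow> (*v) (transpose X) ` ?W \<in> hit C" if "X \<in> space haar" for X
    proof -
      have X: "orthogonal_matrix X" using that by (simp add: space_haar)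
      let ?G = "transpose X ** A'"
      have "?G ** (A ** X) = mat 1"
        using X A'(1) by (metis matrix_mul_assoc matrix_mul_lid orthogonal_matrix)
      then have GB: "(*v) ?G ` (*v) (A ** X) ` C = C"
        by (simp only: image_matrix_mult[symmetric]) simp
      have "det (transpose X) \<noteq> 0" using det_orthogonal_matrix_nonzero[OF X] by simp
      then have inj: "inj ((*v) ?G)"
        using detA' by (intro bij_is_inj bij_matrix_vector_mult) (simp add: det_mul)
      have "(*v) ?G ` (W \<inter> (*v) (A ** X) ` C) = (*v) ?G ` W \<inter> C"
        by (simp only: image_Int[OF inj] GB)
      moreover have "(*v) ?G ` {0} = {0}" by simp
      ultimately have "W \<inter> (*v) (A ** X) ` C = {0} \<longleftrightarrow> (*v) ?G ` W \<inter> C = {0}"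
        by (metis inj inj_image_eq_iff)
      moreover have "(*v) (transpose X) ` ?W \<in> space U"
        unfolding spU by (rule subspaces_of_dim_matrix_image[OF \<open>det (transpose X) \<noteq> 0\<close> W'])
      ultimately show ?thesis by (simp only: hit_def image_matrix_mult mem_Collect_eq simp_thms)
    qed
    have "(\<integral>\<^sup>+X. of_bool (?P W X) \<partial>haar) = (\<integral>\<^sup>+X. indicator (hit C) ((*v) (transpose X) ` ?W) \<partial>haar)"
      by (intro nn_integral_cong) (simp only: eqX indicator_def of_bool_def)
    also have "\<dots> = (\<integral>\<^sup>+V. indicator (hit C) V \<partial>distr haar (grassmannian m) (\<lambda>X. (*v) (transpose X) ` ?W))"
      using hitC by (intro nn_integral_distr[symmetric] measurable_haar_transpose_image[OF W']) simp
    also have "\<dots> = emeasure U (hit C)"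
      using hitC sU unfolding uniform_grassmannian_eq[OF W', symmetric] U_def[symmetric] by simp
    finally show "(\<integral>\<^sup>+X. of_bool (?P W X) \<partial>haar) = emeasure U (hit C)" .
  qed
  also have "\<dots> = ennreal (grassmann_angle k C)" by (simp add: U.emeasure_space_1 eq)
  finally show "(\<integral>\<^sup>+X. ennreal (grassmann_angle k ((*v) (A ** X) ` C)) \<partial>haar) = ennreal (grassmann_angle k C)" .
qed

lemma face_of_cone_is_cone:
  fixes C :: "'a::euclidean_space set"
  assumes "cone C" "D face_of C"
  shows "cone D"
  using face_of_conic[of C D] assms by (auto simp: conic_def cone_def)

lemma normal_cone_properties:
  fixes C :: "(real^'n) set"
  assumes C: "C \<in> space polyhedral_cones" and D: "D \<in> faces k C"
  shows "closed (normal_cone D C)" "convex (normal_cone D C)" "cone (normal_cone D C)" "normal_cone D C \<noteq> {}"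
    and "closed D" "convex D" "cone D" "D \<noteq> {}"
    and "span (normal_cone D C) = (span D)\<^sup>\<bottom>"
proof -
  have C': "polyhedron C" "cone C" using C by (auto simp: space_polyhedral_cones)
  have D': "D face_of C" "D \<noteq> {}" using D by (auto simp: faces_def)
  show "closed (normal_cone D C)" "convex (normal_cone D C)" "cone (normal_cone D C)"
    unfolding normal_cone_eq_polar by (rule closed_polar convex_polar cone_polar)+
  show "normal_cone D C \<noteq> {}" unfolding normal_cone_eq_polar using zero_in_polar by blast
  show "closed D" "convex D" "cone D" "D \<noteq> {}"
    using face_of_polyhedron_polyhedron[OF C'(1) D'(1)] face_of_cone_is_cone[OF C'(2) D'(1)] D'(2)
      polyhedron_imp_closed polyhedron_imp_convex by auto
  show "span (normal_cone D C) = (span D)\<^sup>\<bottom>" by (rule span_normal_cone[OF C' D'])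
qed

lemma ennreal_conic_intrinsic_volume:
  fixes C :: "(real^'n) set"
  assumes C: "C \<in> space polyhedral_cones"
  shows "ennreal (conic_intrinsic_volume k C) = (\<Sum>D\<in>faces k C. cone_angle D * cone_angle (normal_cone D C))"
proof -
  have "ennreal (conic_intrinsic_volume k C) =
      (\<Sum>D\<in>faces k C. ennreal (solid_angle D * solid_angle (normal_cone D C)))"
    unfolding conic_intrinsic_volume_def by (rule sum_ennreal[symmetric]) (simp add: solid_angle_nonneg)
  also have "\<dots> = (\<Sum>D\<in>faces k C. cone_angle D * cone_angle (normal_cone D C))"
  proof (rule sum.cong)
    fix D assume D: "D \<in> faces k C"
    note p = normal_cone_properties[OF C D]
    show "ennreal (solid_angle D * solid_angle (normal_cone D C)) = cone_angle D * cone_angle (normal_cone D C)"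
      using solid_angle_eq_cone_angle[OF p(5,7,8)] solid_angle_eq_cone_angle[OF p(1,3,4)]
      by (simp add: ennreal_mult solid_angle_nonneg)
  qed simp
  finally show ?thesis .
qed

lemma cone_angle_le_1: "cone_angle C \<le> 1"
proof -
  interpret B: prob_space "unit_ball_law :: 'a measure" by (rule prob_space_unit_ball_law)
  show ?thesis unfolding cone_angle_def by (rule B.emeasure_le_1)
qed

text \<open>
  Apply the averaging of a single angle twice: the angle of the second cone is a weight that is not affected
  by rotations inside the span of the first cone, because these fix its orthogonal complement pointwise.
\<close>

lemma flag_angle_average:
  fixes D N :: "(real^'n) set" and A G :: "real^'n^'n"
  assumes D: "closed D" "convex D" "cone D" "D \<noteq> {}" and N: "closed N" "convex N" "cone N" "N \<noteq> {}"
    and orth: "span N \<subseteq> (span D)\<^sup>\<bottom>" and A: "det A \<noteq> 0" and G: "det G \<noteq> 0"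
  shows "(\<integral>\<^sup>+X. cone_angle ((*v) (A ** X) ` D) * cone_angle ((*v) (G ** X) ` N) \<partial>haar)
    = cone_angle D * cone_angle N"
proof -
  interpret H: prob_space "haar :: (real^'n^'n) measure" by (rule prob_space_haar)
  have "(\<integral>\<^sup>+X. cone_angle ((*v) (A ** X) ` D) * cone_angle ((*v) (G ** X) ` N) \<partial>haar)
      = cone_angle D * (\<integral>\<^sup>+X. cone_angle ((*v) (G ** X) ` N) \<partial>haar)"
  proof (rule cone_angle_average[OF D A borel_measurable_cone_angle_image[OF N(1,2,4) G] cone_angle_le_1])
    fix X :: "real^'n^'n" and a assume a: "a \<in> span D"
    have "reflection a v = v" if "v \<in> N" for v
    proof (rule reflection_orthogonal)
      have "v \<in> (span D)\<^sup>\<bottom>" using that orth span_superset[of N] by blast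
      then show "a \<bullet> v = 0" using a by (auto simp: orthogonal_comp_def orthogonal_def)
    qed
    then have "reflection a ` N = N" by auto
    then show "cone_angle ((*v) (G ** (X ** matrix (reflection a))) ` N) = cone_angle ((*v) (G ** X) ` N)"
      by (simp only: matrix_mul_assoc image_matrix_mult[of "G ** X"] matrix_reflection(1))
  qed
  also have "(\<integral>\<^sup>+X. cone_angle ((*v) (G ** X) ` N) \<partial>haar) = cone_angle N * (\<integral>\<^sup>+X. 1 \<partial>(haar :: (real^'n^'n) measure))"
    using cone_angle_average[OF N G, of "\<lambda>_. 1"] by simp
  finally show ?thesis by (simp add: H.emeasure_space_1)
qed

text \<open>
  Under a linear map \<open>B\<close> the normal cones are transformed by the inverse transpose of \<open>B\<close>; for \<open>B = A X\<close> with an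
  orthogonal \<open>X\<close> this is \<open>A\<^sup>-\<^sup>T X\<close>. A face and its normal cone span orthogonal subspaces, so the product of
  their angles is averaged by the result on pairs of cones.
\<close>

lemma averaging_functional_conic_intrinsic_volume:
  "averaging_functional (conic_intrinsic_volume k :: (real^'n) set \<Rightarrow> real)"
  unfolding averaging_functional_def
proof (intro conjI allI impI)
  show "conic_intrinsic_volume k C \<ge> 0" for C :: "(real^'n) set"
    unfolding conic_intrinsic_volume_def by (intro sum_nonneg mult_nonneg_nonneg solid_angle_nonneg)
  note self = measurable_polyhedral_cones_self
  have "(\<lambda>C :: (real^'n) set. \<Sum>D\<in>faces k C. cone_angle D * cone_angle (normal_cone D C))
      \<in> borel_measurable polyhedral_cones"
  proof (rule borel_measurable_sum_faces[OF self(1)])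
    show poly: "polyhedron C" if "C \<in> space polyhedral_cones" for C :: "(real^'n) set" using self(2)[OF that] by blast
    fix y :: "(real^'n) set \<Rightarrow> real^'n"
    assume y: "y \<in> borel_measurable polyhedral_cones" "\<And>C. C \<in> space polyhedral_cones \<Longrightarrow> y C \<in> C"
    have cv: "convex (face_at (y C) C)" if "C \<in> space polyhedral_cones" for C
      using face_at_face_of(1)[OF polyhedron_imp_convex[OF poly[OF that]] y(2)[OF that]] face_of_imp_convex by blast
    have T: "convex (dir_cone (y C) C) \<and> cone (dir_cone (y C) C)" if "C \<in> space polyhedral_cones" for C
      using polyhedron_imp_convex[OF polyhedron_dir_cone[OF poly[OF that] y(2)[OF that]]]
        cone_dir_cone[OF polyhedron_imp_convex[OF poly[OF that]] y(2)[OF that]] by blast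
    have 1: "(\<lambda>C. cone_angle (face_at (y C) C)) \<in> borel_measurable polyhedral_cones"
      by (rule borel_measurable_cone_angle[OF random_face_at[OF self(1) poly y] cv])
    have "(\<lambda>C. cone_angle (polar (dir_cone (y C) C))) \<in> borel_measurable polyhedral_cones"
      by (rule borel_measurable_cone_angle[OF random_polar[OF random_dir_cone[OF self(1) poly y] T] convex_polar])
    moreover have "normal_cone (face_at (y C) C) C = polar (dir_cone (y C) C)" if "C \<in> space polyhedral_cones" for C
      using tangent_cone_face_at[OF poly[OF that] y(2)[OF that]] by (simp add: normal_cone_eq_polar)
    ultimately have "(\<lambda>C. cone_angle (normal_cone (face_at (y C) C) C)) \<in> borel_measurable polyhedral_cones"
      by (simp cong: measurable_cong)
    with 1 show "(\<lambda>C. cone_angle (face_at (y C) C) * cone_angle (normal_cone (face_at (y C) C) C))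
        \<in> borel_measurable polyhedral_cones"
      by (rule borel_measurable_times_ennreal)
  qed
  then show "(\<lambda>C :: (real^'n) set. ennreal (conic_intrinsic_volume k C)) \<in> borel_measurable polyhedral_cones"
    by (simp add: ennreal_conic_intrinsic_volume cong: measurable_cong)
  fix A :: "real^'n^'n" and C :: "(real^'n) set"
  assume A: "det A \<noteq> 0" and C: "C \<in> space polyhedral_cones"
  obtain A' where A': "A' ** A = mat 1" "A ** A' = mat 1" using A invertible_det_nz[of A] by (auto simp: invertible_def)
  define G where "G = transpose A'"
  have "det A' \<noteq> 0" using A' invertible_det_nz[of A'] by (auto simp: invertible_def)
  then have G: "det G \<noteq> 0" by (simp add: G_def)
  have polyC: "polyhedron C" using C by (simp add: space_polyhedral_cones)
  have "(\<integral>\<^sup>+X. ennreal (conic_intrinsic_volume k ((*v) (A ** X) ` C)) \<partial>haar) =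
      (\<integral>\<^sup>+X. (\<Sum>D\<in>faces k C. cone_angle ((*v) (A ** X) ` D) * cone_angle ((*v) (G ** X) ` normal_cone D C)) \<partial>haar)"
  proof (rule nn_integral_cong)
    fix X :: "real^'n^'n" assume Xs: "X \<in> space haar"
    then have X: "orthogonal_matrix X" by (simp add: space_haar)
    have B: "det (A ** X) \<noteq> 0" by (rule det_mult_orthogonal_nonzero[OF A X])
    have "transpose (A ** X) ** (G ** X) = transpose X ** (transpose (A' ** A) ** X)"
      unfolding G_def matrix_transpose_mul by (simp only: matrix_mul_assoc)
    also have "\<dots> = mat 1" using X by (simp add: A'(1) transpose_mat orthogonal_matrix)
    finally have "polar ((*v) (A ** X) ` T) = (*v) (G ** X) ` polar T" for T
      by (rule polar_matrix_image)
    then have "normal_cone ((*v) (A ** X) ` D) ((*v) (A ** X) ` C) = (*v) (G ** X) ` normal_cone D C" for D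
      by (simp add: normal_cone_eq_polar tangent_cone_matrix_image[OF B])
    then show "ennreal (conic_intrinsic_volume k ((*v) (A ** X) ` C)) =
        (\<Sum>D\<in>faces k C. cone_angle ((*v) (A ** X) ` D) * cone_angle ((*v) (G ** X) ` normal_cone D C))"
      using measurable_space[OF measurable_haar_image_polyhedral_cone[OF A C] Xs]
      by (simp add: ennreal_conic_intrinsic_volume sum_faces_matrix_image[OF B])
  qed
  also have "\<dots> = (\<Sum>D\<in>faces k C.
      \<integral>\<^sup>+X. cone_angle ((*v) (A ** X) ` D) * cone_angle ((*v) (G ** X) ` normal_cone D C) \<partial>haar)"
  proof (rule nn_integral_sum)
    fix D assume D: "D \<in> faces k C"
    note p = normal_cone_properties[OF C D]
    show "(\<lambda>X. cone_angle ((*v) (A ** X) ` D) * cone_angle ((*v) (G ** X) ` normal_cone D C)) \<in> borel_measurable haar"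
      by (intro borel_measurable_times_ennreal borel_measurable_cone_angle_image p A G)
  qed
  also have "\<dots> = (\<Sum>D\<in>faces k C. cone_angle D * cone_angle (normal_cone D C))"
  proof (rule sum.cong)
    fix D assume D: "D \<in> faces k C"
    note p = normal_cone_properties[OF C D]
    show "(\<integral>\<^sup>+X. cone_angle ((*v) (A ** X) ` D) * cone_angle ((*v) (G ** X) ` normal_cone D C) \<partial>haar)
        = cone_angle D * cone_angle (normal_cone D C)"
      by (rule flag_angle_average[OF p(5-8) p(1-4) _ A G]) (simp add: p(9))
  qed simp
  also have "\<dots> = ennreal (conic_intrinsic_volume k C)" using ennreal_conic_intrinsic_volume[OF C] by simp
  finally show "(\<integral>\<^sup>+X. ennreal (conic_intrinsic_volume k ((*v) (A ** X) ` C)) \<partial>haar) = ennreal (conic_intrinsic_volume k C)" .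
qed

text \<open>
  Equality of laws passes to the trace of the Fell \<sigma>-algebra on the polyhedra, where sums over faces are
  measurable functions.
\<close>

lemma distr_polyhedra_eqI:
  fixes P Q :: "'w \<Rightarrow> (real^'n) set"
  assumes P: "P \<in> M \<rightarrow>\<^sub>M polyhedra" and Q: "Q \<in> M \<rightarrow>\<^sub>M polyhedra"
    and eq: "distr M closed_sets_borel P = distr M closed_sets_borel Q"
  shows "distr M polyhedra P = distr M polyhedra Q"
proof (rule measure_eqI)
  fix S assume "S \<in> sets (distr M polyhedra P)"
  then have S: "S \<in> sets polyhedra" by simp
  then obtain B where B: "B \<in> sets closed_sets_borel" "S = {Q. polyhedron Q \<and> Q \<noteq> {}} \<inter> B"
    unfolding polyhedra_def sets_restrict_space by auto
  have *: "emeasure (distr M polyhedra f) S = emeasure (distr M closed_sets_borel f) B"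
    if f: "f \<in> M \<rightarrow>\<^sub>M polyhedra" for f
  proof -
    have f': "f \<in> M \<rightarrow>\<^sub>M closed_sets_borel"
      using f unfolding measurable_polyhedra_iff random_nonempty_closed_def by blast
    have "f -` S \<inter> space M = f -` B \<inter> space M"
      using measurable_space[OF f] B(2) by (auto simp: space_polyhedra)
    then show ?thesis by (simp add: emeasure_distr[OF f S] emeasure_distr[OF f' B(1)])
  qed
  show "emeasure (distr M polyhedra P) S = emeasure (distr M polyhedra Q) S"
    using *[OF P] *[OF Q] eq by simp
qed simp

text \<open>
  Used to turn a polyhedron that is almost surely nonempty into one that always is, without destroying
  rotation invariance.
\<close>

lemma measurable_replace_empty:
  "(\<lambda>F :: 'a::euclidean_space set. if F = {} then UNIV else F) \<in> closed_sets_borel \<rightarrow>\<^sub>M closed_sets_borel"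
proof (rule measurable_closed_sets_borelI)
  show "closed (if F = {} then UNIV else F)" if "F \<in> space closed_sets_borel" for F :: "'a set"
    using that by (simp add: space_closed_sets_borel)
  fix K :: "'a set" assume K: "compact K"
  have ne: "{F. closed F \<and> F \<noteq> {}} = (\<Union>n. {F. closed F \<and> F \<inter> cball (0::'a) (real n) \<noteq> {}})"
  proof
    show "{F. closed F \<and> F \<noteq> {}} \<subseteq> (\<Union>n. {F. closed F \<and> F \<inter> cball (0::'a) (real n) \<noteq> {}})"
    proof
      fix F :: "'a set" assume "F \<in> {F. closed F \<and> F \<noteq> {}}"
      then obtain x where x: "x \<in> F" "closed F" by auto
      obtain n where "norm x \<le> real n" using real_arch_simple by blast
      then have "x \<in> F \<inter> cball 0 (real n)" using x by simp
      then show "F \<in> (\<Union>n. {F. closed F \<and> F \<inter> cball (0::'a) (real n) \<noteq> {}})" using x(2) by blast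
    qed
  qed auto
  have "{F. closed F \<and> F \<noteq> {}} \<in> sets (closed_sets_borel :: 'a set measure)"
    unfolding ne by (intro sets.countable_UN) (auto intro: hit_sets_closed_sets_borel)
  then have "space closed_sets_borel - {F. closed F \<and> F \<noteq> {}} \<in> sets (closed_sets_borel :: 'a set measure)"
    by (rule sets.compl_sets)
  then have e: "{{}} \<in> sets (closed_sets_borel :: 'a set measure)"
  proof -
    have "space closed_sets_borel - {F. closed F \<and> F \<noteq> {}} = ({{}} :: 'a set set)"
      by (auto simp: space_closed_sets_borel)
    then show ?thesis using \<open>space closed_sets_borel - _ \<in> _\<close> by simp
  qed
  show "{F \<in> space closed_sets_borel. (if F = {} then UNIV else F) \<inter> K \<noteq> {}} \<in> sets closed_sets_borel"
  proof (cases "K = {}")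
    case False
    then have "{F \<in> space closed_sets_borel. (if F = {} then UNIV else F) \<inter> K \<noteq> {}} =
        {{}} \<union> {F. closed F \<and> F \<inter> K \<noteq> {}}"
      by (auto simp: space_closed_sets_borel)
    then show ?thesis using sets.Un[OF e hit_sets_closed_sets_borel[OF K]] by (simp only:)
  qed simp
qed

theorem theorem4p22:
  fixes M :: "'w measure"
    and P :: "'w \<Rightarrow> (real ^ 'n) set"
    and A :: "real ^ 'n ^ 'n"
  assumes "prob_space M"
    and "random_polyhedral_set M P"
    and "AE \<omega> in M. interior (P \<omega>) \<noteq> {}"
    and "rotation_invariant_law M P"
    and "det A \<noteq> 0"
  shows
    "(\<forall>j<CARD('n). \<forall>k\<le>CARD('n).
        (\<integral>\<^sup>+ \<omega>. ennreal (\<Sum>G\<in>faces j ((\<lambda>x. A *v x) ` P \<omega>).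
            grassmann_angle k (tangent_cone G ((\<lambda>x. A *v x) ` P \<omega>))) \<partial>M)
        = (\<integral>\<^sup>+ \<omega>. ennreal (\<Sum>F\<in>faces j (P \<omega>).
            grassmann_angle k (tangent_cone F (P \<omega>))) \<partial>M)
        \<and>
        (\<integral>\<^sup>+ \<omega>. ennreal (\<Sum>G\<in>faces j ((\<lambda>x. A *v x) ` P \<omega>).
            conic_intrinsic_volume k (tangent_cone G ((\<lambda>x. A *v x) ` P \<omega>))) \<partial>M)
        = (\<integral>\<^sup>+ \<omega>. ennreal (\<Sum>F\<in>faces j (P \<omega>).
            conic_intrinsic_volume k (tangent_cone F (P \<omega>))) \<partial>M))
     \<and>
     (\<forall>j<CARD('n).
        (\<integral>\<^sup>+ \<omega>. ennreal (\<Sum>G\<in>faces j ((\<lambda>x. A *v x) ` P \<omega>).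
            solid_angle (tangent_cone G ((\<lambda>x. A *v x) ` P \<omega>))) \<partial>M)
        = (\<integral>\<^sup>+ \<omega>. ennreal (\<Sum>F\<in>faces j (P \<omega>).
            solid_angle (tangent_cone F (P \<omega>))) \<partial>M))"
proof -
  define r :: "(real^'n) set \<Rightarrow> (real^'n) set" where "r F = (if F = {} then UNIV else F)" for F
  have rm: "r \<in> closed_sets_borel \<rightarrow>\<^sub>M closed_sets_borel"
    unfolding r_def by (rule measurable_replace_empty)
  define Q where "Q \<omega> = r (P \<omega>)" for \<omega>
  have Pm: "P \<in> M \<rightarrow>\<^sub>M closed_sets_borel" and poly: "\<And>\<omega>. \<omega> \<in> space M \<Longrightarrow> polyhedron (P \<omega>)"
    using assms(2) by (auto simp: random_polyhedral_set_def)
  have Qm': "Q \<in> M \<rightarrow>\<^sub>M closed_sets_borel" unfolding Q_def by (rule measurable_compose[OF Pm rm])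
  have Qm: "Q \<in> M \<rightarrow>\<^sub>M polyhedra"
    unfolding measurable_polyhedra_iff random_nonempty_closed_def
    using Qm' poly by (auto simp: Q_def r_def)
  have inv: "distr M polyhedra (\<lambda>\<omega>. T ` Q \<omega>) = distr M polyhedra Q"
    if T: "orthogonal_transformation T" for T
  proof (rule distr_polyhedra_eqI)
    have lin: "linear T" using T by (simp add: orthogonal_transformation_def)
    have X: "(*v) (matrix T) = T" using matrix_vector_mul(2)[OF lin] by simp
    have "orthogonal_matrix (matrix T)" using T by (simp add: orthogonal_transformation_matrix)
    then have det: "det (matrix T) \<noteq> 0" by (rule det_orthogonal_matrix_nonzero)
    have "(\<lambda>\<omega>. (*v) (matrix T) ` Q \<omega>) \<in> M \<rightarrow>\<^sub>M polyhedra"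
      by (rule measurable_polyhedra_matrix_image[OF Qm]) (simp_all add: det)
    then show TQ: "(\<lambda>\<omega>. T ` Q \<omega>) \<in> M \<rightarrow>\<^sub>M polyhedra" by (simp only: X)
    show "Q \<in> M \<rightarrow>\<^sub>M polyhedra" by (rule Qm)
    have TPm: "(\<lambda>\<omega>. T ` P \<omega>) \<in> M \<rightarrow>\<^sub>M closed_sets_borel"
    proof (rule measurable_closed_sets_borelI)
      fix \<omega> assume "\<omega> \<in> space M"
      then show "closed (T ` P \<omega>)"
        using poly polyhedron_imp_closed closed_injective_linear_image[OF _ lin orthogonal_transformation_inj[OF T]] by blast
    next
      fix K :: "(real^'n) set" assume K: "compact K"
      have "compact (T -` K)"
      proof -
        obtain S where S: "orthogonal_transformation S" "\<And>x. S (T x) = x" "\<And>x. T (S x) = x"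
          using orthogonal_transformation_inv[OF T] orthogonal_transformation_bij[OF T]
          by (metis bij_inv_eq_iff)
        then have "T -` K = S ` K" by (auto simp: image_iff) metis
        moreover have "continuous_on K S"
          using S(1) by (intro linear_continuous_on) (simp add: orthogonal_transformation_def linear_conv_bounded_linear)
        ultimately show ?thesis using K compact_continuous_image by metis
      qed
      from measurable_sets[OF Pm hit_sets_closed_sets_borel[OF this]]
      have "P -` {F. closed F \<and> F \<inter> T -` K \<noteq> {}} \<inter> space M \<in> sets M" .
      moreover have "P -` {F. closed F \<and> F \<inter> T -` K \<noteq> {}} \<inter> space M = {\<omega> \<in> space M. T ` P \<omega> \<inter> K \<noteq> {}}"
        using poly polyhedron_imp_closed by auto
      ultimately show "{\<omega> \<in> space M. T ` P \<omega> \<inter> K \<noteq> {}} \<in> sets M" by simp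
    qed
    have "T ` r F = r (T ` F)" for F
      using orthogonal_transformation_surj[OF T] by (simp add: r_def)
    then have "distr M closed_sets_borel (\<lambda>\<omega>. T ` Q \<omega>) = distr (distr M closed_sets_borel (\<lambda>\<omega>. T ` P \<omega>)) closed_sets_borel r"
      unfolding Q_def by (subst distr_distr[OF rm TPm]) (simp add: comp_def)
    also have "\<dots> = distr (distr M closed_sets_borel P) closed_sets_borel r"
      using assms(4) T by (simp add: rotation_invariant_law_def)
    also have "\<dots> = distr M closed_sets_borel Q"
      unfolding Q_def by (subst distr_distr[OF rm Pm]) (simp add: comp_def)
    finally show "distr M closed_sets_borel (\<lambda>\<omega>. T ` Q \<omega>) = distr M closed_sets_borel Q" .
  qed
  have PQ: "AE \<omega> in M. P \<omega> = Q \<omega>" using assms(3) by eventually_elim (auto simp: Q_def r_def)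
  have key: "(\<integral>\<^sup>+ \<omega>. ennreal (\<Sum>G\<in>faces j ((\<lambda>x. A *v x) ` P \<omega>). \<Phi> (tangent_cone G ((\<lambda>x. A *v x) ` P \<omega>))) \<partial>M)
      = (\<integral>\<^sup>+ \<omega>. ennreal (\<Sum>F\<in>faces j (P \<omega>). \<Phi> (tangent_cone F (P \<omega>))) \<partial>M)"
    if \<Phi>: "averaging_functional \<Phi>" for \<Phi> j
  proof -
    have nn: "\<Phi> C \<ge> 0" for C using \<Phi> by (simp add: averaging_functional_def)
    have sum: "ennreal (\<Sum>F\<in>S. \<Phi> (t F)) = (\<Sum>F\<in>S. ennreal (\<Phi> (t F)))"
      for S :: "(real^'n) set set" and t by (rule sum_ennreal[symmetric]) (rule nn)
    have "(\<integral>\<^sup>+ \<omega>. ennreal (\<Sum>G\<in>faces j ((*v) A ` P \<omega>). \<Phi> (tangent_cone G ((*v) A ` P \<omega>))) \<partial>M)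
        = (\<integral>\<^sup>+ \<omega>. (\<Sum>G\<in>faces j ((*v) A ` Q \<omega>). ennreal (\<Phi> (tangent_cone G ((*v) A ` Q \<omega>)))) \<partial>M)"
      unfolding sum using PQ by (intro nn_integral_cong_AE) auto
    also have "\<dots> = (\<integral>\<^sup>+ \<omega>. (\<Sum>F\<in>faces j (Q \<omega>). ennreal (\<Phi> (tangent_cone F (Q \<omega>)))) \<partial>M)"
      by (rule expected_tangent_sum_invariant[OF assms(1) Qm inv assms(5) \<Phi>])
    also have "\<dots> = (\<integral>\<^sup>+ \<omega>. ennreal (\<Sum>F\<in>faces j (P \<omega>). \<Phi> (tangent_cone F (P \<omega>))) \<partial>M)"
      unfolding sum using PQ by (intro nn_integral_cong_AE) auto
    finally show ?thesis .
  qed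
  show ?thesis
    by (intro conjI allI impI key averaging_functional_grassmann_angle
        averaging_functional_conic_intrinsic_volume averaging_functional_solid_angle)
qed

end
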